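(* Let $\alpha_i\in[0,\infty]$, $i\ge1$, and let $p_i=n^{-\alpha_i}$, $i\ge1$. Let $q=\min\{i\ge1:\alpha_i>0\}$ and let $k^*\ge1$ be the critical dimension, i.e. $$\sum_{i=1}^{k^*}\binom{k^*}{i}\alpha_i<1<\sum_{i=1}^{k^*+1}\binom{k^*+1}{i}\alpha_i\quad\text{and}\quad q\le k^*.$$ In the case $q<k^*$, suppose also that for every $k_0=q+1,\dots,k^*$, $$\frac{k^*-q}{k^*+1}\binom{k^*+1}{q+1}\alpha_q+\sum_{j=q+1}^{k_0}\binom{k^*+1}{j+1}\alpha_j<k_0-q.$$ Assume moreover that $$\sum_{i=q}^{k^*+1}\binom{k^*+1}{i}\alpha_i-1\ \ge\ \frac{q\,(k^*+2)!}{(q+1)!\,(k^*+1-q)!\,(k^*+1)}\,\alpha_q.$$ Let $\beta_{k^*,n}$ be the $k^*$-th Betti number of the multi-parameter random simplicial complex $K(n;p_1,\dots,p_{n-1})$ and let $$\tau_{k^*}=k^*+1-\sum_{i=1}^{k^*}\binom{k^*+1}{i+1}\alpha_i.$$ Then for every $\varepsilon>0$ there exist constants $C_1(\varepsilon),C_2(\varepsilon)>0$ (not depending on $n$) such that for all large enough $n$, $$\exp\Bigl\{-C_1(\varepsilon)n^{q+1-\binom{k^*}{q}\alpha_q}\log n\Bigr\}\le\mathbb{P}\Bigl(\beta_{k^*,n}\ge(1+\varepsilon)\frac{n^{\tau_{k^*}}}{(k^*+1)!}\Bigr)\le\exp\Bigl\{-C_2(\varepsilon)n^{q+1-\binom{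k^*}{q}\alpha_q}\Bigr\}.$$
   Context: Random complex: $K(n;p_1,\dots,p_{n-1})$ is built on the vertex set $[n]=\{1,\dots,n\}$ recursively: all $n$ vertices are present; for $i=1,\dots,n-1$, once the $(i-1)$-skeleton has been constructed, each potential $i$-simplex (set of $i+1$ vertices) whose whole boundary lies in that $(i-1)$-skeleton is added with probability $p_i$, independently of the other potential $i$-simplices. Convention: $n^{-\infty}=0$. The $j$-th Betti number of a finite simplicial complex is the rank of its $j$-th simplicial homology group with integer coefficients (equivalently, the dimension of the $j$-th homology over $\mathbb{Q}$). *)

theory Defs
  imports
    "HOL-Algebra.Free_Abelian_Groups"
    "HOL-Library.Extended_Real"
    "HOL-Probability.Product_PMF"
begin

section \<open>Simplicial homology and Betti numbers\<close>

text \<open>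
  A simplicial complex on vertices in \<open>nat\<close> is given by its set of (nonempty, finite) simplices.
  Chains are written in the basis of simplices, each oriented by the natural order of its
  vertices.
\<close>

definition simplices :: "nat set set \<Rightarrow> nat \<Rightarrow> nat set set" where
  "simplices K j = {\<sigma> \<in> K. card \<sigma> = j + 1}"

text \<open>
  In the sum below, \<open>card {u \<in> \<sigma>. u < v}\<close> is the position of \<open>v\<close> in the increasing
  enumeration of \<open>\<sigma>\<close>, counted from 0. The homology is unreduced: vertices have boundary 0.
\<close>

definition face_boundary :: "nat set \<Rightarrow> (nat set \<Rightarrow>\<^sub>0 int)" where
  "face_boundary \<sigma> =
     (if card \<sigma> \<le> 1 then 0
      else \<Sum>v\<in>\<sigma>. frag_cmul ((- 1) ^ card {u \<in> \<sigma>. u < v}) (frag_of (\<sigma> - {v})))"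

definition simplicial_boundary :: "(nat set \<Rightarrow>\<^sub>0 int) \<Rightarrow> (nat set \<Rightarrow>\<^sub>0 int)" where
  "simplicial_boundary = frag_extend face_boundary"

definition simplicial_chain_group :: "nat set set \<Rightarrow> nat \<Rightarrow> (nat set \<Rightarrow>\<^sub>0 int) monoid" where
  "simplicial_chain_group K j = free_Abelian_group (simplices K j)"

definition simplicial_cycles :: "nat set set \<Rightarrow> nat \<Rightarrow> (nat set \<Rightarrow>\<^sub>0 int) set" where
  "simplicial_cycles K j = {c \<in> carrier (simplicial_chain_group K j). simplicial_boundary c = 0}"

definition simplicial_boundaries :: "nat set set \<Rightarrow> nat \<Rightarrow> (nat set \<Rightarrow>\<^sub>0 int) set" where
  "simplicial_boundaries K j = simplicial_boundary ` carrier (simplicial_chain_group K (j + 1))"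

definition simplicial_homology_group :: "nat set set \<Rightarrow> nat \<Rightarrow> (nat set \<Rightarrow>\<^sub>0 int) set monoid" where
  "simplicial_homology_group K j =
     subgroup_generated (simplicial_chain_group K j) (simplicial_cycles K j)
       Mod simplicial_boundaries K j"

definition int_independent :: "('a, 'b) monoid_scheme \<Rightarrow> 'a set \<Rightarrow> bool" where
  "int_independent G S \<longleftrightarrow>
     finite S \<and> S \<subseteq> carrier G \<and>
     (\<forall>c :: 'a \<Rightarrow> int. finprod G (\<lambda>x. x [^]\<^bsub>G\<^esub> c x) S = \<one>\<^bsub>G\<^esub> \<longrightarrow> (\<forall>x\<in>S. c x = 0))"

text \<open>
  The supremum is a maximum for abelian groups of finite rank, in particular for the finitely
  generated ones considered here.
\<close>

definition abelian_rank :: "('a, 'b) monoid_scheme \<Rightarrow> nat" where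
  "abelian_rank G = Sup {card S | S. int_independent G S}"

definition betti :: "nat \<Rightarrow> nat set set \<Rightarrow> nat" where
  "betti j K = abelian_rank (simplicial_homology_group K j)"


section \<open>The multi-parameter random simplicial complex\<close>

definition potential_simplices :: "nat \<Rightarrow> nat \<Rightarrow> nat set set \<Rightarrow> nat set set" where
  "potential_simplices n i X =
     {\<sigma>. \<sigma> \<subseteq> {1..n} \<and> card \<sigma> = i + 1 \<and> (\<forall>\<tau>. \<tau> \<noteq> {} \<and> \<tau> \<subset> \<sigma> \<longrightarrow> \<tau> \<in> X)}"

text \<open>
  \<open>random_skeleton n p i\<close> is the law of the \<open>i\<close>-skeleton. Given the previous skeleton \<open>X\<close>, the
  family \<open>F\<close> consists of independent coins with success probability \<open>p (Suc i)\<close>, one for each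
  potential simplex.
\<close>

primrec random_skeleton :: "nat \<Rightarrow> (nat \<Rightarrow> real) \<Rightarrow> nat \<Rightarrow> nat set set pmf" where
  "random_skeleton n p 0 = return_pmf {{v} | v. v \<in> {1..n}}"
| "random_skeleton n p (Suc i) =
     bind_pmf (random_skeleton n p i) (\<lambda>X.
       map_pmf (\<lambda>F. X \<union> {\<sigma> \<in> potential_simplices n (Suc i) X. F \<sigma>})
         (Pi_pmf (potential_simplices n (Suc i) X) False (\<lambda>_. bernoulli_pmf (p (Suc i)))))"

definition random_complex :: "nat \<Rightarrow> (nat \<Rightarrow> real) \<Rightarrow> nat set set pmf" where
  "random_complex n p = random_skeleton n p (n - 1)"

text \<open>\<open>neg_power n a\<close> is \<open>n\<close> to the power \<open>-a\<close> for \<open>a\<close> in \<open>[0, \<infinity>]\<close>.\<close>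

definition neg_power :: "nat \<Rightarrow> ereal \<Rightarrow> real" where
  "neg_power n a = (if a = \<infinity> then 0 else real n powr (- real_of_ereal a))"

end

theory Submission
  imports Defs
begin

text \<open>
  Write \<open>f\<^sub>j\<close> for the number of \<open>j\<close>-simplices; then \<open>f\<^sub>k - f\<^sub>k\<^sub>-\<^sub>1 - f\<^sub>k\<^sub>+\<^sub>1 \<le> \<beta>\<^sub>k \<le> f\<^sub>k\<close>.

  Upper bound: moments of \<open>f\<^sub>k\<close>. If a set \<open>Q\<close> of at most \<open>c r\<close> faces is forced to be present,
  where \<open>r = n\<^sup>q\<^sup>+\<^sup>1 p\<^sub>q\<^sup>D\<close> and \<open>D = k choose q\<close>, the expectation of \<open>f\<^sub>k\<close> grows by a factor of at most
  \<open>1 + \<epsilon> / 2\<close>. Hence the \<open>m\<close>-th moment with \<open>m\<close> of order \<open>r\<close> is at most the \<open>m\<close>-th power of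
  \<open>(1 + \<epsilon> / 2) E f\<^sub>k\<close>, and Markov's inequality applies.

  Lower bound: plant all \<open>q\<close>-simplices inside boundedly many disjoint blocks of order
  \<open>n p\<^sub>q\<^sup>D\<^sup>/\<^sup>(\<^sup>q\<^sup>+\<^sup>1\<^sup>)\<close> vertices. This costs a factor \<open>exp (- C r log n)\<close> and makes the conditional expectation of
  \<open>f\<^sub>k - f\<^sub>k\<^sub>-\<^sub>1 - f\<^sub>k\<^sub>+\<^sub>1\<close> at least twice the target; since this difference never exceeds \<open>n\<^sup>k\<^sup>+\<^sup>1\<close>, the
  target is reached with at least polynomially small conditional probability.
\<close>

section \<open>Products of functions of few coordinates\<close>

text \<open>The exponents explain the hypotheses. Without planting, the expectation of f_{k-1}
  divided by that of f_k has order n to the power \<Sum> (k choose i) \<alpha>_i - 1, and for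
  f_{k+1} the power is 1 - \<Sum> (k+1 choose i) \<alpha>_i; the critical dimension is the one where
  both are negative. The rate r arises as follows. If s vertices carry all possible q-simplices,
  they contain about s^(k+1) \<Prod>_{i>q} p_i^(k+1 choose i+1) simplices of dimension k. This has
  the order of E f_k exactly for s = n p_q^(D/(q+1)), because (q+1) (k+1 choose q+1) = (k+1) D, and
  then s^(q+1) = r. That fewer forced q-faces cannot have this effect is a Finner inequality in
  which each vertex of a k-simplex lies in D of its q-faces. Forced faces of higher dimension could
  do better; the intermediate conditions exclude this. The obstacle in the lower bound is that
  planting also creates (k+1)-simplices, which enter with a minus sign. The last hypothesis keeps
  those inside a block at the order of E f_k, but it allows equality, so that only constants are
  left to separate the two counts.\<close>

lemma prod_powr_le_affine:
  fixes b :: "'i \<Rightarrow> real"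
  assumes "finite J" "\<And>i. i \<in> J \<Longrightarrow> 0 \<le> b i" "0 < t" "real (card J) * t \<le> 1"
  shows "(\<Prod>i\<in>J. b i powr t) \<le> 1 + t * (\<Sum>i\<in>J. b i - 1)"
proof -
  \<comment> \<open>\<open>A\<close> is the weighted arithmetic mean of the \<open>b i\<close>, each
    with weight \<open>t\<close>, and of 1 with the remaining weight \<open>1 - t * card J\<close>:
    this is weighted AM-GM. It comes from adding \<open>ln x \<le> x - 1\<close> at the points
    \<open>b i / A\<close> and \<open>1 / A\<close>.\<close>
  define A where "A = 1 + t * (\<Sum>i\<in>J. b i - 1)"
  have A_eq: "A = (1 - t * card J) + t * (\<Sum>i\<in>J. b i)"
    by (simp add: A_def sum_subtractf algebra_simps)
  show ?thesis
  proof (cases "\<exists>i\<in>J. b i = 0")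
    case True
    then have "(\<Prod>i\<in>J. b i powr t) = 0"
      using assms(1) by (auto intro!: prod_zero)
    moreover have "0 \<le> A"
      unfolding A_eq using assms by (intro add_nonneg_nonneg mult_nonneg_nonneg sum_nonneg) (auto simp: mult.commute)
    ultimately show ?thesis by (simp add: A_def)
  next
    case False
    then have pos: "0 < b i" if "i \<in> J" for i
      using assms(2)[OF that] that by (metis less_eq_real_def)
    have "0 < A"
    proof (cases "J = {}")
      case True then show ?thesis by (simp add: A_def)
    next
      case False
      then have "0 < (\<Sum>i\<in>J. b i)" using assms(1) pos by (intro sum_pos) auto
      then show ?thesis unfolding A_eq using assms by (intro add_nonneg_pos) (auto simp: mult.commute)
    qed
    have "t * (ln (b i) - ln A) \<le> t * (b i / A - 1)" if "i \<in> J" for i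
      using ln_le_minus_one[of "b i / A"] pos[OF that] \<open>0 < A\<close> assms(3) by (simp add: ln_div)
    then have "(\<Sum>i\<in>J. t * (ln (b i) - ln A)) \<le> (\<Sum>i\<in>J. t * (b i / A - 1))"
      by (rule sum_mono)
    then have 1: "t * (\<Sum>i\<in>J. ln (b i)) - t * card J * ln A \<le> t * (\<Sum>i\<in>J. b i) / A - t * card J"
      by (simp add: sum_subtractf sum_divide_distrib[symmetric] sum_distrib_left[symmetric] algebra_simps)
    have "(1 - t * card J) * - ln A \<le> (1 - t * card J) * (1 / A - 1)"
      using ln_le_minus_one[of "1 / A"] \<open>0 < A\<close> assms(4)
      by (intro mult_left_mono) (auto simp: ln_div mult.commute)
    with 1 have "t * (\<Sum>i\<in>J. ln (b i)) - ln A \<le> (t * (\<Sum>i\<in>J. b i) + (1 - t * card J)) / A - 1"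
      by (simp add: add_divide_distrib diff_divide_distrib algebra_simps)
    also have "\<dots> = 0" using \<open>0 < A\<close> by (simp add: A_eq)
    finally have "exp (t * (\<Sum>i\<in>J. ln (b i))) \<le> A"
      using \<open>0 < A\<close> by (simp add: ln_ge_iff[symmetric])
    moreover have "exp (t * (\<Sum>i\<in>J. ln (b i))) = (\<Prod>i\<in>J. b i powr t)"
      using assms(1) pos by (simp add: sum_distrib_left exp_sum powr_def less_imp_neq[symmetric] cong: prod.cong)
    ultimately show ?thesis by (simp add: A_def)
  qed
qed

text \<open>Hoelder's inequality for averages, with equal exponents of total at most 1. Once each
  factor is divided by its own average, the affine bound of the previous lemma has a linear term
  that averages to zero.\<close>

lemma average_prod_powr_le:
  fixes h :: "'i \<Rightarrow> 'a \<Rightarrow> real"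
  assumes "finite V" "finite J" "\<And>i y. i \<in> J \<Longrightarrow> 0 \<le> h i y" "0 < t" "real (card J) * t \<le> 1"
    "V \<noteq> {}"
  shows "(\<Sum>y\<in>V. \<Prod>i\<in>J. h i y powr t) / card V \<le> (\<Prod>i\<in>J. ((\<Sum>y\<in>V. h i y) / card V) powr t)"
proof -
  define A where "A i = (\<Sum>y\<in>V. h i y) / card V" for i
  have cV: "0 < card V" using assms by (simp add: card_gt_0_iff)
  have A0: "0 \<le> A i" if "i \<in> J" for i
    unfolding A_def using assms that by (intro divide_nonneg_nonneg sum_nonneg) auto
  show ?thesis
  proof (cases "\<exists>i\<in>J. A i = 0")
    case True
    then obtain i where i: "i \<in> J" "A i = 0" by blast
    have "h i y = 0" if "y \<in> V" for y
      using i cV that assms by (simp add: A_def sum_nonneg_eq_0_iff)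
    then have "(\<Prod>i\<in>J. h i y powr t) = 0" if "y \<in> V" for y
      using i assms(2) that by (intro prod_zero) auto
    then have "(\<Sum>y\<in>V. \<Prod>i\<in>J. h i y powr t) = 0" by simp
    moreover have "0 \<le> (\<Prod>i\<in>J. A i powr t)" by (simp add: prod_nonneg)
    ultimately show ?thesis by (simp add: A_def)
  next
    case False
    then have pos: "0 < A i" if "i \<in> J" for i using A0[OF that] that by (metis less_eq_real_def)
    define B where "B = (\<Prod>i\<in>J. A i powr t)"
    have "(\<Prod>i\<in>J. h i y powr t) = B * (\<Prod>i\<in>J. (h i y / A i) powr t)" for y
      unfolding B_def prod.distrib[symmetric]
      using pos assms(3) by (intro prod.cong) (auto simp: powr_mult[symmetric] less_imp_neq[symmetric] less_imp_le)
    also have "B * (\<Prod>i\<in>J. (h i y / A i) powr t) \<le> B * (1 + t * (\<Sum>i\<in>J. h i y / A i - 1))" for y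
      using assms pos by (intro mult_left_mono prod_powr_le_affine) (auto simp: B_def prod_nonneg less_imp_le)
    finally have "(\<Sum>y\<in>V. \<Prod>i\<in>J. h i y powr t) \<le> (\<Sum>y\<in>V. B * (1 + t * (\<Sum>i\<in>J. h i y / A i - 1)))"
      by (rule sum_mono)
    also have "\<dots> = B * (card V + t * (\<Sum>i\<in>J. \<Sum>y\<in>V. (h i y / A i - 1)))"
      by (simp add: sum_distrib_left[symmetric] sum.distrib sum.swap[of _ V J])
    also have "(\<Sum>i\<in>J. \<Sum>y\<in>V. (h i y / A i - 1)) = (\<Sum>i\<in>J. 0)"
    proof (rule sum.cong[OF refl])
      fix i assume i: "i \<in> J"
      have "(\<Sum>y\<in>V. h i y) = A i * card V" using cV by (simp add: A_def)
      then show "(\<Sum>y\<in>V. (h i y / A i - 1)) = 0"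
        using pos[OF i] by (simp add: sum_subtractf sum_divide_distrib[symmetric])
    qed
    finally show ?thesis using cV by (simp add: B_def A_def field_simps)
  qed
qed

lemma sum_PiE_insert:
  assumes "v \<notin> R"
  shows "(\<Sum>x\<in>PiE (insert v R) (\<lambda>_. V). f x) = (\<Sum>x\<in>PiE R (\<lambda>_. V). \<Sum>y\<in>V. f (x(v := y)))"
proof -
  have "(\<Sum>x\<in>PiE (insert v R) (\<lambda>_. V). f x) = (\<Sum>(y, x)\<in>V \<times> PiE R (\<lambda>_. V). f (x(v := y)))"
    unfolding PiE_insert_eq using inj_combinator[OF assms]
    by (subst sum.reindex) (auto simp: case_prod_unfold)
  also have "\<dots> = (\<Sum>x\<in>PiE R (\<lambda>_. V). \<Sum>y\<in>V. f (x(v := y)))"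
    by (simp add: sum.cartesian_product[symmetric] sum.swap[of _ V])
  finally show ?thesis .
qed

text \<open>
  A Finner (generalised Loomis-Whitney) inequality. With averages instead of sums, factors that
  ignore a coordinate are harmless.
\<close>

lemma average_prod_powr_le_PiE:
  fixes h :: "'i \<Rightarrow> ('v \<Rightarrow> 'a) \<Rightarrow> real"
  assumes "finite R" "finite V" "V \<noteq> {}" "finite I" "0 < d"
    and "\<And>i x. i \<in> I \<Longrightarrow> 0 \<le> h i x"
    and "\<And>v. v \<in> R \<Longrightarrow> card {i \<in> I. \<exists>x y. h i (x(v := y)) \<noteq> h i x} \<le> d"
  shows "(\<Sum>x\<in>PiE R (\<lambda>_. V). \<Prod>i\<in>I. h i x powr (1 / d)) / card V ^ card R
    \<le> (\<Prod>i\<in>I. ((\<Sum>x\<in>PiE R (\<lambda>_. V). h i x) / card V ^ card R) powr (1 / d))"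
  using assms(1,6,7)
proof (induction R arbitrary: h rule: finite_induct)
  case empty
  then show ?case by simp
next
  case (insert v R)
  define c where "c = real (card V)"
  have c: "0 < c" using assms by (simp add: c_def card_gt_0_iff)
  \<comment> \<open>\<open>h'\<close> averages out the new coordinate \<open>v\<close>. At most
    \<open>d\<close> factors, those in \<open>J\<close>, depend on it, so their exponents
    \<open>1 / d\<close> have total at most 1 and the one-variable inequality applies; the other
    factors are pulled out of the average.\<close>
  define h' where "h' i x = (\<Sum>y\<in>V. h i (x(v := y))) / c" for i x
  define J where "J = {i \<in> I. \<exists>x y. h i (x(v := y)) \<noteq> h i x}"
  have J: "J \<subseteq> I" "finite J" "card J \<le> d"
    using insert.prems(2)[of v] assms(4) by (simp_all add: J_def del: fun_upd_apply)
  have indep: "h i (x(v := y)) = h i x" if "i \<in> I - J" for i x y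
    using that by (auto simp: J_def)
  have h'_nonneg: "0 \<le> h' i x" if "i \<in> I" for i x
    unfolding h'_def using c insert.prems(1)[OF that] by (intro divide_nonneg_nonneg sum_nonneg) auto
  have h'_indep: "h' i x = h i x" if "i \<in> I - J" for i x
    unfolding h'_def using indep[OF that] c by (simp add: c_def)
  have step: "(\<Sum>y\<in>V. \<Prod>i\<in>I. h i (x(v := y)) powr (1 / d)) / c \<le> (\<Prod>i\<in>I. h' i x powr (1 / d))" for x
  proof -
    have split: "(\<Prod>i\<in>I. F i) = (\<Prod>i\<in>J. F i) * (\<Prod>i\<in>I - J. F i)" for F :: "'i \<Rightarrow> real"
      using prod.subset_diff[OF J(1) assms(4), of F] by (simp add: mult.commute)
    have rest: "(\<Prod>i\<in>I - J. h i (x(v := y)) powr (1 / d)) = (\<Prod>i\<in>I - J. h i x powr (1 / d))" for y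
      using indep by (intro prod.cong) auto
    have "(\<Sum>y\<in>V. \<Prod>i\<in>I. h i (x(v := y)) powr (1 / d)) / c
      = (\<Sum>y\<in>V. \<Prod>i\<in>J. h i (x(v := y)) powr (1 / d)) / c * (\<Prod>i\<in>I - J. h i x powr (1 / d))"
      unfolding split rest by (simp add: sum_distrib_right)
    also have "\<dots> \<le> (\<Prod>i\<in>J. h' i x powr (1 / d)) * (\<Prod>i\<in>I - J. h i x powr (1 / d))"
      unfolding h'_def c_def
      using assms J insert.prems(1) by (intro mult_right_mono average_prod_powr_le) (auto simp: prod_nonneg)
    also have "\<dots> = (\<Prod>i\<in>I. h' i x powr (1 / d))"
      unfolding split using h'_indep by (intro arg_cong2[where f = times] prod.cong) auto
    finally show ?thesis .
  qed
  have "(\<Sum>x\<in>PiE (insert v R) (\<lambda>_. V). \<Prod>i\<in>I. h i x powr (1 / d)) / card V ^ card (insert v R)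
    = (\<Sum>x\<in>PiE R (\<lambda>_. V). (\<Sum>y\<in>V. \<Prod>i\<in>I. h i (x(v := y)) powr (1 / d)) / c) / card V ^ card R"
    using insert.hyps by (simp add: sum_PiE_insert c_def sum_divide_distrib[symmetric] field_simps)
  also have "\<dots> \<le> (\<Sum>x\<in>PiE R (\<lambda>_. V). \<Prod>i\<in>I. h' i x powr (1 / d)) / card V ^ card R"
    using step by (intro divide_right_mono sum_mono) auto
  also have "\<dots> \<le> (\<Prod>i\<in>I. ((\<Sum>x\<in>PiE R (\<lambda>_. V). h' i x) / card V ^ card R) powr (1 / d))"
  proof (rule insert.IH[OF h'_nonneg])
    fix w assume w: "w \<in> R"
    then have "w \<noteq> v" using insert.hyps by auto
    \<comment> \<open>Averaging over \<open>v\<close> creates no dependence on another coordinate,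
      so the bound \<open>d\<close> is inherited by \<open>h'\<close>.\<close>
    have "{i \<in> I. \<exists>x y. h' i (x(w := y)) \<noteq> h' i x} \<subseteq> {i \<in> I. \<exists>x y. h i (x(w := y)) \<noteq> h i x}"
    proof (rule subsetI, rule ccontr)
      fix i assume i: "i \<in> {i \<in> I. \<exists>x y. h' i (x(w := y)) \<noteq> h' i x}"
        and "i \<notin> {i \<in> I. \<exists>x y. h i (x(w := y)) \<noteq> h i x}"
      then have "h i (x(w := y)) = h i x" for x y by blast
      then have "h' i (x(w := y)) = h' i x" for x y
        using fun_upd_twist[OF \<open>w \<noteq> v\<close>[symmetric], of x] unfolding h'_def by metis
      with i show False by blast
    qed
    then have "card {i \<in> I. \<exists>x y. h' i (x(w := y)) \<noteq> h' i x} \<le> card {i \<in> I. \<exists>x y. h i (x(w := y)) \<noteq> h i x}"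
      using assms(4) by (intro card_mono) auto
    also have "\<dots> \<le> d" by (rule insert.prems(2)) (use w in simp)
    finally show "card {i \<in> I. \<exists>x y. h' i (x(w := y)) \<noteq> h' i x} \<le> d" .
  qed
  also have "\<dots> = (\<Prod>i\<in>I. ((\<Sum>x\<in>PiE (insert v R) (\<lambda>_. V). h i x) / card V ^ card (insert v R)) powr (1 / d))"
    using insert.hyps by (simp add: sum_PiE_insert c_def h'_def sum_divide_distrib[symmetric] field_simps)
  finally show ?case .
qed

section \<open>Betti numbers and face counts\<close>

text \<open>Fraction-free Gaussian elimination: each coordinate in \<open>B\<close> uses up at most
  one vector as pivot. It stands in for rank-nullity over the rationals, and the relations it yields
  have integer coefficients, hence can serve as exponents in a homology group. Coefficients vanish
  outside \<open>J\<close>, so a relation is determined by its values on \<open>J\<close> and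
  \<open>R\<close> can be a plain set.\<close>

lemma independent_integer_relations:
  fixes v :: "'j \<Rightarrow> 'b \<Rightarrow> int"
  assumes "finite B" "finite J"
  shows "\<exists>R. finite R \<and> card J \<le> card R + card B
    \<and> (\<forall>c\<in>R. (\<forall>j. j \<notin> J \<longrightarrow> c j = 0) \<and> (\<forall>b\<in>B. (\<Sum>j\<in>J. c j * v j b) = 0))
    \<and> (\<forall>e :: ('j \<Rightarrow> int) \<Rightarrow> int. (\<forall>j\<in>J. (\<Sum>c\<in>R. e c * c j) = 0) \<longrightarrow> (\<forall>c\<in>R. e c = 0))"
  using assms
proof (induction B arbitrary: J v rule: finite_induct)
  case empty
  define R where "R = (\<lambda>i j. if j = i then 1 else 0 :: int) ` J"
  have inj: "inj_on (\<lambda>i j. if j = i then 1 else 0 :: int) J"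
    by (rule inj_onI) (metis zero_neq_one)
  have "e (\<lambda>j. if j = i then 1 else 0) = 0"
    if e: "\<forall>j\<in>J. (\<Sum>c\<in>R. e c * c j) = 0" and i: "i \<in> J" for e :: "('j \<Rightarrow> int) \<Rightarrow> int" and i
  proof -
    have "(\<Sum>c\<in>R. e c * c i) = (\<Sum>k\<in>J. e (\<lambda>j. if j = k then 1 else 0) * (if i = k then 1 else 0))"
      unfolding R_def by (subst sum.reindex[OF inj]) simp
    also have "\<dots> = e (\<lambda>j. if j = i then 1 else 0)"
      using i empty by (simp add: if_distrib cong: if_cong)
    finally show ?thesis using e i by simp
  qed
  then have "\<forall>e :: ('j \<Rightarrow> int) \<Rightarrow> int. (\<forall>j\<in>J. (\<Sum>c\<in>R. e c * c j) = 0) \<longrightarrow> (\<forall>c\<in>R. e c = 0)"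
    unfolding R_def by blast
  moreover have "finite R" "card R = card J" using empty inj by (auto simp: R_def card_image)
  moreover have "\<forall>c\<in>R. \<forall>j. j \<notin> J \<longrightarrow> c j = 0" by (auto simp: R_def)
  ultimately show ?case by (intro exI[of _ R]) simp
next
  case (insert b B)
  show ?case
  proof (cases "\<forall>j\<in>J. v j b = 0")
    case True
    from insert.IH[OF insert.prems, of v] obtain R where R: "finite R" "card J \<le> card R + card B"
      "\<forall>c\<in>R. (\<forall>j. j \<notin> J \<longrightarrow> c j = 0) \<and> (\<forall>b\<in>B. (\<Sum>j\<in>J. c j * v j b) = 0)"
      "\<forall>e :: ('j \<Rightarrow> int) \<Rightarrow> int. (\<forall>j\<in>J. (\<Sum>c\<in>R. e c * c j) = 0) \<longrightarrow> (\<forall>c\<in>R. e c = 0)"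
      by (elim exE conjE) (rule that)
    show ?thesis using R True insert.hyps by (intro exI[of _ R]) simp
  next
    case False
    then obtain i where i: "i \<in> J" "v i b \<noteq> 0" by blast
    \<comment> \<open>Elimination with pivot entry \<open>v i b\<close>. Cross-multiplication
      instead of division keeps the entries integral and makes \<open>w j b = 0\<close>.\<close>
    define w where "w j b' = v i b * v j b' - v j b * v i b'" for j b'
    define J' where "J' = J - {i}"
    have J': "J = insert i J'" "i \<notin> J'" "finite J'" using i insert.prems by (auto simp: J'_def)
    from insert.IH[OF J'(3), of w] obtain R where fR: "finite R" and cR: "card J' \<le> card R + card B"
      and relR: "\<forall>c\<in>R. (\<forall>j. j \<notin> J' \<longrightarrow> c j = 0) \<and> (\<forall>b\<in>B. (\<Sum>j\<in>J'. c j * w j b) = 0)"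
      and indR: "\<forall>e :: ('j \<Rightarrow> int) \<Rightarrow> int. (\<forall>j\<in>J'. (\<Sum>c\<in>R. e c * c j) = 0) \<longrightarrow> (\<forall>c\<in>R. e c = 0)"
      by (elim exE conjE) (rule that)
    have R3: "c j = 0" if "c \<in> R" "j \<notin> J'" for c j using relR that by blast
    have R4: "(\<Sum>j\<in>J'. c j * w j b') = 0" if "c \<in> R" "b' \<in> B" for c b' using relR that by blast
    \<comment> \<open>Lifts a relation among the \<open>w j\<close> to one among the
      \<open>v j\<close>: old coefficients are scaled by the nonzero pivot entry, which preserves
      independence, and the coefficient at \<open>i\<close> is the one that cancels coordinate
      \<open>b\<close>.\<close>
    define T where "T c = (\<lambda>j. if j = i then - (\<Sum>j\<in>J'. c j * v j b) else v i b * c j)" for c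
    have injT: "inj_on T R"
    proof (rule inj_onI)
      fix c c' assume c: "c \<in> R" "c' \<in> R" "T c = T c'"
      show "c = c'"
      proof
        fix j
        show "c j = c' j"
        proof (cases "j \<in> J'")
          case True
          then have "j \<noteq> i" using J' by auto
          then show ?thesis using fun_cong[OF c(3), of j] i by (simp add: T_def)
        qed (simp add: R3 c(1,2))
      qed
    qed
    have rel: "(\<Sum>j\<in>J. T c j * v j b') = 0" if c: "c \<in> R" "b' \<in> insert b B" for c b'
    proof -
      have "(\<Sum>j\<in>J. T c j * v j b') = T c i * v i b' + (\<Sum>j\<in>J'. v i b * c j * v j b')"
        using J' by (auto simp: T_def intro!: sum.cong)
      also have "\<dots> = (\<Sum>j\<in>J'. c j * w j b')"
        by (simp add: T_def w_def sum_distrib_right sum_distrib_left algebra_simps sum_subtractf)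
      also have "\<dots> = 0"
        using R4[OF c(1)] c(2) by (auto simp: w_def algebra_simps)
      finally show ?thesis .
    qed
    have indep: "e (T c') = 0" if c': "c' \<in> R" and e: "\<forall>j\<in>J. (\<Sum>c\<in>R. e (T c) * T c j) = 0" for c' and e :: "('j \<Rightarrow> int) \<Rightarrow> int"
    proof (rule indR[rule_format, OF _ c', of "\<lambda>c. e (T c)"])
      fix j assume j: "j \<in> J'"
      then have "j \<noteq> i" using J' by auto
      then have "v i b * (\<Sum>c\<in>R. e (T c) * c j) = (\<Sum>c\<in>R. e (T c) * T c j)"
        by (simp add: T_def sum_distrib_left algebra_simps)
      also have "\<dots> = 0" using e j J' by auto
      finally show "(\<Sum>c\<in>R. e (T c) * c j) = 0" using i by simp
    qed
    show ?thesis
    proof (intro exI[of _ "T ` R"] conjI)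
      show "card J \<le> card (T ` R) + card (insert b B)"
        using fR cR J' insert.hyps by (simp add: card_image[OF injT])
      show "\<forall>c\<in>T ` R. (\<forall>j. j \<notin> J \<longrightarrow> c j = 0) \<and> (\<forall>b\<in>insert b B. (\<Sum>j\<in>J. c j * v j b) = 0)"
        using rel R3 J' by (auto simp: T_def simp del: sum.insert)
      show "\<forall>e :: ('j \<Rightarrow> int) \<Rightarrow> int. (\<forall>j\<in>J. (\<Sum>c\<in>T ` R. e c * c j) = 0) \<longrightarrow> (\<forall>c\<in>T ` R. e c = 0)"
        using indep by (simp add: sum.reindex[OF injT] del: sum.insert)
    qed (use fR in auto)
  qed
qed

section \<open>Integer chains and the simplicial boundary operator\<close>

lemma lookup_sum_frag_cmul:
  "Poly_Mapping.lookup (\<Sum>x\<in>A. frag_cmul (c x) (f x)) y = (\<Sum>x\<in>A. c x * Poly_Mapping.lookup (f x) y)"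
  by (simp add: lookup_sum)

lemma frag_expand:
  assumes "finite J" "Poly_Mapping.keys c \<subseteq> J"
  shows "c = (\<Sum>j\<in>J. frag_cmul (Poly_Mapping.lookup c j) (frag_of j))"
proof (rule poly_mapping_eqI)
  fix y
  have "(\<Sum>j\<in>J. Poly_Mapping.lookup c j * (if j = y then 1 else 0)) = Poly_Mapping.lookup c y"
    using assms by (auto simp: if_distrib in_keys_iff cong: if_cong)
  then show "Poly_Mapping.lookup c y
    = Poly_Mapping.lookup (\<Sum>j\<in>J. frag_cmul (Poly_Mapping.lookup c j) (frag_of j)) y"
    by (simp add: lookup_sum_frag_cmul eq_commute)
qed

lemma simplicial_boundary_sum:
  assumes "finite J"
  shows "simplicial_boundary (\<Sum>j\<in>J. frag_cmul (c j) (f j)) = (\<Sum>j\<in>J. frag_cmul (c j) (simplicial_boundary (f j)))"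
  using assms unfolding simplicial_boundary_def by (subst frag_extend_sum) (simp_all add: frag_extend_cmul o_def)

lemma simplicial_boundary_frag_of [simp]: "simplicial_boundary (frag_of \<sigma>) = face_boundary \<sigma>"
  by (simp add: simplicial_boundary_def)

lemma finite_simplices: "finite K \<Longrightarrow> finite (simplices K j)"
  by (simp add: simplices_def)

lemma keys_sum_frag_cmul:
  assumes "\<And>i. i \<in> I \<Longrightarrow> Poly_Mapping.keys (f i) \<subseteq> A"
  shows "Poly_Mapping.keys (\<Sum>i\<in>I. frag_cmul (c i) (f i)) \<subseteq> A"
  by (rule order_trans[OF keys_sum]) (meson UN_least assms keys_cmul order_trans)

lemma keys_face_boundary:
  assumes "\<And>\<sigma> \<tau>. \<sigma> \<in> K \<Longrightarrow> \<tau> \<subseteq> \<sigma> \<Longrightarrow> \<tau> \<noteq> {} \<Longrightarrow> \<tau> \<in> K" "\<sigma> \<in> simplices K (Suc j)"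
  shows "Poly_Mapping.keys (face_boundary \<sigma>) \<subseteq> simplices K j"
proof -
  have card: "card \<sigma> = j + 2" "\<sigma> \<in> K" using assms(2) by (auto simp: simplices_def)
  have "\<sigma> - {v} \<in> simplices K j" if "v \<in> \<sigma>" for v
  proof -
    have "finite \<sigma>" using card by (simp add: card_ge_0_finite)
    then have c: "card (\<sigma> - {v}) = j + 1" using card that by simp
    moreover from this have "\<sigma> - {v} \<noteq> {}" by (metis Suc_eq_plus1 card.empty nat.distinct(1))
    ultimately show ?thesis using assms(1)[of \<sigma> "\<sigma> - {v}"] card by (auto simp: simplices_def)
  qed
  then have "Poly_Mapping.keys (frag_of (\<sigma> - {v})) \<subseteq> simplices K j" if "v \<in> \<sigma>" for v
    using that by simp
  then show ?thesis
    using card unfolding face_boundary_def by (simp add: keys_sum_frag_cmul)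
qed

text \<open>The double sum over ordered pairs of removed vertices is antisymmetric, so it equals its
  own negative and vanishes over the integers. Three vertices ensure that the facets fall under the
  summation case of \<open>face_boundary\<close>.\<close>

lemma boundary_face_boundary:
  assumes "card \<sigma> \<ge> 3"
  shows "simplicial_boundary (face_boundary \<sigma>) = 0"
proof -
  have fin: "finite \<sigma>" using assms by (simp add: card_ge_0_finite)
  define s where "s \<tau> v = (- 1 :: int) ^ card {u \<in> \<tau>. u < v}" for \<tau> and v :: nat
  define f where "f v u = frag_cmul (s \<sigma> v * s (\<sigma> - {v}) u) (frag_of (\<sigma> - {v} - {u}))" for v u
  define T where "T = (\<Sum>v\<in>\<sigma>. \<Sum>u\<in>\<sigma> - {v}. f v u)"
  have cf: "card (\<sigma> - {v}) = card \<sigma> - 1" if "v \<in> \<sigma>" for v using that fin by simp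
  have "simplicial_boundary (face_boundary \<sigma>) = (\<Sum>v\<in>\<sigma>. frag_cmul (s \<sigma> v) (face_boundary (\<sigma> - {v})))"
    using assms by (simp add: face_boundary_def[of \<sigma>] s_def simplicial_boundary_sum[OF fin])
  also have "\<dots> = T"
    unfolding T_def
  proof (rule sum.cong[OF refl])
    fix v assume "v \<in> \<sigma>"
    then have "\<not> card (\<sigma> - {v}) \<le> 1" using cf assms by simp
    then have "face_boundary (\<sigma> - {v}) = (\<Sum>u\<in>\<sigma> - {v}. frag_cmul (s (\<sigma> - {v}) u) (frag_of (\<sigma> - {v} - {u})))"
      by (simp only: face_boundary_def if_False s_def)
    then show "frag_cmul (s \<sigma> v) (face_boundary (\<sigma> - {v})) = (\<Sum>u\<in>\<sigma> - {v}. f v u)"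
      by (simp only: frag_cmul_sum f_def frag_cmul_cmul)
  qed
  finally have T: "simplicial_boundary (face_boundary \<sigma>) = T" .
  \<comment> \<open>Removing the smaller vertex lowers the position of the larger one by 1; removing
    the larger one leaves the position of the smaller unchanged. This single shift gives the
    sign.\<close>
  have anti: "f u v = - f v u" if "u \<in> \<sigma>" "v \<in> \<sigma>" "u < v" for u v
  proof -
    have "{w \<in> \<sigma> - {v}. w < u} = {w \<in> \<sigma>. w < u}" using that by auto
    then have 1: "s (\<sigma> - {v}) u = s \<sigma> u" by (simp only: s_def)
    have "{w \<in> \<sigma>. w < v} = insert u {w \<in> \<sigma> - {u}. w < v}" using that by auto
    then have "card {w \<in> \<sigma>. w < v} = Suc (card {w \<in> \<sigma> - {u}. w < v})" using fin by simp
    then have 2: "s \<sigma> v = - s (\<sigma> - {u}) v" by (simp only: s_def power_Suc)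
    have 3: "\<sigma> - {v} - {u} = \<sigma> - {u} - {v}" by auto
    show ?thesis unfolding f_def 1 2 3 by (simp add: mult.commute)
  qed
  have anti': "f u v = - f v u" if "u \<in> \<sigma>" "v \<in> \<sigma>" "u \<noteq> v" for u v
    using anti[of u v] anti[of v u] that by (cases "u < v") auto
  have "T = (\<Sum>v\<in>\<sigma>. \<Sum>u | u \<in> \<sigma> \<and> v \<noteq> u. f v u)"
    unfolding T_def by (intro sum.cong refl) auto
  also have "\<dots> = (\<Sum>u\<in>\<sigma>. \<Sum>v | v \<in> \<sigma> \<and> v \<noteq> u. f v u)"
    using fin by (rule sum.swap_restrict[OF _ ]) (use fin in auto)
  also have "\<dots> = (\<Sum>u\<in>\<sigma>. \<Sum>v\<in>\<sigma> - {u}. - f u v)"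
    by (intro sum.cong refl anti') auto
  also have "\<dots> = - T" by (simp add: T_def sum_negf)
  finally have "T = - T" .
  then have "Poly_Mapping.lookup T x = - Poly_Mapping.lookup T x" for x
    by (metis lookup_uminus)
  then have "T = 0" by (intro poly_mapping_eqI) (simp add: eq_neg_iff_add_eq_0)
  with T show ?thesis by simp
qed

text \<open>\<open>pos_dim\<close> makes \<open>j - 1\<close> a genuine lower dimension and gives
  every simplex of dimension \<open>j + 1\<close> at least three vertices, as
  \<open>boundary_face_boundary\<close> requires.\<close>

locale finite_complex =
  fixes K :: "nat set set" and j :: nat
  assumes finite_K: "finite K"
    and down_closed: "\<And>\<sigma> \<tau>. \<sigma> \<in> K \<Longrightarrow> \<tau> \<subseteq> \<sigma> \<Longrightarrow> \<tau> \<noteq> {} \<Longrightarrow> \<tau> \<in> K"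
    and pos_dim: "j \<ge> 1"
begin

abbreviation "ChG \<equiv> simplicial_chain_group K j"
abbreviation "Cyc \<equiv> simplicial_cycles K j"
abbreviation "Bd \<equiv> simplicial_boundaries K j"
abbreviation "CycG \<equiv> subgroup_generated ChG Cyc"
abbreviation "HomG \<equiv> simplicial_homology_group K j"

lemma group_chains: "comm_group ChG"
  by (simp add: simplicial_chain_group_def abelian_free_Abelian_group)

lemma one_chains: "\<one>\<^bsub>ChG\<^esub> = 0"
  by (simp add: simplicial_chain_group_def)

lemma fin_simp: "finite (simplices K i)" using finite_K by (rule finite_simplices)

lemma subgroup_cycles: "subgroup Cyc ChG"
proof
  fix x y assume "x \<in> Cyc" "y \<in> Cyc"
  then show "x \<otimes>\<^bsub>ChG\<^esub> y \<in> Cyc"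
    using keys_add[of x y]
    by (auto simp: simplicial_cycles_def simplicial_chain_group_def simplicial_boundary_def frag_extend_add)
qed (auto simp: simplicial_cycles_def simplicial_chain_group_def simplicial_boundary_def frag_extend_minus)

lemma carrier_CycG: "carrier CycG = Cyc"
  using comm_group.axioms(2)[OF group_chains] subgroup_cycles
  by (intro subgroup.carrier_subgroup_generated_subgroup)

lemma comm_group_CycG: "comm_group CycG"
  using comm_group.axioms(2)[OF group_chains] group_chains by (rule group.abelian_subgroup_generated)

lemma boundary_expand:
  assumes "Poly_Mapping.keys c \<subseteq> simplices K i"
  shows "simplicial_boundary c = (\<Sum>\<sigma>\<in>simplices K i. frag_cmul (Poly_Mapping.lookup c \<sigma>) (face_boundary \<sigma>))"
  by (subst frag_expand[OF fin_simp assms]) (simp add: simplicial_boundary_sum[OF fin_simp])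

lemma keys_boundary: "\<sigma> \<in> simplices K (Suc i) \<Longrightarrow> Poly_Mapping.keys (face_boundary \<sigma>) \<subseteq> simplices K i"
  by (rule keys_face_boundary) (use down_closed in blast)+

lemma boundaries_subset: "Bd \<subseteq> Cyc"
proof
  fix x assume "x \<in> Bd"
  then obtain c where c: "Poly_Mapping.keys c \<subseteq> simplices K (Suc j)" "x = simplicial_boundary c"
    by (auto simp: simplicial_boundaries_def simplicial_chain_group_def)
  have "Poly_Mapping.keys x \<subseteq> simplices K j"
    unfolding c(2) boundary_expand[OF c(1)]
    using keys_boundary by (intro keys_sum_frag_cmul) auto
  moreover have "simplicial_boundary (face_boundary \<sigma>) = 0" if "\<sigma> \<in> simplices K (Suc j)" for \<sigma>
    using that pos_dim by (intro boundary_face_boundary) (auto simp: simplices_def)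
  then have "simplicial_boundary x = 0"
    unfolding c(2) boundary_expand[OF c(1)] by (simp add: simplicial_boundary_sum[OF fin_simp])
  ultimately show "x \<in> Cyc" by (simp add: simplicial_cycles_def simplicial_chain_group_def)
qed

lemma boundaries_iff:
  "x \<in> Bd \<longleftrightarrow> (\<exists>c. Poly_Mapping.keys c \<subseteq> simplices K (Suc j) \<and> x = simplicial_boundary c)"
  by (auto simp: simplicial_boundaries_def simplicial_chain_group_def image_iff Bex_def)

lemma subgroup_boundaries: "subgroup Bd CycG"
proof -
  have "subgroup Bd ChG"
  proof
    show "Bd \<subseteq> carrier ChG" using boundaries_subset by (auto simp: simplicial_cycles_def)
    fix x y assume "x \<in> Bd" "y \<in> Bd"
    then obtain c d where c: "Poly_Mapping.keys c \<subseteq> simplices K (Suc j)" "x = simplicial_boundary c"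
      and d: "Poly_Mapping.keys d \<subseteq> simplices K (Suc j)" "y = simplicial_boundary d"
      unfolding boundaries_iff by blast
    have "Poly_Mapping.keys (c + d) \<subseteq> simplices K (Suc j)" using keys_add[of c d] c d by blast
    moreover have "x + y = simplicial_boundary (c + d)"
      by (simp add: c d simplicial_boundary_def frag_extend_add)
    ultimately have "x + y \<in> Bd" unfolding boundaries_iff by blast
    then show "x \<otimes>\<^bsub>ChG\<^esub> y \<in> Bd" by (simp add: simplicial_chain_group_def)
  next
    have "simplicial_boundary 0 = 0" by (simp add: simplicial_boundary_def)
    then have "0 \<in> Bd" unfolding boundaries_iff by (metis empty_subsetI keys_zero)
    then show "\<one>\<^bsub>ChG\<^esub> \<in> Bd" by (simp add: simplicial_chain_group_def)
    fix x assume x: "x \<in> Bd"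
    then obtain c where c: "Poly_Mapping.keys c \<subseteq> simplices K (Suc j)" "x = simplicial_boundary c"
      unfolding boundaries_iff by blast
    have "- x = simplicial_boundary (- c)" "Poly_Mapping.keys (- c) \<subseteq> simplices K (Suc j)"
      using c by (simp_all add: simplicial_boundary_def frag_extend_minus)
    then have "- x \<in> Bd" unfolding boundaries_iff by blast
    moreover have "Poly_Mapping.keys x \<subseteq> simplices K j"
      using x boundaries_subset by (auto simp: simplicial_cycles_def simplicial_chain_group_def)
    ultimately show "inv\<^bsub>ChG\<^esub> x \<in> Bd" by (simp add: simplicial_chain_group_def)
  qed
  then show ?thesis
    using boundaries_subset comm_group.axioms(2)[OF group_chains]
    by (simp add: group.subgroup_subgroup_generated_iff carrier_CycG)
qed

sublocale quot: normal Bd CycG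
  using comm_group_CycG subgroup_boundaries by (rule comm_group.subgroup_imp_normal)

lemma homology_group: "HomG = CycG Mod Bd" "comm_group HomG"
  by (simp_all add: simplicial_homology_group_def comm_group.abelian_FactGroup[OF comm_group_CycG subgroup_boundaries])

lemma carrier_homology: "carrier HomG = (\<lambda>x. Bd #>\<^bsub>CycG\<^esub> x) ` Cyc"
  by (simp add: homology_group(1) carrier_FactGroup carrier_CycG)

lemma coset_closed: "x \<in> Cyc \<Longrightarrow> Bd #>\<^bsub>CycG\<^esub> x \<in> carrier HomG"
  unfolding carrier_homology by (rule imageI)

lemma sum_in_cycles:
  assumes "\<And>i. i \<in> I \<Longrightarrow> z i \<in> Cyc"
  shows "(\<Sum>i\<in>I. frag_cmul (e i) (z i)) \<in> Cyc"
proof (cases "finite I")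
  case True
  have "simplicial_boundary (\<Sum>i\<in>I. frag_cmul (e i) (z i)) = 0"
    using assms by (simp add: simplicial_boundary_sum[OF True] simplicial_cycles_def)
  moreover have "Poly_Mapping.keys (\<Sum>i\<in>I. frag_cmul (e i) (z i)) \<subseteq> simplices K j"
    using assms by (intro keys_sum_frag_cmul) (auto simp: simplicial_cycles_def simplicial_chain_group_def)
  ultimately show ?thesis by (simp add: simplicial_cycles_def simplicial_chain_group_def)
qed (simp add: simplicial_cycles_def simplicial_chain_group_def simplicial_boundary_def)

text \<open>The bridge between the multiplicative notation of the quotient group and additive
  chains: a product of powers of classes is trivial iff the same integer combination of
  representatives is a boundary. Both rank bounds use it.\<close>

lemma finprod_cosets:
  fixes e :: "'i \<Rightarrow> int"
  assumes "finite I" "\<And>i. i \<in> I \<Longrightarrow> z i \<in> Cyc"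
  shows "finprod HomG (\<lambda>i. (Bd #>\<^bsub>CycG\<^esub> z i) [^]\<^bsub>HomG\<^esub> e i) I = Bd #>\<^bsub>CycG\<^esub> (\<Sum>i\<in>I. frag_cmul (e i) (z i))"
  using assms
proof (induction I rule: finite_induct)
  case empty
  interpret H: comm_group HomG by (rule homology_group)
  have "Bd #>\<^bsub>CycG\<^esub> \<one>\<^bsub>CycG\<^esub> = Bd"
    using quot.coset_mult_one[OF quot.subset] .
  then have "Bd #>\<^bsub>CycG\<^esub> 0 = Bd" by (simp add: simplicial_chain_group_def)
  then show ?case by (simp only: H.finprod_empty sum.empty) (simp add: homology_group(1))
next
  case (insert i I)
  interpret H: comm_group HomG by (rule homology_group)
  have pow: "(Bd #>\<^bsub>CycG\<^esub> z i) [^]\<^bsub>HomG\<^esub> e i = Bd #>\<^bsub>CycG\<^esub> frag_cmul (e i) (z i)" if "z i \<in> Cyc" for i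
  proof -
    have "z i [^]\<^bsub>CycG\<^esub> e i = z i [^]\<^bsub>ChG\<^esub> e i"
      using that comm_group.axioms(2)[OF group_chains] by (simp add: group.int_pow_subgroup_generated carrier_CycG)
    also have "\<dots> = frag_cmul (e i) (z i)"
      using that by (simp add: simplicial_cycles_def simplicial_chain_group_def)
    finally have "z i [^]\<^bsub>CycG\<^esub> e i = frag_cmul (e i) (z i)" .
    then show ?thesis using quot.FactGroup_int_pow[of "z i" "e i"] that
      by (simp add: homology_group(1) carrier_CycG)
  qed
  have cyc: "frag_cmul (e i) (z i) \<in> Cyc" using sum_in_cycles[of "{i}" z e] insert.prems by simp
  have clos: "(\<lambda>i. (Bd #>\<^bsub>CycG\<^esub> z i) [^]\<^bsub>HomG\<^esub> e i) \<in> insert i I \<rightarrow> carrier HomG"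
    using insert.prems by (intro funcsetI H.int_pow_closed coset_closed)
  have "finprod HomG (\<lambda>i. (Bd #>\<^bsub>CycG\<^esub> z i) [^]\<^bsub>HomG\<^esub> e i) (insert i I)
    = (Bd #>\<^bsub>CycG\<^esub> frag_cmul (e i) (z i)) \<otimes>\<^bsub>HomG\<^esub> (Bd #>\<^bsub>CycG\<^esub> (\<Sum>i\<in>I. frag_cmul (e i) (z i)))"
    using insert.hyps insert.prems clos by (subst H.finprod_insert) (auto simp: pow insert.IH)
  also have "\<dots> = Bd #>\<^bsub>CycG\<^esub> (frag_cmul (e i) (z i) \<otimes>\<^bsub>CycG\<^esub> (\<Sum>i\<in>I. frag_cmul (e i) (z i)))"
    using cyc sum_in_cycles[of I z e] insert.prems by (simp add: homology_group(1) quot.rcos_sum carrier_CycG)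
  also have "frag_cmul (e i) (z i) \<otimes>\<^bsub>CycG\<^esub> (\<Sum>i\<in>I. frag_cmul (e i) (z i)) = (\<Sum>i\<in>insert i I. frag_cmul (e i) (z i))"
    using insert.hyps by (simp add: simplicial_chain_group_def)
  finally show ?case .
qed

lemma coset_eq_one_iff:
  assumes "x \<in> Cyc"
  shows "Bd #>\<^bsub>CycG\<^esub> x = \<one>\<^bsub>HomG\<^esub> \<longleftrightarrow> x \<in> Bd"
  using assms quot.coset_join1[of Bd x] quot.coset_join2[of x Bd] subgroup_boundaries quot.subset
  by (auto simp: homology_group(1) carrier_CycG)

text \<open>Representing cycles are vectors with one coordinate per \<open>j\<close>-simplex, so
  more classes than simplices would have representatives with a nontrivial integer relation, and
  this relation descends to homology.\<close>

lemma card_independent_le: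
  assumes "int_independent HomG S"
  shows "card S \<le> card (simplices K j)"
proof (rule ccontr)
  assume neg: "\<not> card S \<le> card (simplices K j)"
  have fin: "finite S" and sub: "S \<subseteq> carrier HomG"
    and ind: "finprod HomG (\<lambda>x. x [^]\<^bsub>HomG\<^esub> c x) S = \<one>\<^bsub>HomG\<^esub> \<Longrightarrow> \<forall>x\<in>S. c x = 0" for c :: "_ \<Rightarrow> int"
    using assms by (auto simp: int_independent_def)
  interpret H: comm_group HomG by (rule homology_group)
  have "\<forall>s\<in>S. \<exists>z. z \<in> Cyc \<and> s = Bd #>\<^bsub>CycG\<^esub> z"
    using sub unfolding carrier_homology by blast
  from bchoice[OF this] obtain z where "\<forall>s\<in>S. z s \<in> Cyc \<and> s = Bd #>\<^bsub>CycG\<^esub> z s" ..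
  then have zC: "z s \<in> Cyc" and zs: "Bd #>\<^bsub>CycG\<^esub> z s = s" if "s \<in> S" for s using that by simp_all
  from independent_integer_relations[OF fin_simp[of j] fin, of "\<lambda>s. Poly_Mapping.lookup (z s)"]
  obtain R where R: "finite R" "card S \<le> card R + card (simplices K j)"
    "\<forall>c\<in>R. (\<forall>s. s \<notin> S \<longrightarrow> c s = 0) \<and> (\<forall>\<sigma>\<in>simplices K j. (\<Sum>s\<in>S. c s * Poly_Mapping.lookup (z s) \<sigma>) = 0)"
    "\<forall>e :: (_ \<Rightarrow> int) \<Rightarrow> int. (\<forall>s\<in>S. (\<Sum>c\<in>R. e c * c s) = 0) \<longrightarrow> (\<forall>c\<in>R. e c = 0)"
    by (elim exE conjE) (rule that)
  from R(1,2) neg obtain c where c: "c \<in> R" by (cases "R = {}") auto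
  have "(\<Sum>s\<in>S. frag_cmul (c s) (z s)) = 0"
  proof (rule poly_mapping_eqI)
    fix \<sigma>
    have "Poly_Mapping.lookup (z s) \<sigma> = 0" if "\<sigma> \<notin> simplices K j" "s \<in> S" for s
      using zC[OF that(2)] that(1) by (auto simp: simplicial_cycles_def simplicial_chain_group_def in_keys_iff)
    then show "Poly_Mapping.lookup (\<Sum>s\<in>S. frag_cmul (c s) (z s)) \<sigma> = Poly_Mapping.lookup 0 \<sigma>"
      using R(3)[rule_format, OF c] by (cases "\<sigma> \<in> simplices K j") (simp_all add: lookup_sum_frag_cmul)
  qed
  moreover have "finprod HomG (\<lambda>s. s [^]\<^bsub>HomG\<^esub> c s) S = finprod HomG (\<lambda>s. (Bd #>\<^bsub>CycG\<^esub> z s) [^]\<^bsub>HomG\<^esub> c s) S"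
  proof (rule H.finprod_cong'[OF refl])
    show "(\<lambda>s. (Bd #>\<^bsub>CycG\<^esub> z s) [^]\<^bsub>HomG\<^esub> c s) \<in> S \<rightarrow> carrier HomG"
      using sub by (auto simp: zs intro!: H.int_pow_closed)
  qed (simp add: zs simp_implies_def)
  ultimately have "finprod HomG (\<lambda>s. s [^]\<^bsub>HomG\<^esub> c s) S = \<one>\<^bsub>HomG\<^esub>"
    using coset_eq_one_iff[of 0] subgroup.one_closed[OF subgroup_boundaries] sum_in_cycles[of "{}" z c]
      finprod_cosets[OF fin zC, where e = c]
    by (simp add: one_chains)
  then have "\<forall>s\<in>S. c s = 0" by (rule ind)
  then have "\<forall>s. c s = 0" using R(3)[rule_format, OF c] by auto
  \<comment> \<open>The zero function cannot belong to the independent family \<open>R\<close>: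
    testing independence with the indicator of \<open>c\<close> would give 1 = 0.\<close>
  moreover have "(\<Sum>c'\<in>R. (if c' = c then 1 else 0) * c' s) = (\<Sum>c'\<in>R. if c' = c then c' s else 0)" for s
    by (intro sum.cong) auto
  ultimately have "\<forall>s\<in>S. (\<Sum>c'\<in>R. (if c' = c then 1 else 0) * c' s) = 0"
    using R(1) c by simp
  from R(4)[rule_format, OF this[rule_format], OF _ c] c show False by simp
qed

text \<open>On the naturals \<open>Sup\<close> is a true supremum only for nonempty bounded sets;
  \<open>card_independent_le\<close> supplies the bound and the empty family a member.\<close>

lemma abelian_rank_homology:
  shows betti_le: "betti j K \<le> card (simplices K j)"
    and betti_ge: "int_independent HomG S \<Longrightarrow> card S \<le> betti j K"
proof -
  have bdd: "bdd_above {card S | S. int_independent HomG S}"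
    using card_independent_le by (intro bdd_aboveI) auto
  have "int_independent HomG {}" by (simp add: int_independent_def)
  then show "betti j K \<le> card (simplices K j)"
    unfolding betti_def abelian_rank_def using card_independent_le by (intro cSup_least) auto
  show "int_independent HomG S \<Longrightarrow> card S \<le> betti j K"
    unfolding betti_def abelian_rank_def using bdd by (intro cSup_upper) auto
qed

text \<open>
  Harmonic chains are cycles orthogonal to all boundaries; a combination of them that is itself a
  boundary is orthogonal to itself, hence zero.
\<close>

lemma card_simplices_le_betti:
  "card (simplices K j) \<le> betti j K + card (simplices K (j - 1)) + card (simplices K (j + 1))"
proof -
  define J where "J = simplices K j"
  \<comment> \<open>One linear condition per index. \<open>Inl \<tau>\<close> asks that the boundary
    of the chain have coefficient 0 at \<tau>, \<open>Inr \<tau>\<close> that the chain be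
    orthogonal to the boundary of \<tau>. The common solutions are the harmonic chains.\<close>
  define B where "B = simplices K (j - 1) <+> simplices K (j + 1)"
  define v where "v = (\<lambda>\<sigma> b. case b of Inl \<tau> \<Rightarrow> Poly_Mapping.lookup (face_boundary \<sigma>) \<tau>
     | Inr \<tau> \<Rightarrow> Poly_Mapping.lookup (face_boundary \<tau>) \<sigma>)"
  have fin: "finite J" "finite B" by (auto simp: J_def B_def fin_simp)
  from independent_integer_relations[OF fin(2,1), of v]
  obtain R where R: "finite R" "card J \<le> card R + card B"
    "\<forall>c\<in>R. (\<forall>\<sigma>. \<sigma> \<notin> J \<longrightarrow> c \<sigma> = 0) \<and> (\<forall>b\<in>B. (\<Sum>\<sigma>\<in>J. c \<sigma> * v \<sigma> b) = 0)"
    "\<forall>e :: (_ \<Rightarrow> int) \<Rightarrow> int. (\<forall>\<sigma>\<in>J. (\<Sum>c\<in>R. e c * c \<sigma>) = 0) \<longrightarrow> (\<forall>c\<in>R. e c = 0)"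
    by (elim exE conjE) (rule that)
  define z where "z c = (\<Sum>\<sigma>\<in>J. frag_cmul (c \<sigma>) (frag_of \<sigma>))" for c
  have lz: "Poly_Mapping.lookup (z c) \<sigma> = c \<sigma>" if "\<sigma> \<in> J" for c \<sigma>
    using that fin(1) by (simp add: z_def lookup_sum_frag_cmul if_distrib cong: if_cong)
  have kz: "Poly_Mapping.keys (z c) \<subseteq> J" for c
    unfolding z_def by (intro keys_sum_frag_cmul) auto
  have zc: "z c \<in> Cyc" if c: "c \<in> R" for c
  proof -
    have "simplicial_boundary (z c) = 0"
    proof (rule poly_mapping_eqI)
      fix \<tau>
      have b: "Poly_Mapping.lookup (simplicial_boundary (z c)) \<tau> = (\<Sum>\<sigma>\<in>J. c \<sigma> * Poly_Mapping.lookup (face_boundary \<sigma>) \<tau>)"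
        unfolding z_def simplicial_boundary_sum[OF fin(1)] by (simp add: lookup_sum_frag_cmul)
      show "Poly_Mapping.lookup (simplicial_boundary (z c)) \<tau> = Poly_Mapping.lookup 0 \<tau>"
      proof (cases "\<tau> \<in> simplices K (j - 1)")
        case True
        then have "Inl \<tau> \<in> B" unfolding B_def by (rule InlI)
        then have "(\<Sum>\<sigma>\<in>J. c \<sigma> * v \<sigma> (Inl \<tau>)) = 0" using R(3) c by blast
        then show ?thesis using b by (simp add: v_def)
      next
        case False
        then have "Poly_Mapping.lookup (face_boundary \<sigma>) \<tau> = 0" if "\<sigma> \<in> J" for \<sigma>
          using that keys_boundary[of \<sigma> "j - 1"] pos_dim by (auto simp: J_def in_keys_iff)
        then show ?thesis using b by simp
      qed
    qed
    then show ?thesis using kz[of c] by (simp add: simplicial_cycles_def simplicial_chain_group_def J_def)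
  qed
  have key: "\<forall>c\<in>R. e c = 0" if bd: "(\<Sum>c\<in>R. frag_cmul (e c) (z c)) \<in> Bd" for e
  proof -
    define w where "w = (\<Sum>c\<in>R. frag_cmul (e c) (z c))"
    obtain d where d: "Poly_Mapping.keys d \<subseteq> simplices K (j + 1)" "w = simplicial_boundary d"
      using bd by (auto simp: w_def boundaries_iff)
    have lw: "Poly_Mapping.lookup w \<sigma> = (\<Sum>c\<in>R. e c * c \<sigma>)" if "\<sigma> \<in> J" for \<sigma>
      using that by (simp add: w_def lookup_sum_frag_cmul lz)
    have orth: "(\<Sum>\<sigma>\<in>J. Poly_Mapping.lookup w \<sigma> * Poly_Mapping.lookup (face_boundary \<tau>) \<sigma>) = 0"
      if "\<tau> \<in> simplices K (j + 1)" for \<tau>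
    proof -
      have "Inr \<tau> \<in> B" using that unfolding B_def by (rule InrI)
      then have 0: "(\<Sum>\<sigma>\<in>J. c \<sigma> * Poly_Mapping.lookup (face_boundary \<tau>) \<sigma>) = 0" if "c \<in> R" for c
      proof -
        have "(\<Sum>\<sigma>\<in>J. c \<sigma> * v \<sigma> (Inr \<tau>)) = 0" using R(3) that \<open>Inr \<tau> \<in> B\<close> by blast
        then show ?thesis by (simp add: v_def)
      qed
      have "(\<Sum>\<sigma>\<in>J. Poly_Mapping.lookup w \<sigma> * Poly_Mapping.lookup (face_boundary \<tau>) \<sigma>)
        = (\<Sum>\<sigma>\<in>J. \<Sum>c\<in>R. e c * (c \<sigma> * Poly_Mapping.lookup (face_boundary \<tau>) \<sigma>))"
        by (simp add: lw sum_distrib_right mult.assoc)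
      also have "\<dots> = (\<Sum>c\<in>R. e c * (\<Sum>\<sigma>\<in>J. c \<sigma> * Poly_Mapping.lookup (face_boundary \<tau>) \<sigma>))"
        by (subst sum.swap) (simp add: sum_distrib_left)
      finally show ?thesis using 0 by simp
    qed
    \<comment> \<open>Expanding one factor of the squared norm of \<open>w\<close> as the boundary
      of \<open>d\<close> leaves a combination of the inner products that vanish by
      \<open>orth\<close>.\<close>
    have "(\<Sum>\<sigma>\<in>J. Poly_Mapping.lookup w \<sigma> * Poly_Mapping.lookup w \<sigma>)
      = (\<Sum>\<sigma>\<in>J. \<Sum>\<tau>\<in>simplices K (j + 1). Poly_Mapping.lookup d \<tau> * (Poly_Mapping.lookup w \<sigma> * Poly_Mapping.lookup (face_boundary \<tau>) \<sigma>))"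
    proof (rule sum.cong[OF refl])
      fix \<sigma> assume "\<sigma> \<in> J"
      have "Poly_Mapping.lookup w \<sigma> = (\<Sum>\<tau>\<in>simplices K (j + 1). Poly_Mapping.lookup d \<tau> * Poly_Mapping.lookup (face_boundary \<tau>) \<sigma>)"
        unfolding d(2) by (subst boundary_expand[OF d(1)]) (simp add: lookup_sum_frag_cmul)
      then show "Poly_Mapping.lookup w \<sigma> * Poly_Mapping.lookup w \<sigma> = (\<Sum>\<tau>\<in>simplices K (j + 1). Poly_Mapping.lookup d \<tau> * (Poly_Mapping.lookup w \<sigma> * Poly_Mapping.lookup (face_boundary \<tau>) \<sigma>))"
        by (metis (mono_tags, lifting) mult.left_commute sum.cong sum_distrib_left)
    qed
    also have "\<dots> = (\<Sum>\<tau>\<in>simplices K (j + 1). Poly_Mapping.lookup d \<tau> * (\<Sum>\<sigma>\<in>J. Poly_Mapping.lookup w \<sigma> * Poly_Mapping.lookup (face_boundary \<tau>) \<sigma>))"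
      by (subst sum.swap) (simp add: sum_distrib_left)
    also have "\<dots> = 0" using orth by simp
    finally have "\<forall>\<sigma>\<in>J. Poly_Mapping.lookup w \<sigma> * Poly_Mapping.lookup w \<sigma> = 0"
      using fin(1) by (subst (asm) sum_nonneg_eq_0_iff) auto
    then have "\<forall>\<sigma>\<in>J. (\<Sum>c\<in>R. e c * c \<sigma>) = 0" using lw by auto
    then show ?thesis by (rule R(4)[THEN spec, THEN mp])
  qed
  define F where "F c = Bd #>\<^bsub>CycG\<^esub> z c" for c
  have inj: "inj_on F R"
  proof (rule inj_onI, rule ccontr)
    fix c c' assume c: "c \<in> R" "c' \<in> R" "F c = F c'" "c \<noteq> c'"
    \<comment> \<open>If the classes of \<open>z c\<close> and \<open>z c'\<close> agree, then
      \<open>z c - z c'\<close> is a boundary. It has these coefficients, and \<open>key\<close>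
      would make the coefficient 1 vanish.\<close>
    define e :: "_ \<Rightarrow> int" where "e x = (if x = c then 1 else if x = c' then - 1 else 0)" for x
    have "(\<Sum>x\<in>R. frag_cmul (e x) (z x)) = (\<Sum>x\<in>{c, c'}. frag_cmul (e x) (z x))"
      using R(1) c by (intro sum.mono_neutral_right) (auto simp: e_def)
    also have "\<dots> = z c - z c'" using c(4) by (simp add: e_def)
    also have "\<dots> \<in> Bd"
    proof -
      have "z c \<in> Bd #>\<^bsub>CycG\<^esub> z c'"
        using c(3) zc c by (metis F_def carrier_CycG quot.rcos_self subgroup_boundaries)
      then show ?thesis
        by (auto simp: r_coset_def simplicial_chain_group_def)
    qed
    finally have "e c = 0" using key c by blast
    then show False by (simp add: e_def)
  qed
  have "int_independent HomG (F ` R)"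
    unfolding int_independent_def
  proof (intro conjI allI impI)
    interpret H: comm_group HomG by (rule homology_group)
    show "finite (F ` R)" using R(1) by simp
    show sub: "F ` R \<subseteq> carrier HomG" using zc by (auto simp: carrier_homology F_def)
    fix e :: "_ \<Rightarrow> int"
    assume "finprod HomG (\<lambda>x. x [^]\<^bsub>HomG\<^esub> e x) (F ` R) = \<one>\<^bsub>HomG\<^esub>"
    moreover have "finprod HomG (\<lambda>x. x [^]\<^bsub>HomG\<^esub> e x) (F ` R) = finprod HomG (\<lambda>c. F c [^]\<^bsub>HomG\<^esub> e (F c)) R"
      using sub by (intro H.finprod_reindex inj) (auto intro!: H.int_pow_closed)
    moreover have "\<dots> = Bd #>\<^bsub>CycG\<^esub> (\<Sum>c\<in>R. frag_cmul (e (F c)) (z c))"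
      unfolding F_def using R(1) zc by (rule finprod_cosets)
    ultimately have "(\<Sum>c\<in>R. frag_cmul (e (F c)) (z c)) \<in> Bd"
      using coset_eq_one_iff[OF sum_in_cycles[of R z "\<lambda>c. e (F c)"]] zc by simp
    from key[OF this] show "\<forall>x\<in>F ` R. e x = 0" by simp
  qed
  then have "card (F ` R) \<le> betti j K" by (rule betti_ge)
  then show ?thesis using R(1,2) by (simp add: card_image[OF inj] J_def B_def card_Plus fin_simp)
qed

end

section \<open>Independent coins\<close>

text \<open>
  All coins are tossed in advance, one for every vertex set of size at least 2; a set is a simplex
  if its own coin and those of all its faces show heads. Coins of sets whose boundary is missing
  are never looked at, so this has the law of the recursive construction.
\<close>

definition coins :: "nat \<Rightarrow> nat \<Rightarrow> nat set set" where
  "coins n i = {\<sigma>. \<sigma> \<subseteq> {1..n} \<and> 2 \<le> card \<sigma> \<and> card \<sigma> \<le> i + 1}"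

definition coin_faces :: "nat set \<Rightarrow> nat set set" where
  "coin_faces \<sigma> = {\<tau>. \<tau> \<subseteq> \<sigma> \<and> 2 \<le> card \<tau>}"

definition coin_complex :: "nat \<Rightarrow> nat \<Rightarrow> (nat set \<Rightarrow> bool) \<Rightarrow> nat set set" where
  "coin_complex n i F = {\<sigma>. \<sigma> \<noteq> {} \<and> \<sigma> \<subseteq> {1..n} \<and> card \<sigma> \<le> i + 1 \<and> (\<forall>\<tau>\<in>coin_faces \<sigma>. F \<tau>)}"

definition coin_pmf :: "nat \<Rightarrow> (nat \<Rightarrow> real) \<Rightarrow> nat \<Rightarrow> (nat set \<Rightarrow> bool) pmf" where
  "coin_pmf n p i = Pi_pmf (coins n i) False (\<lambda>\<sigma>. bernoulli_pmf (p (card \<sigma> - 1)))"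

lemma finite_coins [simp]: "finite (coins n i)"
  by (rule finite_subset[of _ "Pow {1..n}"]) (auto simp: coins_def)

lemma finite_coin_faces: "finite \<sigma> \<Longrightarrow> finite (coin_faces \<sigma>)"
  by (rule finite_subset[of _ "Pow \<sigma>"]) (auto simp: coin_faces_def)

text \<open>The coin of \<sigma> itself is left out, so the condition reads only coins of smaller
  sets. This separates the coins about to be tossed from those already used.\<close>

lemma potential_simplices_coin_complex:
  "potential_simplices n (Suc i) (coin_complex n i F) =
    {\<sigma> \<in> coins n (Suc i) - coins n i. \<forall>\<tau>\<in>coin_faces \<sigma> - {\<sigma>}. F \<tau>}" (is "?L = ?R")
proof (intro Set.set_eqI iffI)
  fix \<sigma> assume "\<sigma> \<in> ?L"
  then have \<sigma>: "\<sigma> \<subseteq> {1..n}" "card \<sigma> = Suc i + 1" and f: "\<And>\<tau>. \<tau> \<noteq> {} \<Longrightarrow> \<tau> \<subset> \<sigma> \<Longrightarrow> \<tau> \<in> coin_complex n i F"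
    by (auto simp: potential_simplices_def)
  have "F \<tau>" if "\<tau> \<in> coin_faces \<sigma> - {\<sigma>}" for \<tau>
  proof -
    have "\<tau> \<noteq> {}" "\<tau> \<subset> \<sigma>" "\<tau> \<in> coin_faces \<tau>" using that by (auto simp: coin_faces_def)
    with f[of \<tau>] show ?thesis by (auto simp: coin_complex_def)
  qed
  with \<sigma> show "\<sigma> \<in> ?R" by (auto simp: coins_def)
next
  fix \<sigma> assume \<sigma>: "\<sigma> \<in> ?R"
  then have s: "\<sigma> \<subseteq> {1..n}" "card \<sigma> = Suc i + 1" by (auto simp: coins_def)
  then have "finite \<sigma>" using finite_subset by blast
  have "\<tau> \<in> coin_complex n i F" if \<tau>: "\<tau> \<noteq> {}" "\<tau> \<subset> \<sigma>" for \<tau>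
  proof -
    have "card \<tau> \<le> i + 1" using psubset_card_mono[OF \<open>finite \<sigma>\<close> \<tau>(2)] s by simp
    moreover have "coin_faces \<tau> \<subseteq> coin_faces \<sigma> - {\<sigma>}" using \<tau> by (auto simp: coin_faces_def)
    ultimately show ?thesis using \<tau> \<sigma> s by (auto simp: coin_complex_def)
  qed
  with s show "\<sigma> \<in> ?L" by (auto simp: potential_simplices_def)
qed

text \<open>\<open>F'\<close> is prescribed on the old coins and on the potential simplices only. A
  new set with an incomplete boundary stays out whatever its coin shows.\<close>

lemma coin_complex_Suc:
  assumes "\<And>\<tau>. \<tau> \<in> coins n i \<Longrightarrow> F' \<tau> = F \<tau>"
    and "\<And>\<tau>. \<tau> \<in> potential_simplices n (Suc i) (coin_complex n i F) \<Longrightarrow> F' \<tau> = G \<tau>"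
  shows "coin_complex n (Suc i) F' = coin_complex n i F \<union>
    {\<sigma> \<in> potential_simplices n (Suc i) (coin_complex n i F). G \<sigma>}" (is "_ = _ \<union> ?P")
proof (rule Set.set_eqI)
  fix \<sigma>
  have eq: "F' \<tau> = F \<tau>" if "\<sigma> \<subseteq> {1..n}" "\<tau> \<in> coin_faces \<sigma>" "card \<tau> \<le> Suc i" for \<tau>
    using that by (intro assms(1)) (auto simp: coins_def coin_faces_def)
  show "\<sigma> \<in> coin_complex n (Suc i) F' \<longleftrightarrow> \<sigma> \<in> coin_complex n i F \<union> ?P"
  proof (cases "\<sigma> \<noteq> {} \<and> \<sigma> \<subseteq> {1..n} \<and> card \<sigma> \<le> Suc i + 1")
    case False
    then show ?thesis by (auto simp: coin_complex_def potential_simplices_def)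
  next
    case True
    then have fin: "finite \<sigma>" using finite_subset by blast
    show ?thesis
    proof (cases "card \<sigma> \<le> i + 1")
      case T: True
      have "card \<tau> \<le> Suc i" if "\<tau> \<in> coin_faces \<sigma>" for \<tau>
        using card_mono[OF fin, of \<tau>] that T by (auto simp: coin_faces_def)
      then have "(\<forall>\<tau>\<in>coin_faces \<sigma>. F' \<tau>) \<longleftrightarrow> (\<forall>\<tau>\<in>coin_faces \<sigma>. F \<tau>)" using eq True by blast
      then show ?thesis using True T by (auto simp: coin_complex_def potential_simplices_def)
    next
      case F: False
      have small: "card \<tau> \<le> Suc i" if "\<tau> \<in> coin_faces \<sigma> - {\<sigma>}" for \<tau>
      proof -
        have "\<tau> \<subset> \<sigma>" using that by (auto simp: coin_faces_def)
        from psubset_card_mono[OF fin this] True show ?thesis by simp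
      qed
      have "\<sigma> \<in> coin_faces \<sigma>" using F by (auto simp: coin_faces_def)
      then have "(\<forall>\<tau>\<in>coin_faces \<sigma>. F' \<tau>) \<longleftrightarrow> F' \<sigma> \<and> (\<forall>\<tau>\<in>coin_faces \<sigma> - {\<sigma>}. F' \<tau>)" by blast
      also have "\<dots> \<longleftrightarrow> F' \<sigma> \<and> (\<forall>\<tau>\<in>coin_faces \<sigma> - {\<sigma>}. F \<tau>)" using eq small True by blast
      also have "\<dots> \<longleftrightarrow> F' \<sigma> \<and> \<sigma> \<in> potential_simplices n (Suc i) (coin_complex n i F)"
        unfolding potential_simplices_coin_complex using True F by (auto simp: coins_def)
      also have "\<dots> \<longleftrightarrow> \<sigma> \<in> ?P" using assms(2) by auto
      finally show ?thesis using True F by (auto simp: coin_complex_def)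
    qed
  qed
qed

text \<open>The product measure splits into the coins of the \<open>i\<close>-skeleton and the layer
  \<open>N\<close> of coins of the next size. Given the former, the marginal of the latter on the
  potential simplices is the recursive step.\<close>

lemma random_skeleton_eq: "random_skeleton n p i = map_pmf (coin_complex n i) (coin_pmf n p i)"
proof (induction i)
  case 0
  have "coins n 0 = {}" by (auto simp: coins_def)
  moreover have "coin_complex n 0 F = {{v} |v. v \<in> {1..n}}" for F
  proof (intro Set.set_eqI iffI)
    fix \<sigma> assume \<sigma>: "\<sigma> \<in> coin_complex n 0 F"
    then have "finite \<sigma>" "\<sigma> \<noteq> {}" "card \<sigma> \<le> 1" by (auto simp: coin_complex_def intro: finite_subset)
    then have "card \<sigma> = 1" by (metis card_0_eq le_antisym less_one linorder_not_less)
    then obtain v where "\<sigma> = {v}" by (rule card_1_singletonE)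
    then show "\<sigma> \<in> {{v} |v. v \<in> {1..n}}" using \<sigma> by (auto simp: coin_complex_def)
  next
    fix \<sigma> :: "nat set" assume "\<sigma> \<in> {{v} |v. v \<in> {1..n}}"
    then obtain v where v: "\<sigma> = {v}" "v \<in> {1..n}" by blast
    have "\<tau> \<notin> coin_faces {v}" for \<tau>
    proof
      assume "\<tau> \<in> coin_faces {v}"
      then have "\<tau> \<subseteq> {v}" "2 \<le> card \<tau>" by (auto simp: coin_faces_def)
      with card_mono[of "{v}" \<tau>] show False by simp
    qed
    then have "coin_faces {v} = {}" by blast
    then show "\<sigma> \<in> coin_complex n 0 F" using v by (auto simp: coin_complex_def)
  qed
  ultimately show ?case by (simp add: coin_pmf_def)
next
  case (Suc i)
  define N where "N = coins n (Suc i) - coins n i"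
  let ?b = "\<lambda>\<sigma>. bernoulli_pmf (p (card \<sigma> - 1))"
  have cov: "coins n (Suc i) = coins n i \<union> N" "coins n i \<inter> N = {}" "finite N"
    unfolding N_def by (auto simp: coins_def)
  have cardN: "card \<sigma> - 1 = Suc i" if "\<sigma> \<in> N" for \<sigma> using that by (auto simp: N_def coins_def)
  have "coin_pmf n p (Suc i) = map_pmf (\<lambda>(f, g) x. if x \<in> coins n i then f x else g x)
      (pair_pmf (coin_pmf n p i) (Pi_pmf N False ?b))"
    unfolding coin_pmf_def cov(1) using cov by (intro Pi_pmf_union) auto
  then have "map_pmf (coin_complex n (Suc i)) (coin_pmf n p (Suc i)) =
    bind_pmf (coin_pmf n p i) (\<lambda>F. map_pmf (\<lambda>G. coin_complex n (Suc i) (\<lambda>x. if x \<in> coins n i then F x else G x)) (Pi_pmf N False ?b))"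
    by (simp add: map_pmf_comp pair_pmf_def map_bind_pmf map_pmf_def bind_assoc_pmf bind_return_pmf)
  also have "\<dots> = bind_pmf (coin_pmf n p i) (\<lambda>F. map_pmf (\<lambda>G. coin_complex n i F \<union> {\<sigma> \<in> potential_simplices n (Suc i) (coin_complex n i F). G \<sigma>})
       (Pi_pmf (potential_simplices n (Suc i) (coin_complex n i F)) False (\<lambda>_. bernoulli_pmf (p (Suc i)))))"
  proof (rule bind_pmf_cong[OF refl])
    fix F
    define S where "S = potential_simplices n (Suc i) (coin_complex n i F)"
    have S: "S \<subseteq> N" unfolding S_def potential_simplices_coin_complex N_def by auto
    have "Pi_pmf S False (\<lambda>_. bernoulli_pmf (p (Suc i))) = Pi_pmf S False ?b"
      using S cardN by (intro Pi_pmf_cong) (auto simp: cardN subset_iff)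
    also have "\<dots> = map_pmf (\<lambda>f x. if x \<in> S then f x else False) (Pi_pmf N False ?b)"
      using cov(3) S by (rule Pi_pmf_subset)
    finally have sub: "Pi_pmf S False (\<lambda>_. bernoulli_pmf (p (Suc i))) = map_pmf (\<lambda>f x. if x \<in> S then f x else False) (Pi_pmf N False ?b)" .
    have "coin_complex n (Suc i) (\<lambda>x. if x \<in> coins n i then F x else G x) = coin_complex n i F \<union> {\<sigma> \<in> S. if \<sigma> \<in> S then G \<sigma> else False}" for G
      unfolding S_def using S cov(2) by (intro coin_complex_Suc) (auto simp: S_def)
    then show "map_pmf (\<lambda>G. coin_complex n (Suc i) (\<lambda>x. if x \<in> coins n i then F x else G x)) (Pi_pmf N False ?b)
      = map_pmf (\<lambda>G. coin_complex n i F \<union> {\<sigma> \<in> potential_simplices n (Suc i) (coin_complex n i F). G \<sigma>})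
       (Pi_pmf (potential_simplices n (Suc i) (coin_complex n i F)) False (\<lambda>_. bernoulli_pmf (p (Suc i))))"
      unfolding S_def[symmetric] sub by (simp add: map_pmf_comp)
  qed
  finally show ?case by (simp add: Suc.IH bind_map_pmf)
qed

lemma finite_set_coin_pmf: "finite (set_pmf (coin_pmf n p i))"
  unfolding coin_pmf_def
  by (rule finite_subset[OF set_Pi_pmf_subset'[OF finite_coins]]) (auto intro!: finite_PiE_dflt)

lemma prob_all_coins:
  assumes "Q \<subseteq> coins n i" "\<And>j. 0 \<le> p j" "\<And>j. p j \<le> 1"
  shows "measure_pmf.prob (coin_pmf n p i) {F. \<forall>\<tau>\<in>Q. F \<tau>} = (\<Prod>\<tau>\<in>Q. p (card \<tau> - 1))"
proof -
  have "{F. \<forall>\<tau>\<in>Q. F \<tau>} = Pi (coins n i) (\<lambda>\<tau>. if \<tau> \<in> Q then {True} else UNIV)"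
    using assms(1) by (auto simp: Pi_def)
  then have "measure_pmf.prob (coin_pmf n p i) {F. \<forall>\<tau>\<in>Q. F \<tau>}
    = (\<Prod>\<tau>\<in>coins n i. measure_pmf.prob (bernoulli_pmf (p (card \<tau> - 1))) (if \<tau> \<in> Q then {True} else UNIV))"
    unfolding coin_pmf_def by (simp add: measure_Pi_pmf_Pi)
  also have "\<dots> = (\<Prod>\<tau>\<in>coins n i. if \<tau> \<in> Q then p (card \<tau> - 1) else 1)"
    using assms by (intro prod.cong) (auto simp: measure_pmf_single)
  also have "\<dots> = (\<Prod>\<tau>\<in>Q. p (card \<tau> - 1))"
    using assms(1) by (simp add: prod.If_cases Int_absorb1)
  finally show ?thesis .
qed

section \<open>Counting cliques\<close>

lemma card_bijections:
  assumes "card R = card \<sigma>" "finite R" "finite \<sigma>"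
  shows "card {x \<in> R \<rightarrow>\<^sub>E \<sigma>. inj_on x R} = fact (card \<sigma>)"
  using card_inj_on_subset_funcset[OF assms(2,3), of R] assms(1) by (simp add: fact_prod_rev)

lemma finite_card_subsets: "finite V \<Longrightarrow> finite {\<sigma>. \<sigma> \<subseteq> V \<and> card \<sigma> = r}"
  by (rule finite_subset[of _ "Pow V"]) auto

text \<open>Each set of size \<open>r\<close> is the image of exactly \<open>r!\<close> injective
  maps from \<open>R\<close>. Maps turn vertices into independent coordinates, the setting of the
  Finner inequality and of multinomial expansion.\<close>

lemma sum_over_bijections:
  fixes H :: "'a set \<Rightarrow> real"
  assumes "finite V" "finite R" "card R = r"
  shows "fact r * (\<Sum>\<sigma> | \<sigma> \<subseteq> V \<and> card \<sigma> = r. H \<sigma>) = (\<Sum>x\<in>{x \<in> R \<rightarrow>\<^sub>E V. inj_on x R}. H (x ` R))"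
proof -
  let ?S = "{\<sigma>. \<sigma> \<subseteq> V \<and> card \<sigma> = r}"
  let ?X = "{x \<in> R \<rightarrow>\<^sub>E V. inj_on x R}"
  have "(\<Sum>x\<in>?X. H (x ` R)) = (\<Sum>\<sigma>\<in>?S. \<Sum>x\<in>{x \<in> ?X. x ` R = \<sigma>}. H (x ` R))"
  proof (rule sum.group[symmetric])
    show "finite ?X" using assms by (intro finite_subset[of ?X "R \<rightarrow>\<^sub>E V"] finite_PiE) auto
    show "finite ?S" using assms(1) by (rule finite_card_subsets)
    show "(\<lambda>x. x ` R) ` ?X \<subseteq> ?S" using assms by (auto simp: card_image)
  qed
  also have "\<dots> = (\<Sum>\<sigma>\<in>?S. fact r * H \<sigma>)"
  proof (rule sum.cong[OF refl])
    fix \<sigma> assume s: "\<sigma> \<in> ?S"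
    then have fin: "finite \<sigma>" using assms(1) finite_subset by blast
    have "{x \<in> ?X. x ` R = \<sigma>} = {x \<in> R \<rightarrow>\<^sub>E \<sigma>. inj_on x R}"
    proof (intro Set.set_eqI iffI)
      fix x assume "x \<in> {x \<in> R \<rightarrow>\<^sub>E \<sigma>. inj_on x R}"
      then have x: "x \<in> R \<rightarrow>\<^sub>E \<sigma>" "inj_on x R" by auto
      have "x ` R = \<sigma>"
        using x s fin assms by (intro card_subset_eq) (auto simp: card_image)
      then show "x \<in> {x \<in> ?X. x ` R = \<sigma>}" using x s by (auto simp: PiE_iff)
    qed (auto simp: PiE_iff)
    then have "card {x \<in> ?X. x ` R = \<sigma>} = fact r"
      using card_bijections[of R \<sigma>] s fin assms by simp
    then show "(\<Sum>x\<in>{x \<in> ?X. x ` R = \<sigma>}. H (x ` R)) = fact r * H \<sigma>" by simp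
  qed
  finally show ?thesis by (simp add: sum_distrib_left)
qed

lemma card_functions_with_image:
  assumes "finite R" "finite V" "F \<subseteq> R" "card F = s" "card A = s"
  shows "card {x \<in> R \<rightarrow>\<^sub>E V. x ` F = A} \<le> s ^ s * card V ^ (card R - s)"
proof -
  have finF: "finite F" using assms finite_subset by blast
  show ?thesis
  proof (cases "finite A")
    case True
    have "{x \<in> R \<rightarrow>\<^sub>E V. x ` F = A} \<subseteq> PiE R (\<lambda>i. if i \<in> F then A else V)"
      by (auto simp: PiE_iff extensional_def)
    then have "card {x \<in> R \<rightarrow>\<^sub>E V. x ` F = A} \<le> card (PiE R (\<lambda>i. if i \<in> F then A else V))"
      using assms True by (intro card_mono finite_PiE) auto
    also have "\<dots> = (\<Prod>i\<in>R. if i \<in> F then s else card V)"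
      using assms by (subst card_PiE) (auto intro!: prod.cong)
    also have "\<dots> = s ^ s * card V ^ (card R - s)"
      using assms finF by (simp add: prod.If_cases Int_absorb1 card_Diff_subset Diff_eq[symmetric])
    finally show ?thesis .
  next
    case False
    have "{x \<in> R \<rightarrow>\<^sub>E V. x ` F = A} = {}" using False finF by auto
    then show ?thesis by (simp only: card.empty le0)
  qed
qed

text \<open>The Finner inequality for maps from the \<open>k + 1\<close> positions in
  \<open>R\<close>, with one factor per subset of size \<open>q + 1\<close>. Each position lies in
  \<open>k choose q\<close> of these subsets, and each factor has average at most \<open>B\<close>.
  In the application \<open>b\<close> is \<open>1 / p q\<close>, the gain in probability from one
  forced \<open>q\<close>-face.\<close>

lemma sum_cliques_le:
  fixes Q :: "'a set set" and V :: "'a set" and b :: real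
  assumes "finite V" "V \<noteq> {}" "finite Q" "1 \<le> b" "q \<le> k"
  defines "G \<equiv> \<lambda>\<tau>. if \<tau> \<in> Q then b else (1 :: real)"
  shows "(\<Sum>\<sigma> | \<sigma> \<subseteq> V \<and> card \<sigma> = k + 1. \<Prod>\<tau> | \<tau> \<subseteq> \<sigma> \<and> card \<tau> = q + 1. G \<tau>)
    \<le> card V ^ (k + 1) / fact (k + 1) *
      (1 + (q + 1) ^ (q + 1) * card Q * b ^ (k choose q) / card V ^ (q + 1))
        powr (((k + 1) choose (q + 1)) / (k choose q))"
proof -
  define R where "R = {..k}"
  define I where "I = {F. F \<subseteq> R \<and> card F = q + 1}"
  define d where "d = k choose q"
  define nV where "nV = real (card V)"
  have R: "finite R" "card R = k + 1" by (auto simp: R_def)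
  have I: "finite I" "card I = (k + 1) choose (q + 1)"
    unfolding I_def using R n_subsets[OF R(1), of "q + 1"] by (auto intro: finite_card_subsets)
  have d: "0 < d" using assms by (simp add: d_def)
  have nV: "0 < nV" using assms by (simp add: nV_def card_gt_0_iff)
  have G1: "1 \<le> G \<tau>" for \<tau> using assms by (simp add: G_def)
  \<comment> \<open>Dropping injectivity adds nonnegative terms only, but then \<open>F\<close> may
    be mapped to a smaller set. Weight 1 there leaves just the images of size \<open>q + 1\<close>,
    which \<open>card_functions_with_image\<close> can count.\<close>
  define G' where "G' = (\<lambda>\<tau>. if card \<tau> = q + 1 then G \<tau> else 1)"
  have G'1: "1 \<le> G' \<tau>" for \<tau> using G1 by (simp add: G'_def)
  \<comment> \<open>The power \<open>d\<close> cancels the exponent \<open>1 / d\<close> of the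
    Finner inequality; it is also the source of \<open>b ^ (k choose q)\<close> in the
    bound.\<close>
  define h where "h = (\<lambda>F (x :: nat \<Rightarrow> 'a). G' (x ` F) ^ d)"
  define B where "B = 1 + (q + 1) ^ (q + 1) * card Q * b ^ d / nV ^ (q + 1)"
  have "fact (k + 1) * (\<Sum>\<sigma> | \<sigma> \<subseteq> V \<and> card \<sigma> = k + 1. \<Prod>\<tau> | \<tau> \<subseteq> \<sigma> \<and> card \<tau> = q + 1. G \<tau>)
     = (\<Sum>x\<in>{x \<in> R \<rightarrow>\<^sub>E V. inj_on x R}. \<Prod>\<tau> | \<tau> \<subseteq> x ` R \<and> card \<tau> = q + 1. G \<tau>)"
    by (rule sum_over_bijections[OF assms(1) R])
  also have "\<dots> = (\<Sum>x\<in>{x \<in> R \<rightarrow>\<^sub>E V. inj_on x R}. \<Prod>F\<in>I. h F x powr (1 / d))"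
  proof (rule sum.cong[OF refl])
    fix x assume "x \<in> {x \<in> R \<rightarrow>\<^sub>E V. inj_on x R}"
    then have inj: "inj_on x R" by simp
    have cF: "card (x ` F) = q + 1" if "F \<in> I" for F
      using that inj by (auto simp: I_def card_image inj_on_subset)
    have "{\<tau>. \<tau> \<subseteq> x ` R \<and> card \<tau> = q + 1} = (\<lambda>F. x ` F) ` I"
    proof (intro Set.set_eqI iffI)
      fix \<tau> assume t: "\<tau> \<in> {\<tau>. \<tau> \<subseteq> x ` R \<and> card \<tau> = q + 1}"
      then obtain F where F: "F \<subseteq> R" "\<tau> = x ` F" by (auto elim: subset_imageE)
      then have "card F = q + 1" using t inj by (auto simp: card_image inj_on_subset)
      with F show "\<tau> \<in> (\<lambda>F. x ` F) ` I" by (auto simp: I_def)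
    qed (use cF in \<open>auto simp: I_def\<close>)
    moreover have "inj_on ((`) x) I"
      using inj_on_image_Pow[OF inj] by (rule inj_on_subset) (auto simp: I_def)
    ultimately have "(\<Prod>\<tau> | \<tau> \<subseteq> x ` R \<and> card \<tau> = q + 1. G \<tau>) = (\<Prod>F\<in>I. G (x ` F))"
      by (simp add: prod.reindex)
    also have "\<dots> = (\<Prod>F\<in>I. h F x powr (1 / d))"
    proof (rule prod.cong[OF refl])
      fix F assume "F \<in> I"
      then have "G (x ` F) = G' (x ` F)" using cF by (simp add: G'_def)
      moreover have "0 < G' (x ` F)" using G'1[of "x ` F"] by linarith
      ultimately show "G (x ` F) = h F x powr (1 / d)"
        using d by (simp add: h_def powr_realpow[symmetric] powr_powr)
    qed
    finally show "(\<Prod>\<tau> | \<tau> \<subseteq> x ` R \<and> card \<tau> = q + 1. G \<tau>) = (\<Prod>F\<in>I. h F x powr (1 / d))" .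
  qed
  also have "\<dots> \<le> (\<Sum>x\<in>R \<rightarrow>\<^sub>E V. \<Prod>F\<in>I. h F x powr (1 / d))"
    using R assms(1) by (intro sum_mono2 finite_PiE) (auto intro!: prod_nonneg)
  also have "\<dots> = nV ^ (k + 1) * ((\<Sum>x\<in>R \<rightarrow>\<^sub>E V. \<Prod>F\<in>I. h F x powr (1 / d)) / card V ^ card R)"
    using nV R by (simp add: nV_def)
  also have "\<dots> \<le> nV ^ (k + 1) * (\<Prod>F\<in>I. ((\<Sum>x\<in>R \<rightarrow>\<^sub>E V. h F x) / card V ^ card R) powr (1 / d))"
  proof (rule mult_left_mono[OF average_prod_powr_le_PiE])
    show "0 \<le> h F x" for F x unfolding h_def using G'1[of "x ` F"] by (intro zero_le_power) linarith
    fix v assume v: "v \<in> R"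
    have "{F \<in> I. \<exists>x y. h F (x(v := y)) \<noteq> h F x} \<subseteq> {F \<in> I. v \<in> F}"
    proof (rule subsetI, rule ccontr)
      fix F assume F: "F \<in> {F \<in> I. \<exists>x y. h F (x(v := y)) \<noteq> h F x}" and "F \<notin> {F \<in> I. v \<in> F}"
      then have "v \<notin> F" by auto
      then have "x(v := y) ` F = x ` F" for x :: "nat \<Rightarrow> 'a" and y by (auto simp: image_iff)
      then have "h F (x(v := y)) = h F x" for x y unfolding h_def by metis
      with F show False by blast
    qed
    also have "\<dots> \<subseteq> insert v ` {F. F \<subseteq> R - {v} \<and> card F = q}"
    proof
      fix F assume "F \<in> {F \<in> I. v \<in> F}"
      then have F: "F \<subseteq> R" "card F = q + 1" "v \<in> F" by (auto simp: I_def)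
      then have "finite F" using R finite_subset by blast
      then have "card (F - {v}) = q" "F = insert v (F - {v})" using F by auto
      then show "F \<in> insert v ` {F. F \<subseteq> R - {v} \<and> card F = q}" using F by blast
    qed
    finally have "card {F \<in> I. \<exists>x y. h F (x(v := y)) \<noteq> h F x} \<le> card (insert v ` {F. F \<subseteq> R - {v} \<and> card F = q})"
      using R by (intro card_mono finite_imageI finite_card_subsets) auto
    also have "\<dots> \<le> card {F. F \<subseteq> R - {v} \<and> card F = q}"
      using R by (intro card_image_le finite_card_subsets) auto
    also have "\<dots> = d" using n_subsets[of "R - {v}" q] R v by (simp add: d_def)
    finally show "card {F \<in> I. \<exists>x y. h F (x(v := y)) \<noteq> h F x} \<le> d" .
  qed (use assms R I d nV in auto)
  also have "\<dots> \<le> nV ^ (k + 1) * (\<Prod>F\<in>I. B powr (1 / d))"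
  proof (intro mult_left_mono prod_mono conjI powr_mono2)
    fix F assume F: "F \<in> I"
    let ?Q = "{\<tau> \<in> Q. card \<tau> = q + 1}"
    have bd: "0 \<le> b ^ d" using assms by simp
    have "(\<Sum>x\<in>R \<rightarrow>\<^sub>E V. h F x) \<le> (\<Sum>x\<in>R \<rightarrow>\<^sub>E V. 1 + (if x ` F \<in> ?Q then b ^ d else 0))"
      using assms by (intro sum_mono) (auto simp: h_def G'_def G_def)
    also have "\<dots> = nV ^ (k + 1) + card {x \<in> R \<rightarrow>\<^sub>E V. x ` F \<in> ?Q} * b ^ d"
      using R assms(1) by (simp add: sum.distrib card_funcsetE nV_def sum.If_cases finite_PiE Int_def)
    also have "card {x \<in> R \<rightarrow>\<^sub>E V. x ` F \<in> ?Q} \<le> card Q * ((q + 1) ^ (q + 1) * card V ^ (k - q))"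
    proof -
      have "{x \<in> R \<rightarrow>\<^sub>E V. x ` F \<in> ?Q} = (\<Union>A\<in>?Q. {x \<in> R \<rightarrow>\<^sub>E V. x ` F = A})" by auto
      then have "card {x \<in> R \<rightarrow>\<^sub>E V. x ` F \<in> ?Q} \<le> (\<Sum>A\<in>?Q. card {x \<in> R \<rightarrow>\<^sub>E V. x ` F = A})"
        using assms(3) card_UN_le[of ?Q "\<lambda>A. {x \<in> R \<rightarrow>\<^sub>E V. x ` F = A}"] by simp
      also have "\<dots> \<le> (\<Sum>A\<in>?Q. (q + 1) ^ (q + 1) * card V ^ (card R - (q + 1)))"
        using F R assms(1) by (intro sum_mono card_functions_with_image) (auto simp: I_def)
      also have "\<dots> = card ?Q * ((q + 1) ^ (q + 1) * card V ^ (k - q))" using R by simp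
      also have "\<dots> \<le> card Q * ((q + 1) ^ (q + 1) * card V ^ (k - q))"
        using assms(3) by (intro mult_right_mono card_mono) auto
      finally show ?thesis .
    qed
    then have "nV ^ (k + 1) + card {x \<in> R \<rightarrow>\<^sub>E V. x ` F \<in> ?Q} * b ^ d
      \<le> nV ^ (k + 1) + real (card Q * ((q + 1) ^ (q + 1) * card V ^ (k - q))) * b ^ d"
      using bd by (intro add_left_mono mult_right_mono) (simp_all only: of_nat_le_iff)
    also have "\<dots> = nV ^ (k + 1) * B"
    proof -
      have "k + 1 = (k - q) + (q + 1)" using assms(5) by simp
      then have "nV ^ (k + 1) = nV ^ (k - q) * nV ^ (q + 1)" by (metis power_add)
      then show ?thesis using nV by (simp add: B_def nV_def[symmetric] field_simps)
    qed
    finally show "(\<Sum>x\<in>R \<rightarrow>\<^sub>E V. h F x) / card V ^ card R \<le> B"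
      using nV R by (simp add: nV_def[symmetric] divide_le_eq mult.commute)
    have "0 \<le> h F x" for x unfolding h_def using G'1[of "x ` F"] by (intro zero_le_power) linarith
    then show "0 \<le> (\<Sum>x\<in>R \<rightarrow>\<^sub>E V. h F x) / card V ^ card R"
      by (intro divide_nonneg_nonneg sum_nonneg) auto
  qed (use nV in auto)
  also have "(\<Prod>F\<in>I. B powr (1 / d)) = B powr (((k + 1) choose (q + 1)) / d)"
  proof -
    have "0 < B" unfolding B_def using nV assms(4) by (intro add_pos_nonneg) auto
    then show ?thesis using I by (simp add: powr_realpow[symmetric] powr_powr)
  qed
  finally have main: "fact (k + 1) * (\<Sum>\<sigma> | \<sigma> \<subseteq> V \<and> card \<sigma> = k + 1. \<Prod>\<tau> | \<tau> \<subseteq> \<sigma> \<and> card \<tau> = q + 1. G \<tau>)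
    \<le> nV ^ (k + 1) * B powr (((k + 1) choose (q + 1)) / d)" .
  define S where "S = (\<Sum>\<sigma> | \<sigma> \<subseteq> V \<and> card \<sigma> = k + 1. \<Prod>\<tau> | \<tau> \<subseteq> \<sigma> \<and> card \<tau> = q + 1. G \<tau>)"
  have "(0::real) < fact (k + 1)" by simp
  then have "S \<le> nV ^ (k + 1) * B powr (((k + 1) choose (q + 1)) / d) / fact (k + 1)"
    using main by (simp only: S_def[symmetric] pos_le_divide_eq mult.commute)
  then show ?thesis
    by (simp only: S_def B_def d_def nV_def of_nat_power times_divide_eq_left of_nat_add of_nat_mult of_nat_1)
qed

lemma card_supersets_le:
  assumes "finite V" "finite Q" "\<And>\<tau>. \<tau> \<in> Q \<Longrightarrow> card \<tau> = s" "s \<le> r"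
  shows "card {\<sigma>. \<sigma> \<subseteq> V \<and> card \<sigma> = r \<and> (\<exists>\<tau>\<in>Q. \<tau> \<subseteq> \<sigma>)} \<le> card Q * card V ^ (r - s)"
proof -
  have one: "card {\<sigma>. \<sigma> \<subseteq> V \<and> card \<sigma> = r \<and> \<tau> \<subseteq> \<sigma>} \<le> card V ^ (r - s)" if "\<tau> \<in> Q" for \<tau>
  proof -
    let ?T = "{\<rho>. \<rho> \<subseteq> V \<and> card \<rho> = r - s}"
    have "{\<sigma>. \<sigma> \<subseteq> V \<and> card \<sigma> = r \<and> \<tau> \<subseteq> \<sigma>} \<subseteq> (\<lambda>\<rho>. \<tau> \<union> \<rho>) ` ?T"
    proof
      fix \<sigma> assume s: "\<sigma> \<in> {\<sigma>. \<sigma> \<subseteq> V \<and> card \<sigma> = r \<and> \<tau> \<subseteq> \<sigma>}"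
      then have "\<tau> \<subseteq> V" by auto
      then have "finite \<tau>" using assms(1) by (rule finite_subset)
      then have "card (\<sigma> - \<tau>) = r - s" using s assms(3)[OF that] by (simp add: card_Diff_subset)
      moreover have "\<sigma> = \<tau> \<union> (\<sigma> - \<tau>)" "\<sigma> - \<tau> \<subseteq> V" using s by auto
      ultimately show "\<sigma> \<in> (\<lambda>\<rho>. \<tau> \<union> \<rho>) ` ?T" by (intro image_eqI[of _ _ "\<sigma> - \<tau>"]) simp_all
    qed
    then have "card {\<sigma>. \<sigma> \<subseteq> V \<and> card \<sigma> = r \<and> \<tau> \<subseteq> \<sigma>} \<le> card ?T"
      using finite_card_subsets[OF assms(1)] by (meson card_image_le card_mono finite_imageI le_trans)
    also have "\<dots> = card V choose (r - s)" using n_subsets[OF assms(1)] by simp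
    also have "\<dots> \<le> card V ^ (r - s)"
      by (cases "r - s \<le> card V") (simp_all add: binomial_le_pow binomial_eq_0)
    finally show ?thesis .
  qed
  have "{\<sigma>. \<sigma> \<subseteq> V \<and> card \<sigma> = r \<and> (\<exists>\<tau>\<in>Q. \<tau> \<subseteq> \<sigma>)} = (\<Union>\<tau>\<in>Q. {\<sigma>. \<sigma> \<subseteq> V \<and> card \<sigma> = r \<and> \<tau> \<subseteq> \<sigma>})" by auto
  then have "card {\<sigma>. \<sigma> \<subseteq> V \<and> card \<sigma> = r \<and> (\<exists>\<tau>\<in>Q. \<tau> \<subseteq> \<sigma>)} \<le> (\<Sum>\<tau>\<in>Q. card {\<sigma>. \<sigma> \<subseteq> V \<and> card \<sigma> = r \<and> \<tau> \<subseteq> \<sigma>})"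
    using card_UN_le[OF assms(2), of "\<lambda>\<tau>. {\<sigma>. \<sigma> \<subseteq> V \<and> card \<sigma> = r \<and> \<tau> \<subseteq> \<sigma>}"] by simp
  also have "\<dots> \<le> (\<Sum>\<tau>\<in>Q. card V ^ (r - s))" using one by (rule sum_mono)
  finally show ?thesis by simp
qed

text \<open>Faces are grouped by dimension, and \<open>j < card \<tau>\<close> means dimension at
  least \<open>j\<close>. With \<open>1 \<le> j\<close> every such subset has two elements or more
  and therefore owns a coin.\<close>

lemma prod_faces_by_dim:
  fixes f :: "nat \<Rightarrow> 'b :: comm_monoid_mult"
  assumes "finite \<sigma>" "card \<sigma> = t + 1" "1 \<le> j"
  shows "(\<Prod>\<tau> | \<tau> \<in> coin_faces \<sigma> \<and> j < card \<tau>. f (card \<tau> - 1)) = (\<Prod>i=j..t. f i ^ ((t + 1) choose (i + 1)))"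
proof -
  let ?S = "{\<tau>. \<tau> \<in> coin_faces \<sigma> \<and> j < card \<tau>}"
  have fin: "finite ?S" using finite_coin_faces[OF assms(1)] by simp
  have "(\<Prod>\<tau>\<in>?S. f (card \<tau> - 1)) = (\<Prod>i\<in>{j..t}. \<Prod>\<tau>\<in>{\<tau> \<in> ?S. card \<tau> - 1 = i}. f (card \<tau> - 1))"
  proof (rule prod.group[symmetric, OF fin])
    show "(\<lambda>\<tau>. card \<tau> - 1) ` ?S \<subseteq> {j..t}"
    proof
      fix i assume "i \<in> (\<lambda>\<tau>. card \<tau> - 1) ` ?S"
      then obtain \<tau> where "\<tau> \<subseteq> \<sigma>" "j < card \<tau>" "i = card \<tau> - 1" by (auto simp: coin_faces_def)
      with card_mono[OF assms(1), of \<tau>] assms(2) show "i \<in> {j..t}" by auto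
    qed
  qed simp
  also have "\<dots> = (\<Prod>i=j..t. f i ^ ((t + 1) choose (i + 1)))"
  proof (rule prod.cong[OF refl])
    fix i assume i: "i \<in> {j..t}"
    have "{\<tau> \<in> ?S. card \<tau> - 1 = i} = {\<tau>. \<tau> \<subseteq> \<sigma> \<and> card \<tau> = i + 1}"
      using i assms(3) by (auto simp: coin_faces_def)
    then have "card {\<tau> \<in> ?S. card \<tau> - 1 = i} = (t + 1) choose (i + 1)"
      using n_subsets[OF assms(1), of "i + 1"] assms(2) by simp
    then show "(\<Prod>\<tau>\<in>{\<tau> \<in> ?S. card \<tau> - 1 = i}. f (card \<tau> - 1)) = f i ^ ((t + 1) choose (i + 1))" by simp
  qed
  finally show ?thesis .
qed

section \<open>Forced faces and moments\<close>

lemma prod_le_prod_subset: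
  fixes f :: "'a \<Rightarrow> real"
  assumes "finite A" "B \<subseteq> A" "\<And>x. x \<in> A \<Longrightarrow> 0 \<le> f x \<and> f x \<le> 1"
  shows "prod f A \<le> prod f B"
proof -
  have "prod f A = prod f (A - B) * prod f B" by (rule prod.subset_diff[OF assms(2,1)])
  also have "\<dots> \<le> 1 * prod f B"
    using assms by (intro mult_right_mono prod_le_1 prod_nonneg) auto
  finally show ?thesis by simp
qed

lemma card_coin_faces_le: "finite \<sigma> \<Longrightarrow> card (coin_faces \<sigma>) \<le> 2 ^ card \<sigma>"
  using card_mono[of "Pow \<sigma>" "coin_faces \<sigma>"] by (auto simp: coin_faces_def card_Pow)

text \<open>
  Expected number of \<open>k\<close>-simplices given that all coins in \<open>Q\<close> are heads. A simplex containing a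
  face from \<open>Q\<close> of dimension \<open>j > q\<close> is bounded by counting the choices of one such face of
  maximal dimension; the others meet \<open>Q\<close> in dimension at most \<open>q\<close>, where the Finner inequality
  applies.
\<close>

lemma sum_extensions_le:
  fixes p :: "nat \<Rightarrow> real"
  assumes Q: "finite Q" and q: "1 \<le> q" "q \<le> k" and n: "1 \<le> n"
    and p1: "\<And>i. 1 \<le> i \<Longrightarrow> i < q \<Longrightarrow> p i = 1"
    and p: "\<And>i. 1 \<le> i \<Longrightarrow> i \<le> k \<Longrightarrow> 0 < p i \<and> p i \<le> 1"
  shows "(\<Sum>\<sigma> | \<sigma> \<subseteq> {1..n} \<and> card \<sigma> = k + 1. \<Prod>\<tau>\<in>coin_faces \<sigma> - Q. p (card \<tau> - 1))
    \<le> (\<Prod>i=q..k. p i ^ ((k + 1) choose (i + 1))) *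
      (n ^ (k + 1) / fact (k + 1) *
        (1 + (q + 1) ^ (q + 1) * card Q * (1 / p q) ^ (k choose q) / n ^ (q + 1))
          powr (((k + 1) choose (q + 1)) / (k choose q))
      + (\<Sum>j=q+1..k. card Q * n ^ (k - j) / (\<Prod>i=q..j. p i ^ ((k + 1) choose (i + 1)))))"
proof -
  define P where "P j = (\<Prod>i=q..j. p i ^ ((k + 1) choose (i + 1)))" for j
  define G where "G = (\<lambda>\<tau>. if \<tau> \<in> Q then 1 / p q else 1)"
  define Sk where "Sk = {\<sigma>. \<sigma> \<subseteq> {1..n} \<and> card \<sigma> = k + 1}"
  \<comment> \<open>The product of the probabilities over all faces of dimension above
    \<open>j\<close>. It bounds the conditional probability of a \<open>k\<close>-simplex whose
    largest forced face has dimension \<open>j\<close>.\<close>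
  define c where "c j = P k / P j" for j
  have finSk: "finite Sk" unfolding Sk_def by (rule finite_card_subsets) simp
  have P0: "0 < P j" if "j \<le> k" for j
    unfolding P_def using p q that by (intro prod_pos zero_less_power) auto
  have c0: "0 \<le> c j" if "j \<le> k" for j unfolding c_def using P0[of k] P0[OF that] by simp
  have pq: "0 < p q" "p q \<le> 1" using p q by auto
  have G1: "1 \<le> G \<tau>" for \<tau> using pq by (simp add: G_def)
  have pointwise: "(\<Prod>\<tau>\<in>coin_faces \<sigma> - Q. p (card \<tau> - 1)) \<le> P k * (\<Prod>\<tau> | \<tau> \<subseteq> \<sigma> \<and> card \<tau> = q + 1. G \<tau>)
    + (\<Sum>j=q+1..k. if \<exists>\<tau>\<in>{\<tau> \<in> Q. card \<tau> = j + 1}. \<tau> \<subseteq> \<sigma> then c j else 0)" (is "?W \<le> ?A + ?B") if \<sigma>: "\<sigma> \<in> Sk" for \<sigma>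
  proof -
    have fin: "finite \<sigma>" and card\<sigma>: "card \<sigma> = k + 1" using \<sigma> finite_subset by (auto simp: Sk_def)
    have B0: "0 \<le> ?B" using c0 by (intro sum_nonneg) auto
    have A0: "0 \<le> ?A" using G1 P0[of k] by (intro mult_nonneg_nonneg prod_nonneg) (auto intro: order_trans[OF zero_le_one] less_imp_le)
    have fc: "\<tau> \<subseteq> \<sigma>" "1 \<le> card \<tau> - 1" "card \<tau> - 1 \<le> k" "2 \<le> card \<tau>" if "\<tau> \<in> coin_faces \<sigma>" for \<tau>
      using that card_mono[OF fin, of \<tau>] card\<sigma> by (auto simp: coin_faces_def)
    show ?thesis
    proof (cases "\<forall>\<tau>\<in>Q \<inter> coin_faces \<sigma>. card \<tau> \<le> q + 1")
      case True
      \<comment> \<open>Coins below dimension \<open>q\<close> have probability 1, forced or not. In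
        this case only the forced \<open>q\<close>-faces change the product, each by a factor
        \<open>1 / p q\<close>.\<close>
      define H where "H \<tau> = (if card \<tau> = q + 1 then G \<tau> else 1)" for \<tau>
      have finc: "finite (coin_faces \<sigma>)" using fin by (rule finite_coin_faces)
      have "?W = (\<Prod>\<tau>\<in>coin_faces \<sigma>. if \<tau> \<in> Q then 1 else p (card \<tau> - 1))"
        using finc by (simp add: prod.If_cases Diff_eq)
      also have "\<dots> = (\<Prod>\<tau>\<in>coin_faces \<sigma>. p (card \<tau> - 1) * H \<tau>)"
      proof (rule prod.cong[OF refl])
        fix \<tau> assume t: "\<tau> \<in> coin_faces \<sigma>"
        show "(if \<tau> \<in> Q then 1 else p (card \<tau> - 1)) = p (card \<tau> - 1) * H \<tau>"
        proof (cases "card \<tau> = q + 1")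
          case True then show ?thesis using pq by (simp add: H_def G_def)
        next
          case False
          have "card \<tau> - 1 < q" if "\<tau> \<in> Q"
          proof -
            have "card \<tau> \<le> q + 1" using True t that by blast
            with False show ?thesis using fc[OF t] by linarith
          qed
          then show ?thesis using False p1 fc[OF t] by (auto simp: H_def)
        qed
      qed
      also have "\<dots> = (\<Prod>\<tau>\<in>coin_faces \<sigma>. p (card \<tau> - 1)) * (\<Prod>\<tau>\<in>coin_faces \<sigma>. H \<tau>)" by (rule prod.distrib)
      also have "(\<Prod>\<tau>\<in>coin_faces \<sigma>. H \<tau>) = (\<Prod>\<tau> | \<tau> \<subseteq> \<sigma> \<and> card \<tau> = q + 1. G \<tau>)"
        using finc q by (intro prod.mono_neutral_cong_right) (auto simp: coin_faces_def H_def)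
      also have "(\<Prod>\<tau>\<in>coin_faces \<sigma>. p (card \<tau> - 1)) = (\<Prod>\<tau> | \<tau> \<in> coin_faces \<sigma> \<and> q < card \<tau>. p (card \<tau> - 1))"
      proof (rule prod.mono_neutral_right[OF finc])
        show "\<forall>\<tau>\<in>coin_faces \<sigma> - {\<tau> \<in> coin_faces \<sigma>. q < card \<tau>}. p (card \<tau> - 1) = 1"
        proof
          fix \<tau> assume t: "\<tau> \<in> coin_faces \<sigma> - {\<tau> \<in> coin_faces \<sigma>. q < card \<tau>}"
          then have "\<tau> \<in> coin_faces \<sigma>" "card \<tau> \<le> q" by auto
          then show "p (card \<tau> - 1) = 1" using fc[of \<tau>] by (intro p1) auto
        qed
      qed auto
      also have "\<dots> = P k" unfolding P_def by (rule prod_faces_by_dim[OF fin card\<sigma> q(1)])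
      finally show ?thesis using B0 by linarith
    next
      case False
      define S where "S = {\<tau> \<in> Q \<inter> coin_faces \<sigma>. q + 1 < card \<tau>}"
      have S: "finite S" "S \<noteq> {}" using False Q by (auto simp: S_def not_le)
      define j where "j = Max (card ` S) - 1"
      have "Max (card ` S) \<in> card ` S" using S by (intro Max_in) auto
      then obtain \<tau>0 where t0: "\<tau>0 \<in> S" "card \<tau>0 = Max (card ` S)" by auto
      have j: "q + 1 \<le> j" "j \<le> k" "card \<tau>0 = j + 1" "\<tau>0 \<in> Q" "\<tau>0 \<subseteq> \<sigma>"
        using t0 fc[of \<tau>0] unfolding j_def by (auto simp: S_def)
      have big: "\<tau> \<notin> Q" if "\<tau> \<in> coin_faces \<sigma>" "j + 1 < card \<tau>" for \<tau>
      proof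
        assume "\<tau> \<in> Q"
        then have "\<tau> \<in> S" using that j by (auto simp: S_def)
        then have "card \<tau> \<le> Max (card ` S)" using S by (intro Max_ge) auto
        then show False using that j t0 by simp
      qed
      \<comment> \<open>By maximality of \<open>j\<close> no face of higher dimension is forced, so
        all their coins are still in the product; the other factors are at most 1 and are
        dropped.\<close>
      have "?W \<le> (\<Prod>\<tau> | \<tau> \<in> coin_faces \<sigma> \<and> j + 1 < card \<tau>. p (card \<tau> - 1))"
        using fin fc p big by (intro prod_le_prod_subset) (auto simp: finite_coin_faces less_imp_le)
      also have "\<dots> = (\<Prod>i=j+1..k. p i ^ ((k + 1) choose (i + 1)))"
        by (rule prod_faces_by_dim[OF fin card\<sigma>]) simp
      also have "\<dots> = c j"
      proof -
        have "{q..k} = {q..j} \<union> {j+1..k}" "{q..j} \<inter> {j+1..k} = {}" using j by auto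
        then have "P k = P j * (\<Prod>i=j+1..k. p i ^ ((k + 1) choose (i + 1)))"
          unfolding P_def by (simp add: prod.union_disjoint)
        then show ?thesis using P0[OF j(2)] by (simp add: c_def)
      qed
      also have "c j = (if \<exists>\<tau>\<in>{\<tau> \<in> Q. card \<tau> = j + 1}. \<tau> \<subseteq> \<sigma> then c j else 0)"
        using j by auto
      also have "\<dots> \<le> ?B"
        using j c0 by (intro member_le_sum) auto
      finally show ?thesis using A0 by linarith
    qed
  qed
  have "(\<Sum>\<sigma>\<in>Sk. \<Prod>\<tau>\<in>coin_faces \<sigma> - Q. p (card \<tau> - 1)) \<le> (\<Sum>\<sigma>\<in>Sk. P k * (\<Prod>\<tau> | \<tau> \<subseteq> \<sigma> \<and> card \<tau> = q + 1. G \<tau>)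
    + (\<Sum>j=q+1..k. if \<exists>\<tau>\<in>{\<tau> \<in> Q. card \<tau> = j + 1}. \<tau> \<subseteq> \<sigma> then c j else 0))"
    by (rule sum_mono[OF pointwise])
  also have "\<dots> = P k * (\<Sum>\<sigma>\<in>Sk. \<Prod>\<tau> | \<tau> \<subseteq> \<sigma> \<and> card \<tau> = q + 1. G \<tau>)
    + (\<Sum>j=q+1..k. \<Sum>\<sigma>\<in>Sk. if \<exists>\<tau>\<in>{\<tau> \<in> Q. card \<tau> = j + 1}. \<tau> \<subseteq> \<sigma> then c j else 0)"
    by (simp only: sum.distrib sum_distrib_left sum.swap[of _ "{q+1..k}" Sk])
  also have "\<dots> \<le> P k * (n ^ (k + 1) / fact (k + 1) *
        (1 + (q + 1) ^ (q + 1) * card Q * (1 / p q) ^ (k choose q) / n ^ (q + 1))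
          powr (((k + 1) choose (q + 1)) / (k choose q)))
      + (\<Sum>j=q+1..k. P k * (card Q * n ^ (k - j) / P j))"
  proof (rule add_mono)
    have "(\<Sum>\<sigma>\<in>Sk. \<Prod>\<tau> | \<tau> \<subseteq> \<sigma> \<and> card \<tau> = q + 1. G \<tau>) \<le> n ^ (k + 1) / fact (k + 1) *
        (1 + (q + 1) ^ (q + 1) * card Q * (1 / p q) ^ (k choose q) / n ^ (q + 1))
          powr (((k + 1) choose (q + 1)) / (k choose q))"
      using sum_cliques_le[of "{1..n}" Q "1 / p q" q k] Q q n pq unfolding Sk_def G_def by simp
    then show "P k * (\<Sum>\<sigma>\<in>Sk. \<Prod>\<tau> | \<tau> \<subseteq> \<sigma> \<and> card \<tau> = q + 1. G \<tau>) \<le> P k * (n ^ (k + 1) / fact (k + 1) *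
        (1 + (q + 1) ^ (q + 1) * card Q * (1 / p q) ^ (k choose q) / n ^ (q + 1))
          powr (((k + 1) choose (q + 1)) / (k choose q)))"
      using P0[of k] by (intro mult_left_mono) auto
    show "(\<Sum>j=q+1..k. \<Sum>\<sigma>\<in>Sk. if \<exists>\<tau>\<in>{\<tau> \<in> Q. card \<tau> = j + 1}. \<tau> \<subseteq> \<sigma> then c j else 0)
      \<le> (\<Sum>j=q+1..k. P k * (card Q * n ^ (k - j) / P j))"
    proof (rule sum_mono)
      fix j assume j: "j \<in> {q+1..k}"
      let ?Qj = "{\<tau> \<in> Q. card \<tau> = j + 1}"
      have "card {\<sigma> \<in> Sk. \<exists>\<tau>\<in>?Qj. \<tau> \<subseteq> \<sigma>} \<le> card ?Qj * card {1..n} ^ (k + 1 - (j + 1))"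
        unfolding Sk_def mem_Collect_eq conj_assoc using Q j by (intro card_supersets_le) auto
      also have "\<dots> = card ?Qj * n ^ (k - j)" by simp
      also have "\<dots> \<le> card Q * n ^ (k - j)" using Q by (intro mult_right_mono card_mono) auto
      finally have "card {\<sigma> \<in> Sk. \<exists>\<tau>\<in>?Qj. \<tau> \<subseteq> \<sigma>} \<le> card Q * n ^ (k - j)" .
      then have cnt: "real (card {\<sigma> \<in> Sk. \<exists>\<tau>\<in>?Qj. \<tau> \<subseteq> \<sigma>}) \<le> real (card Q * n ^ (k - j))"
        by (rule of_nat_mono)
      have "(\<Sum>\<sigma>\<in>Sk. if \<exists>\<tau>\<in>?Qj. \<tau> \<subseteq> \<sigma> then c j else 0) = card {\<sigma> \<in> Sk. \<exists>\<tau>\<in>?Qj. \<tau> \<subseteq> \<sigma>} * c j"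
        using finSk by (simp add: sum.If_cases Int_def)
      also have "\<dots> \<le> real (card Q * n ^ (k - j)) * c j" using cnt c0 j by (intro mult_right_mono) auto
      finally show "(\<Sum>\<sigma>\<in>Sk. if \<exists>\<tau>\<in>?Qj. \<tau> \<subseteq> \<sigma> then c j else 0) \<le> P k * (card Q * n ^ (k - j) / P j)"
        by (simp add: c_def mult_ac)
    qed
  qed
  also have "\<dots> = P k * (n ^ (k + 1) / fact (k + 1) *
        (1 + (q + 1) ^ (q + 1) * card Q * (1 / p q) ^ (k choose q) / n ^ (q + 1))
          powr (((k + 1) choose (q + 1)) / (k choose q)) + (\<Sum>j=q+1..k. card Q * n ^ (k - j) / P j))"
    by (simp only: distrib_left sum_distrib_left)
  finally show ?thesis unfolding P_def Sk_def of_nat_power .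
qed

definition simplex_count :: "nat \<Rightarrow> nat \<Rightarrow> (nat set \<Rightarrow> bool) \<Rightarrow> real" where
  "simplex_count n j F = (\<Sum>\<sigma> | \<sigma> \<subseteq> {1..n} \<and> card \<sigma> = j + 1. of_bool (\<forall>\<tau>\<in>coin_faces \<sigma>. F \<tau>))"

lemma card_simplices_coin_complex:
  assumes "j \<le> i"
  shows "card (simplices (coin_complex n i F) j) = simplex_count n j F"
proof -
  have "simplices (coin_complex n i F) j = {\<sigma> \<in> {\<sigma>. \<sigma> \<subseteq> {1..n} \<and> card \<sigma> = j + 1}. \<forall>\<tau>\<in>coin_faces \<sigma>. F \<tau>}"
    using assms by (auto simp: simplices_def coin_complex_def)
  then show ?thesis
    unfolding simplex_count_def
    by (simp only: of_bool_def sum.If_cases[OF finite_card_subsets[OF finite_atLeastAtMost]] Int_def) simp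
qed

lemma integrable_coin_pmf: "integrable (measure_pmf (coin_pmf n p i)) (f :: _ \<Rightarrow> real)"
  using finite_set_coin_pmf by (rule integrable_measure_pmf_finite)

lemma expectation_of_bool:
  "measure_pmf.expectation M (\<lambda>F. of_bool (P F)) = measure_pmf.prob M {F. P F}"
proof -
  have "(\<lambda>F. of_bool (P F)) = (indicator {F. P F} :: _ \<Rightarrow> real)" by (auto simp: indicator_def)
  then show ?thesis by simp
qed

lemma coin_faces_subset_coins:
  assumes "\<sigma> \<subseteq> {1..n}" "card \<sigma> \<le> i + 1"
  shows "coin_faces \<sigma> \<subseteq> coins n i"
proof
  fix \<tau> assume t: "\<tau> \<in> coin_faces \<sigma>"
  have "finite \<sigma>" using assms(1) finite_subset by blast
  then have "card \<tau> \<le> card \<sigma>" using t by (intro card_mono) (auto simp: coin_faces_def)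
  then show "\<tau> \<in> coins n i" using t assms by (auto simp: coin_faces_def coins_def)
qed

text \<open>Heads on \<open>Q\<close> together with \<sigma> means heads on the disjoint union of
  \<open>Q\<close> and \<open>coin_faces \<sigma> - Q\<close>. By independence the second product is
  the conditional probability of \<sigma> given \<open>Q\<close>.\<close>

lemma expectation_planted_simplex_count:
  fixes p :: "nat \<Rightarrow> real"
  assumes "\<And>j. 0 \<le> p j" "\<And>j. p j \<le> 1" "Q \<subseteq> coins n i" "j \<le> i"
  shows "measure_pmf.expectation (coin_pmf n p i) (\<lambda>F. of_bool (\<forall>\<tau>\<in>Q. F \<tau>) * simplex_count n j F)
    = (\<Prod>\<tau>\<in>Q. p (card \<tau> - 1)) *
      (\<Sum>\<sigma> | \<sigma> \<subseteq> {1..n} \<and> card \<sigma> = j + 1. \<Prod>\<tau>\<in>coin_faces \<sigma> - Q. p (card \<tau> - 1))"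
proof -
  let ?S = "{\<sigma>. \<sigma> \<subseteq> {1..n} \<and> card \<sigma> = j + 1}"
  have "measure_pmf.expectation (coin_pmf n p i) (\<lambda>F. of_bool (\<forall>\<tau>\<in>Q. F \<tau>) * simplex_count n j F)
    = (\<Sum>\<sigma>\<in>?S. measure_pmf.expectation (coin_pmf n p i) (\<lambda>F. of_bool (\<forall>\<tau>\<in>Q \<union> coin_faces \<sigma>. F \<tau>)))"
    unfolding simplex_count_def sum_distrib_left
    by (subst Bochner_Integration.integral_sum[OF integrable_coin_pmf])
      (simp add: of_bool_conj[symmetric] ball_Un)
  also have "\<dots> = (\<Sum>\<sigma>\<in>?S. (\<Prod>\<tau>\<in>Q. p (card \<tau> - 1)) * (\<Prod>\<tau>\<in>coin_faces \<sigma> - Q. p (card \<tau> - 1)))"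
  proof (rule sum.cong[OF refl])
    fix \<sigma> assume s: "\<sigma> \<in> ?S"
    then have sub: "coin_faces \<sigma> \<subseteq> coins n i" using assms(4) by (intro coin_faces_subset_coins) auto
    have fin: "finite Q" "finite (coin_faces \<sigma>)"
      using finite_subset[OF assms(3)] finite_subset[OF sub] by auto
    have "measure_pmf.expectation (coin_pmf n p i) (\<lambda>F. of_bool (\<forall>\<tau>\<in>Q \<union> coin_faces \<sigma>. F \<tau>)) = (\<Prod>\<tau>\<in>Q \<union> coin_faces \<sigma>. p (card \<tau> - 1))"
      unfolding expectation_of_bool using assms sub by (intro prob_all_coins) auto
    also have "\<dots> = (\<Prod>\<tau>\<in>Q \<union> (coin_faces \<sigma> - Q). p (card \<tau> - 1))"
      by (rule arg_cong[of _ _ "prod _"]) auto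
    also have "\<dots> = (\<Prod>\<tau>\<in>Q. p (card \<tau> - 1)) * (\<Prod>\<tau>\<in>coin_faces \<sigma> - Q. p (card \<tau> - 1))"
      using fin by (intro prod.union_disjoint) auto
    finally show "measure_pmf.expectation (coin_pmf n p i) (\<lambda>F. of_bool (\<forall>\<tau>\<in>Q \<union> coin_faces \<sigma>. F \<tau>)) = (\<Prod>\<tau>\<in>Q. p (card \<tau> - 1)) * (\<Prod>\<tau>\<in>coin_faces \<sigma> - Q. p (card \<tau> - 1))" .
  qed
  finally show ?thesis by (simp add: sum_distrib_left)
qed

text \<open>One factor of the power is expanded into its simplices \<sigma>, and the faces of
  \<sigma> join the forced set; hence the induction must be over all \<open>Q\<close>. Each
  expansion adds at most \<open>2 ^ (k + 1)\<close> coins, so the budget \<open>M\<close> keeps the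
  hypothesis on \<open>B\<close> applicable throughout.\<close>

lemma planted_moment_le:
  fixes p :: "nat \<Rightarrow> real"
  assumes p: "\<And>j. 0 \<le> p j" "\<And>j. p j \<le> 1" and k: "k \<le> i"
    and B: "\<And>Q. Q \<subseteq> coins n i \<Longrightarrow> card Q \<le> M \<Longrightarrow>
      (\<Sum>\<sigma> | \<sigma> \<subseteq> {1..n} \<and> card \<sigma> = k + 1. \<Prod>\<tau>\<in>coin_faces \<sigma> - Q. p (card \<tau> - 1)) \<le> B"
    and "Q \<subseteq> coins n i" "card Q + m * 2 ^ (k + 1) \<le> M"
  shows "measure_pmf.expectation (coin_pmf n p i) (\<lambda>F. of_bool (\<forall>\<tau>\<in>Q. F \<tau>) * simplex_count n k F ^ m)
    \<le> B ^ m * (\<Prod>\<tau>\<in>Q. p (card \<tau> - 1))"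
  using assms(5,6)
proof (induction m arbitrary: Q)
  case 0
  then show ?case using prob_all_coins[OF 0(1) p] by (simp add: expectation_of_bool)
next
  case (Suc m)
  let ?S = "{\<sigma>. \<sigma> \<subseteq> {1..n} \<and> card \<sigma> = k + 1}"
  let ?w = "\<lambda>Q. \<Prod>\<tau>\<in>Q. p (card \<tau> - 1)"
  have B0: "0 \<le> B"
    using p by (intro order_trans[OF _ B[of "{}"]] sum_nonneg prod_nonneg) auto
  have "measure_pmf.expectation (coin_pmf n p i) (\<lambda>F. of_bool (\<forall>\<tau>\<in>Q. F \<tau>) * simplex_count n k F ^ Suc m)
    = measure_pmf.expectation (coin_pmf n p i) (\<lambda>F. \<Sum>\<sigma>\<in>?S. of_bool (\<forall>\<tau>\<in>Q \<union> coin_faces \<sigma>. F \<tau>) * simplex_count n k F ^ m)"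
  proof (rule Bochner_Integration.integral_cong[OF refl])
    fix F
    have "of_bool (\<forall>\<tau>\<in>Q. F \<tau>) * simplex_count n k F ^ Suc m
      = (of_bool (\<forall>\<tau>\<in>Q. F \<tau>) * simplex_count n k F) * simplex_count n k F ^ m" by simp
    also have "of_bool (\<forall>\<tau>\<in>Q. F \<tau>) * simplex_count n k F = (\<Sum>\<sigma>\<in>?S. of_bool (\<forall>\<tau>\<in>Q \<union> coin_faces \<sigma>. F \<tau>))"
      unfolding simplex_count_def sum_distrib_left by (simp add: of_bool_conj[symmetric] ball_Un)
    finally show "of_bool (\<forall>\<tau>\<in>Q. F \<tau>) * simplex_count n k F ^ Suc m
      = (\<Sum>\<sigma>\<in>?S. of_bool (\<forall>\<tau>\<in>Q \<union> coin_faces \<sigma>. F \<tau>) * simplex_count n k F ^ m)"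
      by (simp only: sum_distrib_right)
  qed
  also have "\<dots> = (\<Sum>\<sigma>\<in>?S. measure_pmf.expectation (coin_pmf n p i) (\<lambda>F. of_bool (\<forall>\<tau>\<in>Q \<union> coin_faces \<sigma>. F \<tau>) * simplex_count n k F ^ m))"
    by (rule Bochner_Integration.integral_sum[OF integrable_coin_pmf])
  also have "\<dots> \<le> (\<Sum>\<sigma>\<in>?S. B ^ m * ?w Q * ?w (coin_faces \<sigma> - Q))"
  proof (rule sum_mono)
    fix \<sigma> assume s: "\<sigma> \<in> ?S"
    then have sub: "coin_faces \<sigma> \<subseteq> coins n i" using k by (intro coin_faces_subset_coins) auto
    have fin: "finite Q" "finite (coin_faces \<sigma>)"
      using finite_subset[OF Suc.prems(1)] finite_subset[OF sub] by auto
    have "finite \<sigma>" using s finite_subset by blast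
    then have "card (Q \<union> coin_faces \<sigma>) \<le> card Q + 2 ^ (k + 1)"
      using card_coin_faces_le[of \<sigma>] s card_Un_le[of Q "coin_faces \<sigma>"] by simp
    then have "card (Q \<union> coin_faces \<sigma>) + m * 2 ^ (k + 1) \<le> M" using Suc.prems(2) by simp
    with Suc.IH[of "Q \<union> coin_faces \<sigma>"] Suc.prems(1) sub
    have "measure_pmf.expectation (coin_pmf n p i) (\<lambda>F. of_bool (\<forall>\<tau>\<in>Q \<union> coin_faces \<sigma>. F \<tau>) * simplex_count n k F ^ m) \<le> B ^ m * ?w (Q \<union> coin_faces \<sigma>)"
      by blast
    also have "?w (Q \<union> coin_faces \<sigma>) = ?w (Q \<union> (coin_faces \<sigma> - Q))" by (rule arg_cong[of _ _ ?w]) auto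
    also have "\<dots> = ?w Q * ?w (coin_faces \<sigma> - Q)" using fin by (intro prod.union_disjoint) auto
    finally show "measure_pmf.expectation (coin_pmf n p i) (\<lambda>F. of_bool (\<forall>\<tau>\<in>Q \<union> coin_faces \<sigma>. F \<tau>) * simplex_count n k F ^ m)
      \<le> B ^ m * ?w Q * ?w (coin_faces \<sigma> - Q)" by (simp only: mult.assoc)
  qed
  also have "\<dots> = B ^ m * ?w Q * (\<Sum>\<sigma>\<in>?S. ?w (coin_faces \<sigma> - Q))" by (simp only: sum_distrib_left)
  also have "\<dots> \<le> B ^ m * ?w Q * B"
    using Suc.prems B0 p by (intro mult_left_mono B mult_nonneg_nonneg zero_le_power prod_nonneg) auto
  finally show ?case by (simp only: power_Suc mult_ac)
qed

lemma prob_simplex_count_ge_le: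
  fixes p :: "nat \<Rightarrow> real"
  assumes p: "\<And>j. 0 \<le> p j" "\<And>j. p j \<le> 1" and k: "k \<le> i"
    and B: "\<And>Q. Q \<subseteq> coins n i \<Longrightarrow> card Q \<le> m * 2 ^ (k + 1) \<Longrightarrow>
      (\<Sum>\<sigma> | \<sigma> \<subseteq> {1..n} \<and> card \<sigma> = k + 1. \<Prod>\<tau>\<in>coin_faces \<sigma> - Q. p (card \<tau> - 1)) \<le> B"
    and t: "0 < t"
  shows "measure_pmf.prob (coin_pmf n p i) {F. simplex_count n k F \<ge> t} \<le> (B / t) ^ m"
proof -
  have sc0: "0 \<le> simplex_count n k F" for F unfolding simplex_count_def by (rule sum_nonneg) auto
  have "measure_pmf.prob (coin_pmf n p i) {F. simplex_count n k F \<ge> t} * t ^ m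
    = measure_pmf.expectation (coin_pmf n p i) (\<lambda>F. of_bool (simplex_count n k F \<ge> t) * t ^ m)"
    by (simp only: expectation_of_bool[symmetric] integral_mult_left_zero)
  also have "\<dots> \<le> measure_pmf.expectation (coin_pmf n p i) (\<lambda>F. simplex_count n k F ^ m)"
    using t sc0 by (intro integral_mono integrable_coin_pmf) (auto intro: power_mono)
  also have "\<dots> \<le> B ^ m"
    using planted_moment_le[OF p k B, of "m * 2 ^ (k + 1)" "{}" m] by simp
  finally show ?thesis using t by (simp add: power_divide field_simps)
qed

section \<open>Planted blocks\<close>

text \<open>Expanding the power gives a sum over all maps from \<open>r\<close> positions to
  \<open>V\<close>; the injective ones alone contain each set \<open>r!\<close> times.\<close>

lemma elementary_symmetric_le_power:
  fixes w :: "'a \<Rightarrow> real"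
  assumes "finite V" "\<And>v. v \<in> V \<Longrightarrow> 0 \<le> w v"
  shows "(\<Sum>\<sigma> | \<sigma> \<subseteq> V \<and> card \<sigma> = r. \<Prod>v\<in>\<sigma>. w v) \<le> (\<Sum>v\<in>V. w v) ^ r"
proof -
  let ?S = "\<Sum>\<sigma> | \<sigma> \<subseteq> V \<and> card \<sigma> = r. \<Prod>v\<in>\<sigma>. w v"
  have "0 \<le> ?S" using assms(2) by (intro sum_nonneg prod_nonneg) auto
  then have "?S \<le> fact r * ?S" using fact_ge_1[of r, where 'a = real] by (simp add: mult_le_cancel_right1)
  also have "\<dots> = (\<Sum>x\<in>{x \<in> {..<r} \<rightarrow>\<^sub>E V. inj_on x {..<r}}. \<Prod>v\<in>x ` {..<r}. w v)"
    by (rule sum_over_bijections[OF assms(1)]) auto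
  also have "\<dots> = (\<Sum>x\<in>{x \<in> {..<r} \<rightarrow>\<^sub>E V. inj_on x {..<r}}. \<Prod>i<r. w (x i))"
    by (intro sum.cong refl) (auto simp: prod.reindex)
  also have "\<dots> \<le> (\<Sum>x\<in>{..<r} \<rightarrow>\<^sub>E V. \<Prod>i<r. w (x i))"
    using assms by (intro sum_mono2 finite_PiE prod_nonneg) (auto simp: PiE_iff extensional_def)
  also have "\<dots> = (\<Prod>i<r. \<Sum>v\<in>V. w v)"
    using assms(1) by (intro prod_sum_PiE[symmetric]) auto
  finally show ?thesis by simp
qed

definition planted :: "(nat \<Rightarrow> nat set) \<Rightarrow> nat \<Rightarrow> nat \<Rightarrow> nat set set" where
  "planted B M q = {\<tau>. card \<tau> = q + 1 \<and> (\<exists>l<M. \<tau> \<subseteq> B l)}"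

text \<open>By \<open>p1\<close> all faces below dimension \<open>q\<close> are certain, so planting
  the \<open>q\<close>-simplices of a block gives it a complete \<open>q\<close>-skeleton.
  \<open>pq\<close> permits division by the price of one planted face.\<close>

locale planted_blocks =
  fixes B :: "nat \<Rightarrow> nat set" and M s n q k :: nat and p :: "nat \<Rightarrow> real"
  assumes block: "\<And>l. l < M \<Longrightarrow> B l \<subseteq> {1..n}" "\<And>l. l < M \<Longrightarrow> card (B l) = s"
    and disj: "\<And>l l'. l < M \<Longrightarrow> l' < M \<Longrightarrow> l \<noteq> l' \<Longrightarrow> B l \<inter> B l' = {}"
    and q: "1 \<le> q" "q \<le> k"
    and p1: "\<And>i. 1 \<le> i \<Longrightarrow> i < q \<Longrightarrow> p i = 1"
    and p: "\<And>i. 0 \<le> p i" "\<And>i. p i \<le> 1" and pq: "0 < p q"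
begin

abbreviation "Q \<equiv> planted B M q"
text \<open>The conditional probability of \<sigma> given all planted faces.\<close>

abbreviation "W \<sigma> \<equiv> \<Prod>\<tau>\<in>coin_faces \<sigma> - Q. p (card \<tau> - 1)"

lemma finite_block: "l < M \<Longrightarrow> finite (B l)"
  using block(1) finite_subset by blast

lemma planted_eq: "Q = (\<Union>l<M. {\<tau>. \<tau> \<subseteq> B l \<and> card \<tau> = q + 1})"
  by (auto simp: planted_def)

lemma card_planted: "card Q \<le> M * s ^ (q + 1)"
proof -
  have "card Q \<le> (\<Sum>l<M. card {\<tau>. \<tau> \<subseteq> B l \<and> card \<tau> = q + 1})"
    unfolding planted_eq by (rule card_UN_le) simp
  also have "\<dots> = (\<Sum>l<M. s choose (q + 1))"
    using finite_block block by (intro sum.cong refl) (simp add: n_subsets)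
  also have "\<dots> \<le> (\<Sum>l<M. s ^ (q + 1))"
    by (intro sum_mono) (metis binomial_eq_0 binomial_le_pow linorder_not_le zero_le)
  finally show ?thesis by simp
qed

lemma planted_subset_coins: "q \<le> i \<Longrightarrow> Q \<subseteq> coins n i"
  using block q by (force simp: planted_def coins_def)

lemma W_nonneg: "0 \<le> W \<sigma>"
  using p by (intro prod_nonneg) auto

lemma W_inside_block:
  assumes "l < M" "\<sigma> \<subseteq> B l" "card \<sigma> = t + 1"
  shows "W \<sigma> = (\<Prod>i=q+1..t. p i ^ ((t + 1) choose (i + 1)))"
proof -
  have fin: "finite \<sigma>" using assms finite_block finite_subset by blast
  have "W \<sigma> = (\<Prod>\<tau> | \<tau> \<in> coin_faces \<sigma> \<and> q + 1 < card \<tau>. p (card \<tau> - 1))"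
  proof (rule prod.mono_neutral_right)
    show "finite (coin_faces \<sigma> - Q)" using fin by (simp add: finite_coin_faces)
    show "{\<tau> \<in> coin_faces \<sigma>. q + 1 < card \<tau>} \<subseteq> coin_faces \<sigma> - Q" by (auto simp: planted_def)
    show "\<forall>\<tau>\<in>coin_faces \<sigma> - Q - {\<tau> \<in> coin_faces \<sigma>. q + 1 < card \<tau>}. p (card \<tau> - 1) = 1"
    proof
      fix \<tau> assume t: "\<tau> \<in> coin_faces \<sigma> - Q - {\<tau> \<in> coin_faces \<sigma>. q + 1 < card \<tau>}"
      then have "2 \<le> card \<tau>" "card \<tau> \<le> q + 1" "\<tau> \<subseteq> B l" using assms(2) by (auto simp: coin_faces_def)
      moreover from this have "card \<tau> \<noteq> q + 1" using t assms(1) by (auto simp: planted_def)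
      ultimately show "p (card \<tau> - 1) = 1" by (intro p1) auto
    qed
  qed
  also have "\<dots> = (\<Prod>i=q+1..t. p i ^ ((t + 1) choose (i + 1)))"
    by (rule prod_faces_by_dim[OF fin assms(3)]) simp
  finally show ?thesis .
qed

lemma sum_W_ge:
  "M * (s choose (k + 1)) * (\<Prod>i=q+1..k. p i ^ ((k + 1) choose (i + 1)))
    \<le> (\<Sum>\<sigma> | \<sigma> \<subseteq> {1..n} \<and> card \<sigma> = k + 1. W \<sigma>)"
proof -
  let ?P = "\<Prod>i=q+1..k. p i ^ ((k + 1) choose (i + 1))"
  let ?S = "\<lambda>l. {\<sigma>. \<sigma> \<subseteq> B l \<and> card \<sigma> = k + 1}"
  have "M * (s choose (k + 1)) * ?P = (\<Sum>l<M. \<Sum>\<sigma>\<in>?S l. W \<sigma>)"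
  proof -
    have "(\<Sum>\<sigma>\<in>?S l. W \<sigma>) = (s choose (k + 1)) * ?P" if "l < M" for l
    proof -
      have "(\<Sum>\<sigma>\<in>?S l. W \<sigma>) = (\<Sum>\<sigma>\<in>?S l. ?P)"
        using W_inside_block[OF that] by (intro sum.cong refl) auto
      then show ?thesis using n_subsets[OF finite_block[OF that], of "k + 1"] block(2)[OF that] by simp
    qed
    then show ?thesis by simp
  qed
  also have "\<dots> = (\<Sum>\<sigma>\<in>(\<Union>l<M. ?S l). W \<sigma>)"
  proof (rule sum.UNION_disjoint[symmetric])
    show "\<forall>l\<in>{..<M}. finite (?S l)" using finite_block by (auto intro: finite_card_subsets)
    show "\<forall>l\<in>{..<M}. \<forall>l'\<in>{..<M}. l \<noteq> l' \<longrightarrow> ?S l \<inter> ?S l' = {}"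
    proof (intro ballI impI, rule ccontr)
      fix l l' assume l: "l \<in> {..<M}" "l' \<in> {..<M}" "l \<noteq> l'" "?S l \<inter> ?S l' \<noteq> {}"
      then obtain \<sigma> where "\<sigma> \<subseteq> B l" "\<sigma> \<subseteq> B l'" "card \<sigma> = k + 1" by auto
      with disj[of l l'] l have "\<sigma> = {}" by auto
      with \<open>card \<sigma> = k + 1\<close> show False by simp
    qed
  qed simp
  also have "\<dots> \<le> (\<Sum>\<sigma> | \<sigma> \<subseteq> {1..n} \<and> card \<sigma> = k + 1. W \<sigma>)"
    using block(1) W_nonneg by (intro sum_mono2 finite_card_subsets) auto
  finally show ?thesis .
qed

definition "blocks = (\<Union>l<M. B l)"

text \<open>A block meeting \<sigma> in \<open>a + 1\<close> vertices, \<open>a \<le> k\<close>,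
  contributes (a+1 choose q+1) planted faces, and (q+1) (a+1 choose q+1) = (a+1) (a choose q) \<le>
  (a+1) (k choose q). The bound is linear in the number of block vertices, so the gain from planting
  can be charged to single vertices.\<close>

lemma card_planted_faces:
  assumes "finite \<sigma>" "\<And>l. l < M \<Longrightarrow> card (\<sigma> \<inter> B l) \<le> k + 1"
  shows "(q + 1) * card (coin_faces \<sigma> \<inter> Q) \<le> (k choose q) * card (\<sigma> \<inter> blocks)"
proof -
  have "coin_faces \<sigma> \<inter> Q \<subseteq> (\<Union>l<M. {\<tau>. \<tau> \<subseteq> \<sigma> \<inter> B l \<and> card \<tau> = q + 1})"
    by (auto simp: coin_faces_def planted_def)
  then have "card (coin_faces \<sigma> \<inter> Q) \<le> card (\<Union>l<M. {\<tau>. \<tau> \<subseteq> \<sigma> \<inter> B l \<and> card \<tau> = q + 1})"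
    using assms(1) by (intro card_mono finite_UN_I finite_card_subsets) auto
  also have "\<dots> \<le> (\<Sum>l<M. card {\<tau>. \<tau> \<subseteq> \<sigma> \<inter> B l \<and> card \<tau> = q + 1})" by (rule card_UN_le) simp
  also have "\<dots> = (\<Sum>l<M. card (\<sigma> \<inter> B l) choose (q + 1))"
    using assms(1) by (intro sum.cong refl n_subsets) auto
  finally have "(q + 1) * card (coin_faces \<sigma> \<inter> Q) \<le> (q + 1) * (\<Sum>l<M. card (\<sigma> \<inter> B l) choose (q + 1))"
    by (rule mult_left_mono) simp
  also have "\<dots> = (\<Sum>l<M. (q + 1) * (card (\<sigma> \<inter> B l) choose (q + 1)))" by (rule sum_distrib_left)
  also have "\<dots> \<le> (\<Sum>l<M. (k choose q) * card (\<sigma> \<inter> B l))"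
  proof (rule sum_mono)
    fix l assume "l \<in> {..<M}"
    then have le: "card (\<sigma> \<inter> B l) \<le> k + 1" using assms(2) by simp
    show "(q + 1) * (card (\<sigma> \<inter> B l) choose (q + 1)) \<le> (k choose q) * card (\<sigma> \<inter> B l)"
    proof (cases "card (\<sigma> \<inter> B l)")
      case (Suc a)
      have "(q + 1) * (Suc a choose (q + 1)) = Suc a * (a choose q)" using Suc_times_binomial[of q a] by simp
      also have "\<dots> \<le> Suc a * (k choose q)" using le Suc by (intro mult_left_mono binomial_right_mono) auto
      finally show ?thesis unfolding Suc by (simp only: mult.commute)
    qed simp
  qed
  also have "\<dots> = (k choose q) * (\<Sum>l<M. card (\<sigma> \<inter> B l))" by (rule sum_distrib_left[symmetric])
  also have "(\<Sum>l<M. card (\<sigma> \<inter> B l)) = card (\<Union>l<M. \<sigma> \<inter> B l)"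
    using assms(1) disj by (intro card_UN_disjoint[symmetric]) auto
  also have "(\<Union>l<M. \<sigma> \<inter> B l) = \<sigma> \<inter> blocks" by (auto simp: blocks_def)
  finally show ?thesis .
qed

text \<open>The share of the planting gain charged to one vertex of a block, with the exponent from
  \<open>card_planted_faces\<close>.\<close>

definition "vertex_weight v = (if v \<in> blocks then (1 / p q) powr ((k choose q) / (q + 1)) else 1)"

lemma W_le_wt:
  assumes "finite \<sigma>" "card \<sigma> = t + 1" "\<And>l. l < M \<Longrightarrow> card (\<sigma> \<inter> B l) \<le> k + 1"
  shows "W \<sigma> \<le> (\<Prod>i=q..t. p i ^ ((t + 1) choose (i + 1))) * (\<Prod>v\<in>\<sigma>. vertex_weight v)"
proof -
  let ?P = "\<Prod>i=q..t. p i ^ ((t + 1) choose (i + 1))"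
  have finc: "finite (coin_faces \<sigma>)" using assms(1) by (rule finite_coin_faces)
  have inv: "1 \<le> 1 / p q" using p(2)[of q] pq by simp
  have "W \<sigma> = (\<Prod>\<tau>\<in>coin_faces \<sigma>. if \<tau> \<in> Q then 1 else p (card \<tau> - 1))"
    using finc by (simp add: prod.If_cases Diff_eq)
  also have "\<dots> = (\<Prod>\<tau>\<in>coin_faces \<sigma>. p (card \<tau> - 1) * (if \<tau> \<in> Q then 1 / p q else 1))"
    using pq by (intro prod.cong refl) (auto simp: planted_def)
  also have "\<dots> = (\<Prod>\<tau>\<in>coin_faces \<sigma>. p (card \<tau> - 1)) * (1 / p q) ^ card (coin_faces \<sigma> \<inter> Q)"
    using finc by (simp add: prod.distrib prod.If_cases)
  also have "(\<Prod>\<tau>\<in>coin_faces \<sigma>. p (card \<tau> - 1)) = (\<Prod>\<tau> | \<tau> \<in> coin_faces \<sigma> \<and> q < card \<tau>. p (card \<tau> - 1))"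
  proof (rule prod.mono_neutral_right[OF finc])
    show "\<forall>\<tau>\<in>coin_faces \<sigma> - {\<tau> \<in> coin_faces \<sigma>. q < card \<tau>}. p (card \<tau> - 1) = 1"
    proof
      fix \<tau> assume t: "\<tau> \<in> coin_faces \<sigma> - {\<tau> \<in> coin_faces \<sigma>. q < card \<tau>}"
      then have "2 \<le> card \<tau>" "card \<tau> \<le> q" by (auto simp: coin_faces_def)
      then show "p (card \<tau> - 1) = 1" by (intro p1) auto
    qed
  qed auto
  also have "\<dots> = ?P" by (rule prod_faces_by_dim[OF assms(1,2) q(1)])
  also have "(1 / p q) ^ card (coin_faces \<sigma> \<inter> Q) \<le> (\<Prod>v\<in>\<sigma>. vertex_weight v)"
  proof -
    have "real ((q + 1) * card (coin_faces \<sigma> \<inter> Q)) \<le> real ((k choose q) * card (\<sigma> \<inter> blocks))"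
      using card_planted_faces[OF assms(1,3)] by (rule of_nat_mono)
    then have le: "real (card (coin_faces \<sigma> \<inter> Q)) \<le> (k choose q) / (q + 1) * card (\<sigma> \<inter> blocks)"
      by (simp add: field_simps)
    have "(1 / p q) ^ card (coin_faces \<sigma> \<inter> Q) = (1 / p q) powr card (coin_faces \<sigma> \<inter> Q)"
      using pq by (simp add: powr_realpow)
    also have "\<dots> \<le> (1 / p q) powr ((k choose q) / (q + 1) * card (\<sigma> \<inter> blocks))"
      using le inv by (rule powr_mono)
    also have "\<dots> = ((1 / p q) powr ((k choose q) / (q + 1))) ^ card (\<sigma> \<inter> blocks)"
      using pq by (simp add: powr_power mult.commute)
    also have "\<dots> = (\<Prod>v\<in>\<sigma>. vertex_weight v)"
      unfolding vertex_weight_def using assms(1) by (simp add: prod.If_cases)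
    finally show ?thesis .
  qed
  then have "?P * (1 / p q) ^ card (coin_faces \<sigma> \<inter> Q) \<le> ?P * (\<Prod>v\<in>\<sigma>. vertex_weight v)"
    using p by (intro mult_left_mono prod_nonneg) auto
  finally show ?thesis .
qed

text \<open>The vertex weights turn the sum into an elementary symmetric polynomial. They are valid
  only when no block contains \<open>k + 2\<close> vertices of \<sigma>; for
  \<open>t \<le> k + 1\<close> the exceptions are the simplices of dimension \<open>k + 1\<close>
  inside a block, which are counted directly.\<close>

lemma sum_W_le:
  assumes "t \<le> k + 1"
  shows "(\<Sum>\<sigma> | \<sigma> \<subseteq> {1..n} \<and> card \<sigma> = t + 1. W \<sigma>)
    \<le> (\<Prod>i=q..t. p i ^ ((t + 1) choose (i + 1))) * (n + M * s * (1 / p q) powr ((k choose q) / (q + 1))) ^ (t + 1)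
      + (if t = k + 1 then M * s ^ (t + 1) * (\<Prod>i=q+1..t. p i ^ ((t + 1) choose (i + 1))) else 0)"
proof -
  let ?P = "\<Prod>i=q..t. p i ^ ((t + 1) choose (i + 1))"
  let ?P' = "\<Prod>i=q+1..t. p i ^ ((t + 1) choose (i + 1))"
  define b where "b = (1 / p q) powr ((k choose q) / (q + 1))"
  define T where "T = {\<sigma>. \<sigma> \<subseteq> {1..n} \<and> card \<sigma> = t + 1}"
  \<comment> \<open>The exceptional simplices: \<open>k + 2\<close> vertices in one block force
    \<open>t = k + 1\<close> and leave no vertex outside.\<close>
  define D where "D = (if t = k + 1 then \<Union>l<M. {\<sigma>. \<sigma> \<subseteq> B l \<and> card \<sigma> = t + 1} else {})"
  have finT: "finite T" unfolding T_def by (rule finite_card_subsets) simp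
  have DT: "D \<subseteq> T"
  proof
    fix \<sigma> assume "\<sigma> \<in> D"
    then obtain l where "l < M" "\<sigma> \<subseteq> B l" "card \<sigma> = t + 1" by (auto simp: D_def split: if_splits)
    with block(1)[of l] show "\<sigma> \<in> T" by (auto simp: T_def)
  qed
  have P0: "0 \<le> ?P" "0 \<le> ?P'" using p by (auto intro!: prod_nonneg)
  have wt0: "0 \<le> vertex_weight v" for v by (simp add: vertex_weight_def)
  have "(\<Sum>\<sigma>\<in>T. W \<sigma>) = (\<Sum>\<sigma>\<in>T - D. W \<sigma>) + (\<Sum>\<sigma>\<in>D. W \<sigma>)" by (rule sum.subset_diff[OF DT finT])
  also have "(\<Sum>\<sigma>\<in>D. W \<sigma>) \<le> (if t = k + 1 then M * s ^ (t + 1) * ?P' else 0)"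
  proof (cases "t = k + 1")
    case True
    have "(\<Sum>\<sigma>\<in>D. W \<sigma>) = (\<Sum>\<sigma>\<in>D. ?P')"
    proof (rule sum.cong[OF refl])
      fix \<sigma> assume "\<sigma> \<in> D"
      then obtain l where "l < M" "\<sigma> \<subseteq> B l" "card \<sigma> = t + 1" by (auto simp: D_def split: if_splits)
      then show "W \<sigma> = ?P'" by (rule W_inside_block)
    qed
    also have "\<dots> = card D * ?P'" by simp
    also have "\<dots> \<le> real (M * s ^ (t + 1)) * ?P'"
    proof (intro mult_right_mono P0 of_nat_mono)
      have "card D \<le> (\<Sum>l<M. card {\<sigma>. \<sigma> \<subseteq> B l \<and> card \<sigma> = t + 1})"
        unfolding D_def using True card_UN_le[of "{..<M}" "\<lambda>l. {\<sigma>. \<sigma> \<subseteq> B l \<and> card \<sigma> = t + 1}"] by simp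
      also have "\<dots> = (\<Sum>l<M. s choose (t + 1))"
        using finite_block block by (intro sum.cong refl) (simp add: n_subsets)
      also have "\<dots> \<le> (\<Sum>l<M. s ^ (t + 1))"
        by (intro sum_mono) (metis binomial_eq_0 binomial_le_pow linorder_not_le zero_le)
      finally show "card D \<le> M * s ^ (t + 1)" by simp
    qed
    finally show ?thesis using True by simp
  qed (simp add: D_def)
  also have "(\<Sum>\<sigma>\<in>T - D. W \<sigma>) \<le> (\<Sum>\<sigma>\<in>T - D. ?P * (\<Prod>v\<in>\<sigma>. vertex_weight v))"
  proof (rule sum_mono)
    fix \<sigma> assume s: "\<sigma> \<in> T - D"
    then have fin: "finite \<sigma>" and card: "card \<sigma> = t + 1" by (auto simp: T_def intro: finite_subset)
    show "W \<sigma> \<le> ?P * (\<Prod>v\<in>\<sigma>. vertex_weight v)"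
    proof (rule W_le_wt[OF fin card])
      fix l assume l: "l < M"
      show "card (\<sigma> \<inter> B l) \<le> k + 1"
      proof (rule ccontr)
        assume neg: "\<not> card (\<sigma> \<inter> B l) \<le> k + 1"
        have "card (\<sigma> \<inter> B l) \<le> card \<sigma>" using fin by (intro card_mono) auto
        then have "t = k + 1" "card (\<sigma> \<inter> B l) = card \<sigma>" using neg card assms by auto
        moreover from this have "\<sigma> \<inter> B l = \<sigma>" using fin by (intro card_subset_eq) auto
        ultimately show False using s l card by (auto simp: D_def)
      qed
    qed
  qed
  also have "\<dots> \<le> (\<Sum>\<sigma>\<in>T. ?P * (\<Prod>v\<in>\<sigma>. vertex_weight v))"
  proof (rule sum_mono2[OF finT])
    show "0 \<le> ?P * (\<Prod>v\<in>\<sigma>. vertex_weight v)" for \<sigma>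
      by (rule mult_nonneg_nonneg[OF P0(1) prod_nonneg]) (rule wt0)
  qed auto
  also have "\<dots> = ?P * (\<Sum>\<sigma>\<in>T. \<Prod>v\<in>\<sigma>. vertex_weight v)" by (rule sum_distrib_left[symmetric])
  also have "\<dots> \<le> ?P * (\<Sum>v\<in>{1..n}. vertex_weight v) ^ (t + 1)"
    unfolding T_def using wt0 P0 by (intro mult_left_mono elementary_symmetric_le_power) auto
  also have "\<dots> \<le> ?P * (n + M * s * b) ^ (t + 1)"
  proof (intro mult_left_mono power_mono P0)
    have U: "blocks \<subseteq> {1..n}" using block(1) by (auto simp: blocks_def)
    have "card blocks \<le> M * s"
      unfolding blocks_def using card_UN_le[of "{..<M}" B] block(2) by simp
    then have cU: "real (card blocks) \<le> real (M * s)" by (rule of_nat_mono)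
    have "vertex_weight v = (if v \<in> blocks then b else 1)" for v by (simp only: vertex_weight_def b_def)
    then have "(\<Sum>v\<in>{1..n}. vertex_weight v) = card blocks * b + card ({1..n} \<inter> - blocks)"
      using U by (simp add: sum.If_cases Int_absorb1)
    also have "\<dots> \<le> real (M * s) * b + n"
      using cU card_mono[of "{1..n}" "{1..n} \<inter> - blocks"] by (intro add_mono mult_right_mono) (auto simp: b_def)
    finally show "(\<Sum>v\<in>{1..n}. vertex_weight v) \<le> n + M * s * b" by simp
    show "0 \<le> (\<Sum>v\<in>{1..n}. vertex_weight v)" using wt0 by (intro sum_nonneg) auto
  qed
  finally show ?thesis unfolding T_def b_def by linarith
qed

end

lemma intervals_planted_blocks:
  assumes "M * s \<le> n" "1 \<le> q" "q \<le> k" "\<And>i. 1 \<le> i \<Longrightarrow> i < q \<Longrightarrow> p i = 1"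
    "\<And>i. 0 \<le> p i" "\<And>i. p i \<le> 1" "0 < p q"
  shows "planted_blocks (\<lambda>l. {l * s + 1..l * s + s}) M s n q k p"
proof
  fix l assume l: "l < M"
  have "l * s + s = Suc l * s" by simp
  also have "\<dots> \<le> M * s" using l by (intro mult_right_mono) auto
  finally show "{l * s + 1..l * s + s} \<subseteq> {1..n}" using assms(1) by auto
  fix l' assume "l' < M" "l \<noteq> l'"
  show "{l * s + 1..l * s + s} \<inter> {l' * s + 1..l' * s + s} = {}"
  proof (rule ccontr)
    assume "\<not> ?thesis"
    then obtain v where "v \<in> {l * s + 1..l * s + s} \<inter> {l' * s + 1..l' * s + s}" by blast
    then have v: "l * s + 1 \<le> v" "v \<le> l * s + s" "l' * s + 1 \<le> v" "v \<le> l' * s + s"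
      by (simp_all only: Int_iff atLeastAtMost_iff)
    have "s * Suc a \<le> s * b" if "a < b" for a b :: nat using that by (intro mult_left_mono) auto
    from this[of l l'] this[of l' l] v \<open>l \<noteq> l'\<close> show False
      by (cases "l < l'") (auto simp: mult.commute)
  qed
qed (use assms in auto)

context planted_blocks
begin

lemma prob_planted_ge:
  assumes i: "k + 1 \<le> i" and n: "1 \<le> n" and \<theta>: "0 \<le> \<theta>"
    and gap: "2 * \<theta> \<le> (\<Sum>\<sigma> | \<sigma> \<subseteq> {1..n} \<and> card \<sigma> = k + 1. W \<sigma>)
      - (\<Sum>\<sigma> | \<sigma> \<subseteq> {1..n} \<and> card \<sigma> = k - 1 + 1. W \<sigma>)
      - (\<Sum>\<sigma> | \<sigma> \<subseteq> {1..n} \<and> card \<sigma> = k + 1 + 1. W \<sigma>)"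
  shows "\<theta> * p q ^ card Q \<le> n ^ (k + 1) *
    measure_pmf.prob (coin_pmf n p i) {F. \<theta> \<le> simplex_count n k F - simplex_count n (k - 1) F - simplex_count n (k + 1) F}"
proof -
  let ?E = "measure_pmf.expectation (coin_pmf n p i)"
  define g where "g F = simplex_count n k F - simplex_count n (k - 1) F - simplex_count n (k + 1) F" for F
  define IQ where "IQ F = (of_bool (\<forall>\<tau>\<in>Q. F \<tau>) :: real)" for F
  define w where "w = (\<Prod>\<tau>\<in>Q. p (card \<tau> - 1))"
  have Qc: "Q \<subseteq> coins n i" using q i by (intro planted_subset_coins) auto
  have w: "w = p q ^ card Q"
    unfolding w_def by (subst prod_constant[symmetric]) (auto simp: planted_def intro!: prod.cong)
  have w0: "0 \<le> w" using w p by simp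
  have Ew: "?E IQ = w"
    unfolding IQ_def w_def expectation_of_bool by (rule prob_all_coins[OF Qc p])
  note ex = expectation_planted_simplex_count[OF p Qc, folded IQ_def w_def]
  have "?E (\<lambda>F. IQ F * g F) = ?E (\<lambda>F. IQ F * simplex_count n k F - IQ F * simplex_count n (k - 1) F - IQ F * simplex_count n (k + 1) F)"
    by (simp add: g_def algebra_simps)
  also have "\<dots> = ?E (\<lambda>F. IQ F * simplex_count n k F) - ?E (\<lambda>F. IQ F * simplex_count n (k - 1) F) - ?E (\<lambda>F. IQ F * simplex_count n (k + 1) F)"
    by (simp add: Bochner_Integration.integral_diff integrable_coin_pmf)
  also have "\<dots> = w * ((\<Sum>\<sigma> | \<sigma> \<subseteq> {1..n} \<and> card \<sigma> = k + 1. W \<sigma>)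
      - (\<Sum>\<sigma> | \<sigma> \<subseteq> {1..n} \<and> card \<sigma> = k - 1 + 1. W \<sigma>)
      - (\<Sum>\<sigma> | \<sigma> \<subseteq> {1..n} \<and> card \<sigma> = k + 1 + 1. W \<sigma>))"
    using i by (simp only: ex[of k] ex[of "k - 1"] ex[of "k + 1"] right_diff_distrib w_def)
  also have "\<dots> \<ge> w * (2 * \<theta>)" using gap w0 by (rule mult_left_mono)
  finally have lower: "2 * \<theta> * w \<le> ?E (\<lambda>F. IQ F * g F)" by (simp only: mult_ac)
  have sc0: "0 \<le> simplex_count n j F" for j F unfolding simplex_count_def by (rule sum_nonneg) auto
  have gle: "g F \<le> n ^ (k + 1)" for F
  proof -
    have "simplex_count n k F \<le> (\<Sum>\<sigma> | \<sigma> \<subseteq> {1..n} \<and> card \<sigma> = k + 1. 1)"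
      unfolding simplex_count_def by (intro sum_mono) auto
    also have "\<dots> = real (n choose (k + 1))" using n_subsets[of "{1..n}" "k + 1"] by simp
    also have "\<dots> \<le> real (n ^ (k + 1))"
      by (intro of_nat_mono) (metis binomial_eq_0 binomial_le_pow linorder_not_le zero_le)
    finally show ?thesis using sc0[of "k - 1" F] sc0[of "k + 1" F] by (simp add: g_def)
  qed
  \<comment> \<open>Where \<open>g\<close> is below the target \<theta> it contributes at most
    \<theta>, elsewhere at most \<open>n ^ (k + 1)\<close>. A conditional mean of at least twice the
    target therefore leaves a net \<theta> for the event.\<close>
  have "?E (\<lambda>F. IQ F * g F) \<le> ?E (\<lambda>F. n ^ (k + 1) * of_bool (\<theta> \<le> g F) + \<theta> * IQ F)"
  proof (intro integral_mono integrable_coin_pmf)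
    fix F
    have "(0::real) \<le> n ^ (k + 1)" by simp
    then show "IQ F * g F \<le> n ^ (k + 1) * of_bool (\<theta> \<le> g F) + \<theta> * IQ F"
      using gle[of F] \<theta> by (auto simp: IQ_def)
  qed
  also have "\<dots> = n ^ (k + 1) * ?E (\<lambda>F. of_bool (\<theta> \<le> g F)) + \<theta> * ?E IQ"
    by (simp add: Bochner_Integration.integral_add integrable_coin_pmf)
  finally have "\<theta> * w \<le> n ^ (k + 1) * measure_pmf.prob (coin_pmf n p i) {F. \<theta> \<le> g F}"
    using lower by (simp add: Ew expectation_of_bool)
  then show ?thesis by (simp only: w g_def)
qed

end

section \<open>Asymptotics\<close>

lemma eventually_powr_ge:
  fixes e X :: real
  assumes "0 < e"
  shows "\<forall>\<^sub>F n in sequentially. X \<le> real n powr e"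
proof (cases "0 < X")
  case True
  have "\<forall>\<^sub>F n in sequentially. nat \<lceil>X powr (1 / e)\<rceil> \<le> n" by (rule eventually_ge_at_top)
  then show ?thesis
  proof eventually_elim
    case (elim n)
    then have "X powr (1 / e) \<le> real n" by linarith
    then have "(X powr (1 / e)) powr e \<le> real n powr e" using assms by (intro powr_mono2) auto
    then show ?case using True assms by (simp add: powr_powr)
  qed
next
  case False
  then show ?thesis by (intro always_eventually allI) (meson linorder_not_less order_trans powr_ge_zero)
qed

lemma eventually_powr_le:
  fixes e y :: real
  assumes "e < 0" "0 < y"
  shows "\<forall>\<^sub>F n in sequentially. real n powr e \<le> y"
proof -
  have "\<forall>\<^sub>F n in sequentially. 1 / y \<le> real n powr (- e)" using assms by (intro eventually_powr_ge) auto
  then show ?thesis using eventually_gt_at_top[of 0]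
  proof eventually_elim
    case (elim n)
    then show ?case using assms by (simp add: powr_minus divide_simps mult.commute)
  qed
qed

lemma prod_powr_power:
  fixes x :: real
  assumes "0 < x" "finite S"
  shows "(\<Prod>i\<in>S. (x powr - a i) ^ c i) = x powr (- (\<Sum>i\<in>S. real (c i) * a i))"
  using assms(2)
proof (induction S rule: finite_induct)
  case (insert i S)
  have "(x powr - a i) ^ c i = x powr (- (real (c i) * a i))"
    using assms(1) by (simp add: powr_power mult.commute)
  then show ?case using insert by (simp add: powr_add[symmetric])
qed (use assms(1) in simp)

text \<open>This identity converts the exponent charged per vertex, times \<open>k + 1\<close>
  vertices, into the number of \<open>q\<close>-faces of a \<open>k\<close>-simplex, which is what
  matches the block size to the order of the expected face count.\<close>

lemma binomial_absorb_real: "(real q + 1) * real ((k + 1) choose (q + 1)) = (real k + 1) * real (k choose q)"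
proof -
  have "real (Suc q * (Suc k choose Suc q)) = real (Suc k * (k choose q))" by (simp only: Suc_times_binomial)
  then show ?thesis by (simp only: of_nat_mult of_nat_Suc Suc_eq_plus1 of_nat_add of_nat_1 add.commute)
qed

declare binomial_Suc_Suc [simp del] fact_Suc [simp del]

text \<open>
  Here \<open>n powr (- a i)\<close> is the paper's \<open>p\<^sub>i\<close>. The flag \<open>fin\<close> says that \<open>\<alpha>\<^sub>k\<^sub>+\<^sub>1\<close> is finite; the value
  \<open>a (k + 1)\<close> is meaningless otherwise.
\<close>

locale exponents =
  fixes a :: "nat \<Rightarrow> real" and q k :: nat and fin :: bool and p :: "nat \<Rightarrow> nat \<Rightarrow> real"
  assumes q: "1 \<le> q" "q \<le> k"
    and aq: "0 < a q" and a0: "\<And>i. 1 \<le> i \<Longrightarrow> i < q \<Longrightarrow> a i = 0"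
    and p_eq: "\<And>n i. 1 \<le> n \<Longrightarrow> 1 \<le> i \<Longrightarrow> i \<le> k \<Longrightarrow> p n i = real n powr - a i"
    and p_range: "\<And>n i. 1 \<le> n \<Longrightarrow> 0 \<le> p n i" "\<And>n i. 1 \<le> n \<Longrightarrow> p n i \<le> 1"
    and p_top: "\<And>n. 1 \<le> n \<Longrightarrow> p n (k + 1) = (if fin then real n powr - a (k + 1) else 0)"
    and sub: "(\<Sum>i=q..k. real (k choose i) * a i) < 1"
    and super: "fin \<Longrightarrow> 1 < (\<Sum>i=q..k+1. real ((k + 1) choose i) * a i)"
    and mid: "\<And>j. q + 1 \<le> j \<Longrightarrow> j \<le> k \<Longrightarrow>
      real (k choose (q + 1)) * a q + (\<Sum>i=q+1..j. real ((k + 1) choose (i + 1)) * a i) < real j - real q"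
    and low: "fin \<Longrightarrow> 1 \<le> real (k choose q) / (real q + 1) * a q + (\<Sum>i=q+1..k+1. real ((k + 1) choose i) * a i)"
    and a_nonneg: "\<And>i. 1 \<le> i \<Longrightarrow> 0 \<le> a i"
begin

definition "rate n = real n powr (real q + 1 - real (k choose q) * a q)"
definition "\<tau> = real k + 1 - (\<Sum>i=q..k. real ((k + 1) choose (i + 1)) * a i)"

lemma p1: "1 \<le> n \<Longrightarrow> 1 \<le> i \<Longrightarrow> i < q \<Longrightarrow> p n i = 1"
  using p_eq[of n i] a0 q by simp

text \<open>A single term of the nonnegative sum in \<open>sub\<close>. Hence the exponent of
  \<open>rate\<close> exceeds \<open>q\<close>, and \<open>rate\<close> tends to infinity.\<close>

lemma rate_exponent_pos: "real (k choose q) * a q < 1"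
proof -
  have "real (k choose q) * a q \<le> (\<Sum>i=q..k. real (k choose i) * a i)"
    using q a_nonneg by (intro member_le_sum) auto
  then show ?thesis using sub by simp
qed

lemma prod_p:
  assumes "1 \<le> n" "S \<subseteq> {1..k}"
  shows "(\<Prod>i\<in>S. p n i ^ c i) = real n powr (- (\<Sum>i\<in>S. real (c i) * a i))"
proof -
  have "(\<Prod>i\<in>S. p n i ^ c i) = (\<Prod>i\<in>S. (real n powr - a i) ^ c i)"
    using assms p_eq by (intro prod.cong) auto
  then show ?thesis
    using prod_powr_power[of "real n" S a c] assms finite_subset[OF assms(2)] by simp
qed

text \<open>Half of \<epsilon> is spent on forced \<open>q\<close>-faces, by a small constant
  \<open>c\<close> in the Finner term, and half on forced faces of higher dimension, whose relative
  contribution is a negative power of \<open>n\<close> by \<open>mid\<close>.\<close>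

lemma extension_bound:
  assumes \<epsilon>: "0 < \<epsilon>"
  obtains c where "0 < c" "\<forall>\<^sub>F n in sequentially. \<forall>Q. finite Q \<longrightarrow> real (card Q) \<le> c * rate n \<longrightarrow>
     (\<Sum>\<sigma> | \<sigma> \<subseteq> {1..n} \<and> card \<sigma> = k + 1. \<Prod>\<tau>\<in>coin_faces \<sigma> - Q. p n (card \<tau> - 1))
       \<le> (1 + \<epsilon>) * (real n powr \<tau> / fact (k + 1))"
proof -
  define e where "e = real ((k + 1) choose (q + 1)) / real (k choose q)"
  define Z where "Z = real ((q + 1) ^ (q + 1))"
  have Z: "0 < Z" unfolding Z_def by (simp only: of_nat_0_less_iff zero_less_power add_gr_0 zero_less_one simp_thms)
  \<comment> \<open>The solution of \<open>(1 + Z * c) powr e = 1 + \<epsilon> / 2\<close>, where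
    \<open>Z\<close> and \<open>e\<close> are the constant and the exponent of the clique
    bound.\<close>
  define c where "c = ((1 + \<epsilon> / 2) powr (1 / e) - 1) / Z"
  have e: "0 < e" unfolding e_def using q by (intro divide_pos_pos) (simp_all del: binomial_Suc_Suc add: zero_less_binomial)
  have "1 < (1 + \<epsilon> / 2) powr (1 / e)" using \<epsilon> e by (intro gr_one_powr) auto
  then have c: "0 < c" unfolding c_def using Z by (intro divide_pos_pos) auto
  have ce: "(1 + Z * c) powr e = 1 + \<epsilon> / 2"
    using \<epsilon> e Z by (simp add: c_def powr_powr)
  \<comment> \<open>Up to constants, \<open>n powr \<delta> j\<close> is the contribution of forced
    \<open>j\<close>-faces relative to \<open>n powr \<tau>\<close>. The coefficient
    \<open>k choose (q + 1)\<close> is what remains of \<open>(k + 1) choose (q + 1)\<close> after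
    the rate has taken \<open>k choose q\<close>.\<close>
  define \<delta> where "\<delta> j = real q - real j + real (k choose (q + 1)) * a q + (\<Sum>i=q+1..j. real ((k + 1) choose (i + 1)) * a i)" for j
  have "\<delta> j < 0" if "j \<in> {q+1..k}" for j
    using mid[of j] that by (simp add: \<delta>_def)
  \<comment> \<open>The factor \<open>k + 1\<close> in the threshold covers the at most
    \<open>k + 1\<close> values of \<open>j\<close>, and \<open>c\<close> the number of forced
    faces.\<close>
  then have "\<forall>j\<in>{q+1..k}. \<forall>\<^sub>F n in sequentially. real n powr \<delta> j \<le> \<epsilon> / (2 * fact (k + 1) * c * real (k + 1))"
    using \<epsilon> c by (intro ballI eventually_powr_le) auto
  then have "\<forall>\<^sub>F n in sequentially. \<forall>j\<in>{q+1..k}. real n powr \<delta> j \<le> \<epsilon> / (2 * fact (k + 1) * c * real (k + 1))"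
    by (intro eventually_ball_finite) auto
  then have ev: "\<forall>\<^sub>F n in sequentially. \<forall>Q. finite Q \<longrightarrow> real (card Q) \<le> c * rate n \<longrightarrow>
     (\<Sum>\<sigma> | \<sigma> \<subseteq> {1..n} \<and> card \<sigma> = k + 1. \<Prod>\<tau>\<in>coin_faces \<sigma> - Q. p n (card \<tau> - 1))
       \<le> (1 + \<epsilon>) * (real n powr \<tau> / fact (k + 1))"
    using eventually_gt_at_top[of 0]
  proof eventually_elim
    case (elim n)
    have n: "1 \<le> n" "0 < real n" using elim by auto
    show ?case
    proof (intro allI impI)
      fix Q :: "nat set set" assume Q: "finite Q" "real (card Q) \<le> c * rate n"
      let ?P = "\<lambda>j. \<Prod>i=q..j. p n i ^ ((k + 1) choose (i + 1))"
      let ?A = "\<lambda>j. \<Sum>i=q..j. real ((k + 1) choose (i + 1)) * a i"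
      have P: "?P j = real n powr (- ?A j)" if "j \<le> k" for j
        using n q that by (intro prod_p) auto
      have npow: "real n ^ j = real n powr real j" for j using n by (simp add: powr_realpow)
      have pos: "0 < p n i" if "1 \<le> i" "i \<le> k" for i using p_eq[OF n(1) that] n by simp
      have first: "(1 + (q + 1) ^ (q + 1) * card Q * (1 / p n q) ^ (k choose q) / real n ^ (q + 1)) powr e \<le> 1 + \<epsilon> / 2"
      proof -
        let ?Y = "(1 / p n q) ^ (k choose q) / real n ^ (q + 1)"
        \<comment> \<open>The origin of the rate: it is the number of forced faces that makes the
          correction in the Finner bound a constant.\<close>
        have "rate n * (1 / p n q) ^ (k choose q) / real n ^ (q + 1) = 1"
        proof -
          have "(1 / p n q) ^ (k choose q) = real n powr (real (k choose q) * a q)"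
            using q n p_eq[of n q] by (simp add: powr_minus powr_power mult.commute divide_inverse)
          then have "rate n * (1 / p n q) ^ (k choose q) / real n ^ (q + 1)
            = real n powr (real q + 1 - real (k choose q) * a q + real (k choose q) * a q - real (q + 1))"
            unfolding rate_def npow powr_add powr_diff[of _ "real q + 1 - real (k choose q) * a q + real (k choose q) * a q"] by simp
          also have "real q + 1 - real (k choose q) * a q + real (k choose q) * a q - real (q + 1) = 0" by simp
          also have "real n powr 0 = 1" using n by simp
          finally show ?thesis .
        qed
        then have one: "rate n * ?Y = 1" by (simp only: times_divide_eq_right)
        have "real (card Q) * ?Y \<le> c * rate n * ?Y"
          using Q pos[of q] q by (intro mult_right_mono) auto
        also have "c * rate n * ?Y = c" by (simp only: mult.assoc one mult_1_right)
        finally have "real (card Q) * ?Y \<le> c" .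
        then have "Z * (real (card Q) * ((1 / p n q) ^ (k choose q) / real n ^ (q + 1))) \<le> Z * c"
          using Z by (intro mult_left_mono) auto
        moreover have "(q + 1) ^ (q + 1) * card Q * (1 / p n q) ^ (k choose q) / real n ^ (q + 1)
          = Z * (real (card Q) * ((1 / p n q) ^ (k choose q) / real n ^ (q + 1)))"
          unfolding Z_def of_nat_mult by (simp only: times_divide_eq_right mult.assoc)
        ultimately have "1 + (q + 1) ^ (q + 1) * card Q * (1 / p n q) ^ (k choose q) / real n ^ (q + 1) \<le> 1 + Z * c"
          by linarith
        moreover have "0 \<le> (q + 1) ^ (q + 1) * card Q * (1 / p n q) ^ (k choose q) / real n ^ (q + 1)"
          using pos[of q] q by (intro divide_nonneg_nonneg mult_nonneg_nonneg zero_le_power of_nat_0_le_iff) auto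
        ultimately have "(1 + (q + 1) ^ (q + 1) * card Q * (1 / p n q) ^ (k choose q) / real n ^ (q + 1)) powr e \<le> (1 + Z * c) powr e"
          using e by (intro powr_mono2) auto
        then show ?thesis using ce by simp
      qed
      have top: "?P k * real n ^ (k + 1) = real n powr \<tau>"
        using n P[of k] npow[of "k + 1"] by (simp add: \<tau>_def powr_add[symmetric] add.commute)
      have second: "?P k * (\<Sum>j=q+1..k. card Q * n ^ (k - j) / ?P j) \<le> \<epsilon> / 2 * (real n powr \<tau> / fact (k + 1))"
      proof -
        have regroup: "g * (t * (e / (2 * f * g))) = e / 2 * (t / f)" if "0 < f" "0 < g" for e f g t :: real
          using that by (simp add: field_simps)
        have "?P k * (\<Sum>j=q+1..k. card Q * n ^ (k - j) / ?P j) = (\<Sum>j=q+1..k. ?P k * (card Q * n ^ (k - j) / ?P j))"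
          by (rule sum_distrib_left)
        also have "\<dots> \<le> (\<Sum>j=q+1..k. real n powr \<tau> * (\<epsilon> / (2 * fact (k + 1) * real (k + 1))))"
        proof (rule sum_mono)
          fix j assume j: "j \<in> {q+1..k}"
          have cancel: "c * (x / (2 * f * c * g)) = x / (2 * f * g)" for x f g :: real using c by simp
          have "?A j = real ((k + 1) choose (q + 1)) * a q + (\<Sum>i=q+1..j. real ((k + 1) choose (i + 1)) * a i)"
            using j by (subst sum.atLeast_Suc_atMost) auto
          then have ex: "\<tau> + \<delta> j = - ?A k + (real q + 1 - real (k choose q) * a q) + (real k - real j) + ?A j"
            by (simp add: \<tau>_def \<delta>_def algebra_simps binomial_Suc_Suc[of k q])
          have "?P k * (card Q * n ^ (k - j) / ?P j) = real (card Q) * (real n powr (- ?A k) * real n powr (real k - real j) * real n powr (?A j))"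
            using P[of k] P[of j] j npow[of "k - j"] by (simp add: powr_minus divide_inverse of_nat_diff)
          also have "\<dots> \<le> (c * rate n) * (real n powr (- ?A k) * real n powr (real k - real j) * real n powr (?A j))"
            using Q by (intro mult_right_mono) auto
          also have "\<dots> = c * real n powr (\<tau> + \<delta> j)"
            unfolding ex rate_def by (simp only: powr_add mult_ac)
          also have "\<dots> = real n powr \<tau> * (c * real n powr \<delta> j)" by (simp add: powr_add)
          also have "\<dots> \<le> real n powr \<tau> * (c * (\<epsilon> / (2 * fact (k + 1) * c * real (k + 1))))"
            using elim j c by (intro mult_left_mono) auto
          also have "c * (\<epsilon> / (2 * fact (k + 1) * c * real (k + 1))) = \<epsilon> / (2 * fact (k + 1) * real (k + 1))"
            by (rule cancel)
          finally show "?P k * (card Q * n ^ (k - j) / ?P j) \<le> real n powr \<tau> * (\<epsilon> / (2 * fact (k + 1) * real (k + 1)))" .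
        qed
        also have "\<dots> = real (k - q) * (real n powr \<tau> * (\<epsilon> / (2 * fact (k + 1) * real (k + 1))))" by simp
        also have "\<dots> \<le> real (k + 1) * (real n powr \<tau> * (\<epsilon> / (2 * fact (k + 1) * real (k + 1))))"
          using \<epsilon> by (intro mult_right_mono) auto
        also have "\<dots> = \<epsilon> / 2 * (real n powr \<tau> / fact (k + 1))" by (rule regroup) simp_all
        finally show ?thesis .
      qed
      have "(\<Sum>\<sigma> | \<sigma> \<subseteq> {1..n} \<and> card \<sigma> = k + 1. \<Prod>\<tau>\<in>coin_faces \<sigma> - Q. p n (card \<tau> - 1))
        \<le> ?P k * (real n ^ (k + 1) / fact (k + 1) *
        (1 + (q + 1) ^ (q + 1) * card Q * (1 / p n q) ^ (k choose q) / real n ^ (q + 1)) powr e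
        + (\<Sum>j=q+1..k. card Q * n ^ (k - j) / ?P j))"
        unfolding e_def using Q q n p1 pos p_range by (intro sum_extensions_le) auto
      also have "\<dots> = ?P k * real n ^ (k + 1) / fact (k + 1) *
        (1 + (q + 1) ^ (q + 1) * card Q * (1 / p n q) ^ (k choose q) / real n ^ (q + 1)) powr e
        + ?P k * (\<Sum>j=q+1..k. card Q * n ^ (k - j) / ?P j)"
        by (simp only: distrib_left times_divide_eq_right mult.assoc times_divide_eq_left)
      also have "\<dots> \<le> real n powr \<tau> / fact (k + 1) * (1 + \<epsilon> / 2) + \<epsilon> / 2 * (real n powr \<tau> / fact (k + 1))"
        unfolding top by (rule add_mono[OF mult_left_mono[OF first] second]) simp
      also have "\<dots> = (1 + \<epsilon>) * (real n powr \<tau> / fact (k + 1))" by (simp add: field_simps del: fact_Suc)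
      finally show "(\<Sum>\<sigma> | \<sigma> \<subseteq> {1..n} \<and> card \<sigma> = k + 1. \<Prod>\<tau>\<in>coin_faces \<sigma> - Q. p n (card \<tau> - 1))
       \<le> (1 + \<epsilon>) * (real n powr \<tau> / fact (k + 1))" .
    qed
  qed
  show ?thesis by (rule that[OF c ev])
qed

lemma upper_tail:
  assumes \<epsilon>: "0 < \<epsilon>"
  shows "\<exists>C>0. \<forall>\<^sub>F n in sequentially.
    measure_pmf.prob (coin_pmf n (p n) (n - 1)) {F. (1 + \<epsilon>) * (real n powr \<tau> / fact (k + 1)) \<le> simplex_count n k F}
      \<le> exp (- C * rate n)"
proof -
  obtain c where c: "0 < c" and ev: "\<forall>\<^sub>F n in sequentially. \<forall>Q. finite Q \<longrightarrow> real (card Q) \<le> c * rate n \<longrightarrow>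
     (\<Sum>\<sigma> | \<sigma> \<subseteq> {1..n} \<and> card \<sigma> = k + 1. \<Prod>\<tau>\<in>coin_faces \<sigma> - Q. p n (card \<tau> - 1))
       \<le> (1 + \<epsilon> / 2) * (real n powr \<tau> / fact (k + 1))"
    using extension_bound[of "\<epsilon> / 2"] \<epsilon> by auto
  define \<rho> where "\<rho> = (1 + \<epsilon> / 2) / (1 + \<epsilon>)"
  have \<rho>: "0 < \<rho>" "\<rho> < 1" using \<epsilon> by (auto simp: \<rho>_def field_simps)
  \<comment> \<open>The moment has order about \<open>c * rate n / 2 ^ (k + 1)\<close>, and each
    unit of it gains the factor \<rho>. Rounding down costs at most a factor 2, hence
    \<open>k + 2\<close>.\<close>
  define C where "C = - ln \<rho> * (c / 2 ^ (k + 2))"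
  have C: "0 < C" unfolding C_def using \<rho> c by (intro mult_pos_pos) auto
  have "\<forall>\<^sub>F n in sequentially. 2 ^ (k + 2) / c \<le> rate n"
    unfolding rate_def using rate_exponent_pos by (intro eventually_powr_ge) auto
  then have "\<forall>\<^sub>F n in sequentially.
    measure_pmf.prob (coin_pmf n (p n) (n - 1)) {F. (1 + \<epsilon>) * (real n powr \<tau> / fact (k + 1)) \<le> simplex_count n k F}
      \<le> exp (- C * rate n)"
    using ev eventually_gt_at_top[of "k + 1"]
  proof eventually_elim
    case (elim n)
    \<comment> \<open>Up to rounding, the largest order for which the faces of \<open>m\<close>
      simplices, at most \<open>2 ^ (k + 1)\<close> each, stay within the budget
      \<open>c * rate n\<close>.\<close>
    define m where "m = nat \<lfloor>c * rate n / 2 ^ (k + 1)\<rfloor>"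
    have n: "1 \<le> n" "k \<le> n - 1" using elim by auto
    have x: "2 \<le> c * rate n / 2 ^ (k + 1)" using elim(1) c by (simp add: field_simps)
    then have m: "real m \<le> c * rate n / 2 ^ (k + 1)" "c * rate n / 2 ^ (k + 1) - 1 < real m"
      unfolding m_def by linarith+
    have mc: "real (m * 2 ^ (k + 1)) \<le> c * rate n" using m(1) by (simp add: field_simps)
    have tpos: "0 < (1 + \<epsilon>) * (real n powr \<tau> / fact (k + 1))" using \<epsilon> n by simp
    have "measure_pmf.prob (coin_pmf n (p n) (n - 1)) {F. (1 + \<epsilon>) * (real n powr \<tau> / fact (k + 1)) \<le> simplex_count n k F}
      \<le> ((1 + \<epsilon> / 2) * (real n powr \<tau> / fact (k + 1)) / ((1 + \<epsilon>) * (real n powr \<tau> / fact (k + 1)))) ^ m"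
    proof (rule prob_simplex_count_ge_le[OF _ _ n(2) _ tpos])
      fix Q assume Q: "Q \<subseteq> coins n (n - 1)" "card Q \<le> m * 2 ^ (k + 1)"
      have "real (card Q) \<le> real (m * 2 ^ (k + 1))" using Q(2) by (rule of_nat_mono)
      then have "real (card Q) \<le> c * rate n" using mc by linarith
      then show "(\<Sum>\<sigma> | \<sigma> \<subseteq> {1..n} \<and> card \<sigma> = k + 1. \<Prod>\<tau>\<in>coin_faces \<sigma> - Q. p n (card \<tau> - 1))
        \<le> (1 + \<epsilon> / 2) * (real n powr \<tau> / fact (k + 1))"
        using elim(2) finite_subset[OF Q(1)] by simp
    qed (use p_range n in auto)
    also have "(1 + \<epsilon> / 2) * (real n powr \<tau> / fact (k + 1)) / ((1 + \<epsilon>) * (real n powr \<tau> / fact (k + 1))) = \<rho>"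
      using n by (simp add: \<rho>_def del: fact_Suc)
    also have "\<rho> ^ m = exp (real m * ln \<rho>)" using \<rho> by (simp add: exp_of_nat_mult)
    also have "\<dots> \<le> exp (- C * rate n)"
    proof -
      have "c * rate n / 2 ^ (k + 2) \<le> real m" using m(2) x by (simp add: field_simps)
      then have "real m * ln \<rho> \<le> c * rate n / 2 ^ (k + 2) * ln \<rho>" using \<rho> by (intro mult_right_mono_neg) auto
      then show ?thesis by (simp add: C_def field_simps)
    qed
    finally show ?case .
  qed
  with C show ?thesis by blast
qed

text \<open>The size at which one block has total vertex weight \<open>n\<close>. Equivalently its
  power \<open>q + 1\<close> is \<open>rate n\<close>, the order of the number of planted
  faces.\<close>

definition "block_scale n = real n powr (1 - real (k choose q) / (real q + 1) * a q)"

lemma prod_powr_eq: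
  assumes "1 \<le> n" "finite S" "\<And>i. i \<in> S \<Longrightarrow> p n i = real n powr - a i"
  shows "(\<Prod>i\<in>S. p n i ^ c i) = real n powr (- (\<Sum>i\<in>S. real (c i) * a i))"
  using prod_powr_power[of "real n" S a c] assms by simp

text \<open>
  By the hypothesis \<open>low\<close> the \<open>k\<close>-simplices inside one block of \<open>c * block_scale n\<close> vertices outnumber
  the \<open>(k + 1)\<close>-simplices there only if \<open>c\<close> is small; the choice of \<open>c\<close> makes the ratio at least 2.
  This is why many small blocks are planted instead of a single large one.
\<close>

lemma planted_gap:
  assumes n: "1 \<le> n" and Ms: "M * s \<le> n" and s: "real s \<le> c * block_scale n" "c * block_scale n \<le> 2 * real s" "k + 1 \<le> s"
    and c: "0 < c" "2 * c * (2 * (real k + 1)) ^ (k + 1) = 1"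
    and e1: "(1 + M * c) ^ k * real n powr ((\<Sum>i=q..k. real (k choose i) * a i) - 1) \<le> 1 / 2"
    and e2: "fin \<Longrightarrow> (1 + M * c) ^ (k + 2) * real n powr (1 - (\<Sum>i=q..k+1. real ((k + 1) choose i) * a i)) \<le> 1 / 2"
  shows "real n powr \<tau> * (M * c ^ (k + 2) - 1) \<le>
    (\<Sum>\<sigma> | \<sigma> \<subseteq> {1..n} \<and> card \<sigma> = k + 1. \<Prod>\<tau>\<in>coin_faces \<sigma> - planted (\<lambda>l. {l * s + 1..l * s + s}) M q. p n (card \<tau> - 1))
      - (\<Sum>\<sigma> | \<sigma> \<subseteq> {1..n} \<and> card \<sigma> = k - 1 + 1. \<Prod>\<tau>\<in>coin_faces \<sigma> - planted (\<lambda>l. {l * s + 1..l * s + s}) M q. p n (card \<tau> - 1))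
      - (\<Sum>\<sigma> | \<sigma> \<subseteq> {1..n} \<and> card \<sigma> = k + 1 + 1. \<Prod>\<tau>\<in>coin_faces \<sigma> - planted (\<lambda>l. {l * s + 1..l * s + s}) M q. p n (card \<tau> - 1))"
    (is "_ \<le> ?S k - ?S (k - 1) - ?S (k + 1)")
proof -
  have pos: "0 < p n i" if "1 \<le> i" "i \<le> k" for i using p_eq[OF n that] n by simp
  interpret planted_blocks "\<lambda>l. {l * s + 1..l * s + s}" M s n q k "p n"
    using Ms q p1 n p_range pos by (intro intervals_planted_blocks) auto
  let ?D = "real (k choose q) / (real q + 1)"
  let ?K = "real n * (1 + M * c)"
  have n0: "0 < real n" using n by simp
  have npow: "real n ^ j = real n powr real j" for j using n0 by (simp add: powr_realpow)
  have scpow: "block_scale n ^ j = real n powr (real j * (1 - ?D * a q))" for j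
    using n0 by (simp add: block_scale_def powr_power mult.commute)
  \<comment> \<open>The total vertex weight: at most \<open>n\<close> outside the blocks and
    \<open>c * n\<close> from each of the \<open>M\<close> blocks.\<close>
  have base: "real n + M * s * (1 / p n q) powr ((k choose q) / (q + 1)) \<le> ?K"
  proof -
    have "(1 / p n q) powr ((k choose q) / (q + 1)) = real n powr (?D * a q)"
      using p_eq[OF n q] n0 by (simp add: powr_minus powr_powr inverse_eq_divide mult.commute add.commute)
    moreover have "s * real n powr (?D * a q) \<le> c * block_scale n * real n powr (?D * a q)"
      using s(1) by (intro mult_right_mono) auto
    moreover have "block_scale n * real n powr (?D * a q) = real n"
      using n0 by (simp add: block_scale_def powr_add[symmetric])
    ultimately have "s * (1 / p n q) powr ((k choose q) / (q + 1)) \<le> c * real n" by (simp add: mult.assoc)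
    then have "M * (s * (1 / p n q) powr ((k choose q) / (q + 1))) \<le> M * (c * real n)" by (intro mult_left_mono) auto
    then show ?thesis by (simp add: algebra_simps)
  qed
  have base0: "0 \<le> real n + M * s * (1 / p n q) powr ((k choose q) / (q + 1))" by simp
  have absorb: "?D * (real k + 1) = real ((k + 1) choose (q + 1))"
    using binomial_absorb_real[of q k] by (simp add: field_simps)
  have split_q: "(\<Sum>i=q..j. f i) = f q + (\<Sum>i=q+1..j. f i)" if "q \<le> j" for f :: "nat \<Rightarrow> real" and j
    using that by (simp add: sum.atLeast_Suc_atMost)
  have pascal: "real ((m + 1) choose (i + 1)) * a i = real (m choose i) * a i + real (m choose (i + 1)) * a i" for m i
    by (simp add: binomial_Suc_Suc distrib_right)
  have "M * (2 * c ^ (k + 2)) * real n powr \<tau> \<le> ?S k"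
  proof -
    \<comment> \<open>In the base, 2 pays for rounding \<open>s\<close> and \<open>k + 1\<close>
      comes from the bound \<open>(s / (k + 1)) ^ (k + 1)\<close> for the binomial. The
      normalisation of \<open>c\<close> makes the result twice the coefficient that bounds the
      simplices of dimension \<open>k + 1\<close> inside a block.\<close>
    have "(c / (2 * (real k + 1))) ^ (k + 1) = 2 * c ^ (k + 2)"
    proof -
      have "(c / (2 * (real k + 1))) ^ (k + 1) = c ^ (k + 1) / (2 * (real k + 1)) ^ (k + 1)" by (rule power_divide)
      also have "\<dots> = c ^ (k + 1) * (1 / (2 * (real k + 1)) ^ (k + 1))" by simp
      also have "1 / (2 * (real k + 1)) ^ (k + 1) = 2 * c"
        using c(2) by (intro divide_eq_imp) auto
      finally show ?thesis by simp
    qed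
    from this[symmetric] have "2 * c ^ (k + 2) * block_scale n ^ (k + 1) = (c * block_scale n / (2 * (real k + 1))) ^ (k + 1)"
      by (simp only: power_mult_distrib[symmetric] times_divide_eq_left)
    also have "\<dots> \<le> (real s / real (k + 1)) ^ (k + 1)"
    proof (rule power_mono)
      have "c * block_scale n / (2 * (real k + 1)) \<le> 2 * real s / (2 * (real k + 1))"
        using s(2) by (intro divide_right_mono) auto
      also have "\<dots> = real s / (real k + 1)" by (rule mult_divide_mult_cancel_left) simp
      finally show "c * block_scale n / (2 * (real k + 1)) \<le> real s / real (k + 1)" by (simp only: of_nat_add of_nat_1)
      show "0 \<le> c * block_scale n / (2 * (real k + 1))" using c(1) by (simp add: block_scale_def)
    qed
    also have "\<dots> \<le> real (s choose (k + 1))" using s(3) by (rule binomial_ge_n_over_k_pow_k)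
    finally have ch: "2 * c ^ (k + 2) * block_scale n ^ (k + 1) \<le> real (s choose (k + 1))" .
    have P': "(\<Prod>i=q+1..k. p n i ^ ((k + 1) choose (i + 1))) = real n powr (- (\<Sum>i=q+1..k. real ((k + 1) choose (i + 1)) * a i))"
      using n q p_eq by (intro prod_powr_eq) auto
    have "\<tau> = real (k + 1) * (1 - ?D * a q) + - (\<Sum>i=q+1..k. real ((k + 1) choose (i + 1)) * a i)"
      unfolding \<tau>_def split_q[OF q(2)] absorb[symmetric] by (simp add: algebra_simps)
    then have "real n powr \<tau> = block_scale n ^ (k + 1) * (\<Prod>i=q+1..k. p n i ^ ((k + 1) choose (i + 1)))"
      unfolding P' scpow by (simp only: powr_add)
    then have "M * (2 * c ^ (k + 2)) * real n powr \<tau> = M * ((2 * c ^ (k + 2) * block_scale n ^ (k + 1)) * (\<Prod>i=q+1..k. p n i ^ ((k + 1) choose (i + 1))))"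
      by (simp only: mult_ac)
    also have "\<dots> \<le> M * (real (s choose (k + 1)) * (\<Prod>i=q+1..k. p n i ^ ((k + 1) choose (i + 1))))"
      unfolding P' by (intro mult_left_mono mult_right_mono ch) auto
    also have "\<dots> \<le> ?S k" using sum_W_ge by (simp only: mult.assoc of_nat_mult)
    finally show ?thesis .
  qed
  moreover have "?S (k - 1) \<le> real n powr \<tau> / 2"
  proof -
    have k1: "k - 1 + 1 = k" "k - 1 \<noteq> k + 1" "k - 1 \<le> k + 1" using q by auto
    have "?S (k - 1) \<le> (\<Prod>i=q..k-1. p n i ^ (k choose (i + 1))) * (real n + M * s * (1 / p n q) powr ((k choose q) / (q + 1))) ^ k"
      using sum_W_le[OF k1(3)] unfolding k1(1) if_not_P[OF k1(2)] add_0_right .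
    also have "\<dots> \<le> (\<Prod>i=q..k-1. p n i ^ (k choose (i + 1))) * ?K ^ k"
      using base base0 p_range[OF n] by (intro mult_left_mono power_mono prod_nonneg) auto
    also have "(\<Prod>i=q..k-1. p n i ^ (k choose (i + 1))) = real n powr (- (\<Sum>i=q..k-1. real (k choose (i + 1)) * a i))"
      using n q p_eq by (intro prod_powr_eq) auto
    also have "(\<Sum>i=q..k-1. real (k choose (i + 1)) * a i) = (\<Sum>i=q..k. real (k choose (i + 1)) * a i)"
    proof (rule sum.mono_neutral_left)
      show "\<forall>i\<in>{q..k} - {q..k - 1}. real (k choose (i + 1)) * a i = 0"
      proof
        fix i assume "i \<in> {q..k} - {q..k - 1}"
        then have "i = k" by auto
        then show "real (k choose (i + 1)) * a i = 0" by simp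
      qed
    qed auto
    also have "real n powr (- (\<Sum>i=q..k. real (k choose (i + 1)) * a i)) * ?K ^ k
      = (1 + M * c) ^ k * (real n powr (- (\<Sum>i=q..k. real (k choose (i + 1)) * a i)) * real n powr real k)"
      by (simp only: power_mult_distrib npow mult_ac)
    \<comment> \<open>By Pascal's rule the exponent is \<tau> plus the sum in \<open>sub\<close>
      minus 1.\<close>
    also have "real n powr (- (\<Sum>i=q..k. real (k choose (i + 1)) * a i)) * real n powr real k
      = real n powr ((\<Sum>i=q..k. real (k choose i) * a i) - 1) * real n powr \<tau>"
      unfolding powr_add[symmetric] \<tau>_def pascal sum.distrib by (simp add: algebra_simps)
    also have "(1 + M * c) ^ k * (real n powr ((\<Sum>i=q..k. real (k choose i) * a i) - 1) * real n powr \<tau>) \<le> 1 / 2 * real n powr \<tau>"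
      unfolding mult.assoc[symmetric] using e1 by (intro mult_right_mono) auto
    finally show ?thesis by simp
  qed
  moreover have "?S (k + 1) \<le> real n powr \<tau> / 2 + M * c ^ (k + 2) * real n powr \<tau>"
  proof -
    let ?P = "\<Prod>i=q..k+1. p n i ^ ((k + 2) choose (i + 1))"
    let ?P' = "\<Prod>i=q+1..k+1. p n i ^ ((k + 2) choose (i + 1))"
    have k2: "k + 1 + 1 = k + 2" by simp
    have bd: "?S (k + 1) \<le> ?P * (real n + M * s * (1 / p n q) powr ((k choose q) / (q + 1))) ^ (k + 2) + M * s ^ (k + 2) * ?P'"
      using sum_W_le[OF order_refl] by (simp only: k2 if_True refl)
    show ?thesis
    proof (cases fin)
      \<comment> \<open>The coin of dimension \<open>k + 1\<close> now has probability 0, and every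
        simplex of that dimension needs one.\<close>
      case False
      then have z: "p n (k + 1) = 0" using p_top[OF n] by simp
      have "p n (k + 1) ^ ((k + 2) choose (k + 1 + 1)) = 0" using z by (simp add: numeral_2_eq_2)
      then have "?P = 0" "?P' = 0" using q by (intro prod_zero bexI[of _ "k + 1"]; simp)+
      then have "?S (k + 1) \<le> 0" using bd by simp
      also have "0 \<le> real n powr \<tau> / 2 + M * c ^ (k + 2) * real n powr \<tau>" using c by simp
      finally show ?thesis .
    next
      case True
      have pe: "p n i = real n powr - a i" if "1 \<le> i" "i \<le> k + 1" for i
        using p_eq[OF n, of i] p_top[OF n] True that by (cases "i = k + 1") auto
      have top0: "(\<Sum>i=j..k+1. real ((k + 1) choose (i + 1)) * a i) = (\<Sum>i=j..k. real ((k + 1) choose (i + 1)) * a i)" if "j \<le> k + 1" for j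
        using that by (simp add: sum.cl_ivl_Suc binomial_eq_0)
      have pascal2: "real ((k + 2) choose (i + 1)) * a i = real ((k + 1) choose i) * a i + real ((k + 1) choose (i + 1)) * a i" for i
        using pascal[of "k + 1" i] by (simp add: numeral_2_eq_2)
      have P: "?P = real n powr (- (\<Sum>i=q..k+1. real ((k + 2) choose (i + 1)) * a i))"
        using n q pe by (intro prod_powr_eq) auto
      have P': "?P' = real n powr (- (\<Sum>i=q+1..k+1. real ((k + 2) choose (i + 1)) * a i))"
        using n q pe by (intro prod_powr_eq) auto
      have "?P * (real n + M * s * (1 / p n q) powr ((k choose q) / (q + 1))) ^ (k + 2) \<le> ?P * ?K ^ (k + 2)"
        using base base0 p_range[OF n] by (intro mult_left_mono power_mono prod_nonneg) auto
      also have "\<dots> = (1 + M * c) ^ (k + 2) * (?P * real n powr real (k + 2))"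
        by (simp only: power_mult_distrib npow mult_ac)
      also have "?P * real n powr real (k + 2) = real n powr (1 - (\<Sum>i=q..k+1. real ((k + 1) choose i) * a i)) * real n powr \<tau>"
        unfolding P powr_add[symmetric] \<tau>_def pascal2 sum.distrib using q by (subst top0) (simp_all add: algebra_simps)
      also have "(1 + M * c) ^ (k + 2) * (real n powr (1 - (\<Sum>i=q..k+1. real ((k + 1) choose i) * a i)) * real n powr \<tau>) \<le> 1 / 2 * real n powr \<tau>"
        unfolding mult.assoc[symmetric] using e2[OF True] by (intro mult_right_mono) auto
      finally have 1: "?P * (real n + M * s * (1 / p n q) powr ((k choose q) / (q + 1))) ^ (k + 2) \<le> real n powr \<tau> / 2" by simp
      \<comment> \<open>Inside a block the exponent is \<tau> plus 1 minus the quantity bounded in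
        \<open>low\<close>, hence at most \<tau>. Equality is possible, so the extra factor
        \<open>c\<close> has to make the difference.\<close>
      have "real s ^ (k + 2) * ?P' \<le> (c * block_scale n) ^ (k + 2) * ?P'"
        using s(1) unfolding P' by (intro mult_right_mono power_mono) auto
      also have "\<dots> = c ^ (k + 2) * (block_scale n ^ (k + 2) * ?P')" by (simp only: power_mult_distrib mult_ac)
      also have "\<dots> \<le> c ^ (k + 2) * real n powr \<tau>"
      proof (intro mult_left_mono)
        have gen: "real (k + 2) * (1 - D * x) + - (S1 + S2) = real k + 1 - (D * (real k + 1) * x + S2) + (1 - (D * x + S1))"
          for D x S1 S2 :: real by (simp add: algebra_simps)
        have top: "(\<Sum>i=q+1..k+1. real ((k + 1) choose (i + 1)) * a i) = (\<Sum>i=q+1..k. real ((k + 1) choose (i + 1)) * a i)"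
          using q by (intro top0) simp
        have "real (k + 2) * (1 - ?D * a q) + - (\<Sum>i=q+1..k+1. real ((k + 2) choose (i + 1)) * a i)
          = \<tau> + (1 - (?D * a q + (\<Sum>i=q+1..k+1. real ((k + 1) choose i) * a i)))"
          unfolding \<tau>_def split_q[OF q(2)] absorb[symmetric] pascal2 sum.distrib top by (rule gen)
        also have "\<dots> \<le> \<tau>" using low[OF True] by simp
        finally have "real n powr (real (k + 2) * (1 - ?D * a q) + - (\<Sum>i=q+1..k+1. real ((k + 2) choose (i + 1)) * a i)) \<le> real n powr \<tau>"
          using n by (intro powr_mono) auto
        then show "block_scale n ^ (k + 2) * ?P' \<le> real n powr \<tau>" unfolding scpow P' by (simp only: powr_add)
      qed (use c in auto)
      finally have "M * (real s ^ (k + 2) * ?P') \<le> M * (c ^ (k + 2) * real n powr \<tau>)" by (intro mult_left_mono) auto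
      then show ?thesis using bd 1 by (simp add: mult.assoc)
    qed
  qed
  \<comment> \<open>In units of \<open>n powr \<tau>\<close>: planted \<open>k\<close>-simplices
    give \<open>2 * M * c ^ (k + 2)\<close>; the simplices of dimension \<open>k + 1\<close> inside
    blocks cost \<open>M * c ^ (k + 2)\<close>, and the two remaining terms cost one half
    each.\<close>
  ultimately show ?thesis by (simp add: algebra_simps)
qed

lemma lower_tail:
  assumes \<epsilon>: "0 < \<epsilon>"
  shows "\<exists>C>0. \<forall>\<^sub>F n in sequentially. exp (- C * rate n * ln (real n)) \<le>
    measure_pmf.prob (coin_pmf n (p n) (n - 1)) {F. (1 + \<epsilon>) * (real n powr \<tau> / fact (k + 1))
      \<le> simplex_count n k F - simplex_count n (k - 1) F - simplex_count n (k + 1) F}"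
proof -
  define c where "c = 1 / (2 * (2 * (real k + 1)) ^ (k + 1))"
  have c: "0 < c" "2 * c * (2 * (real k + 1)) ^ (k + 1) = 1" by (simp_all add: c_def)
  \<comment> \<open>With this many blocks the surplus from \<open>planted_gap\<close> is at least
    twice the target. \<open>M\<close> does not depend on \<open>n\<close>.\<close>
  obtain M where M: "2 * (1 + \<epsilon>) / fact (k + 1) + 1 < real M * c ^ (k + 2)"
    using ex_less_of_nat_mult[of "c ^ (k + 2)" "2 * (1 + \<epsilon>) / fact (k + 1) + 1"] c by auto
  have "0 < 2 * (1 + \<epsilon>) / fact (k + 1) + (1::real)" using \<epsilon> by (intro add_pos_pos divide_pos_pos) auto
  then have M0: "0 < M" using M by (cases M) auto
  define D where "D = real (k choose q) / (real q + 1)"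
  have D: "0 < D * a q" "D * a q < 1"
  proof -
    show "0 < D * a q" unfolding D_def using q aq by (intro mult_pos_pos divide_pos_pos) auto
    have "D * a q \<le> real (k choose q) * a q" unfolding D_def using aq by (intro mult_right_mono) (auto simp: divide_le_eq mult_le_cancel_left1)
    then show "D * a q < 1" using rate_exponent_pos by simp
  qed
  \<comment> \<open>The polynomial loss is \<open>n ^ (k + 1)\<close> divided by the target. The
    exponent is larger by 1 than \<open>k + 1 - \<tau>\<close> because a spare factor
    \<open>n\<close> absorbs the factorial in the target.\<close>
  define A where "A = real k + 2 - \<tau>"
  have A: "0 \<le> A"
  proof -
    have "0 \<le> (\<Sum>i=q..k. real ((k + 1) choose (i + 1)) * a i)"
      using q a_nonneg by (intro sum_nonneg mult_nonneg_nonneg) auto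
    then show ?thesis by (simp add: A_def \<tau>_def)
  qed
  \<comment> \<open>\<open>A\<close> covers the polynomial loss, since eventually
    \<open>1 \<le> rate n\<close>; the second term covers the planted faces, each of which costs
    \<open>n powr - a q\<close>; the summand 1 secures positivity.\<close>
  define C where "C = A + a q * (M * c ^ (q + 1)) + 1"
  have C: "0 < C" unfolding C_def using A aq c by (intro add_nonneg_pos add_nonneg_nonneg) auto
  let ?K1 = "(1 + M * c) ^ k" and ?K2 = "(1 + M * c) ^ (k + 2)"
  have "0 < 1 + M * c" using c by (intro add_pos_nonneg) auto
  then have K: "0 < ?K1" "0 < ?K2" by (simp_all only: zero_less_power)
  have "\<forall>\<^sub>F n in sequentially. real n powr ((\<Sum>i=q..k. real (k choose i) * a i) - 1) \<le> 1 / (2 * ?K1)"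
    using sub K by (intro eventually_powr_le) auto
  moreover have "\<forall>\<^sub>F n in sequentially. fin \<longrightarrow> real n powr (1 - (\<Sum>i=q..k+1. real ((k + 1) choose i) * a i)) \<le> 1 / (2 * ?K2)"
  proof (cases fin)
    case True
    then have "\<forall>\<^sub>F n in sequentially. real n powr (1 - (\<Sum>i=q..k+1. real ((k + 1) choose i) * a i)) \<le> 1 / (2 * ?K2)"
      using super K by (intro eventually_powr_le) auto
    then show ?thesis by eventually_elim simp
  qed simp
  \<comment> \<open>Positivity of \<open>a q\<close> makes a block smaller than \<open>n\<close> by
    a power of \<open>n\<close>, so \<open>M\<close> disjoint blocks eventually fit.\<close>
  moreover have "\<forall>\<^sub>F n in sequentially. real n powr (- (D * a q)) \<le> 1 / (M * c)"
    using D M0 c by (intro eventually_powr_le) auto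
  moreover have "\<forall>\<^sub>F n in sequentially. 2 * (real k + 1) / c \<le> real n powr (1 - D * a q)"
    using D by (intro eventually_powr_ge) auto
  moreover have "\<forall>\<^sub>F n in sequentially. 1 \<le> rate n"
    unfolding rate_def using rate_exponent_pos by (intro eventually_powr_ge) auto
  moreover have "\<forall>\<^sub>F n in sequentially. k + 2 + fact (k + 1) \<le> n" by (rule eventually_ge_at_top)
  ultimately have "\<forall>\<^sub>F n in sequentially. exp (- C * rate n * ln (real n)) \<le>
    measure_pmf.prob (coin_pmf n (p n) (n - 1)) {F. (1 + \<epsilon>) * (real n powr \<tau> / fact (k + 1))
      \<le> simplex_count n k F - simplex_count n (k - 1) F - simplex_count n (k + 1) F}"
  proof eventually_elim
    case (elim n)
    have n: "1 \<le> n" "k + 1 \<le> n - 1" "fact (k + 1) \<le> n" using elim(6) by linarith+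
    have n0: "0 < real n" using n by simp
    define s where "s = nat \<lfloor>c * block_scale n\<rfloor>"
    have scD: "block_scale n = real n powr (1 - D * a q)" by (simp add: block_scale_def D_def)
    have x: "2 * (real k + 1) \<le> c * block_scale n" using elim(4) c unfolding scD by (simp add: field_simps)
    have "(2::real) \<le> 2 * (real k + 1)" by simp
    also note x
    finally have x2: "2 \<le> c * block_scale n" .
    have "real (nat \<lfloor>y\<rfloor>) \<le> y \<and> y - 1 < real (nat \<lfloor>y\<rfloor>)" if "2 \<le> y" for y :: real
      using that by linarith
    from this[OF x2] have s: "real s \<le> c * block_scale n" "c * block_scale n - 1 < real s" by (simp_all only: s_def)
    have s2: "c * block_scale n \<le> 2 * real s" using s x2 by linarith
    have "real (k + 1) \<le> real s" using s x by simp
    then have s3: "k + 1 \<le> s" by (simp only: of_nat_le_iff)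
    have "real (M * s) \<le> M * (c * block_scale n)" unfolding of_nat_mult using s(1) by (intro mult_left_mono) auto
    also have "\<dots> = real n * (M * c * real n powr (- (D * a q)))"
      using n0 by (simp add: scD powr_diff powr_minus divide_inverse)
    also have "\<dots> \<le> real n * 1"
    proof (rule mult_left_mono)
      show "M * c * real n powr (- (D * a q)) \<le> 1" using elim(3) M0 c by (simp add: field_simps)
    qed simp
    finally have "real (M * s) \<le> real n" by (simp only: mult_1_right)
    then have Ms: "M * s \<le> n" by (simp only: of_nat_le_iff)
    have pos: "0 < p n i" if "1 \<le> i" "i \<le> k" for i using p_eq[OF n(1) that] n by simp
    interpret planted_blocks "\<lambda>l. {l * s + 1..l * s + s}" M s n q k "p n"
      using Ms q p1 n p_range pos by (intro intervals_planted_blocks) auto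
    define \<theta> where "\<theta> = (1 + \<epsilon>) * (real n powr \<tau> / fact (k + 1))"
    have "2 * \<theta> = real n powr \<tau> * (2 * (1 + \<epsilon>) / fact (k + 1))" by (simp add: \<theta>_def del: fact_Suc)
    also have "\<dots> \<le> real n powr \<tau> * (M * c ^ (k + 2) - 1)" using M by (intro mult_left_mono) auto
    also have "\<dots> \<le> (\<Sum>\<sigma> | \<sigma> \<subseteq> {1..n} \<and> card \<sigma> = k + 1. W \<sigma>)
      - (\<Sum>\<sigma> | \<sigma> \<subseteq> {1..n} \<and> card \<sigma> = k - 1 + 1. W \<sigma>)
      - (\<Sum>\<sigma> | \<sigma> \<subseteq> {1..n} \<and> card \<sigma> = k + 1 + 1. W \<sigma>)"
    proof (rule planted_gap[OF n(1) Ms s(1) s2 s3 c])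
      show "?K1 * real n powr ((\<Sum>i=q..k. real (k choose i) * a i) - 1) \<le> 1 / 2"
        using elim(1) K by (simp add: field_simps)
      show "?K2 * real n powr (1 - (\<Sum>i=q..k+1. real ((k + 1) choose i) * a i)) \<le> 1 / 2" if fin
        using elim(2) that K by (simp add: pos_le_divide_eq mult.commute mult.left_commute)
    qed
    finally have gap: "2 * \<theta> \<le> (\<Sum>\<sigma> | \<sigma> \<subseteq> {1..n} \<and> card \<sigma> = k + 1. W \<sigma>)
      - (\<Sum>\<sigma> | \<sigma> \<subseteq> {1..n} \<and> card \<sigma> = k - 1 + 1. W \<sigma>)
      - (\<Sum>\<sigma> | \<sigma> \<subseteq> {1..n} \<and> card \<sigma> = k + 1 + 1. W \<sigma>)" .
    let ?Pr = "measure_pmf.prob (coin_pmf n (p n) (n - 1)) {F. \<theta> \<le> simplex_count n k F - simplex_count n (k - 1) F - simplex_count n (k + 1) F}"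
    have \<theta>0: "0 \<le> \<theta>" using \<epsilon> by (simp add: \<theta>_def)
    have main: "\<theta> * p n q ^ card Q \<le> real n ^ (k + 1) * ?Pr"
      using prob_planted_ge[OF n(2) n(1) \<theta>0 gap] by simp
    have cardQ: "real (card Q) \<le> M * c ^ (q + 1) * rate n"
    proof -
      have "real (card Q) \<le> real (M * s ^ (q + 1))" using card_planted by (rule of_nat_mono)
      also have "\<dots> = M * real s ^ (q + 1)" by simp
      also have "\<dots> \<le> M * (c * block_scale n) ^ (q + 1)" using s(1) by (intro mult_left_mono power_mono) auto
      also have "(c * block_scale n) ^ (q + 1) = c ^ (q + 1) * block_scale n ^ (q + 1)" by (rule power_mult_distrib)
      also have "block_scale n ^ (q + 1) = real n powr ((1 - D * a q) * real (q + 1))"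
        unfolding scD using n0 by (subst powr_power) (auto simp: mult.commute)
      also have "(1 - D * a q) * real (q + 1) = real q + 1 - real (k choose q) * a q"
        by (simp add: D_def field_simps)
      finally show ?thesis by (simp add: rate_def)
    qed
    have "real n powr (- A) * real n powr (- (a q * (M * c ^ (q + 1) * rate n))) \<le> ?Pr"
    proof -
      have "real n powr (- (a q * (M * c ^ (q + 1) * rate n))) \<le> real n powr (- (a q * real (card Q)))"
        using cardQ aq n by (intro powr_mono) auto
      also have "\<dots> = p n q ^ card Q"
        using p_eq[OF n(1) q] n0 by (simp add: powr_power mult.commute)
      finally have 1: "real n powr (- (a q * (M * c ^ (q + 1) * rate n))) \<le> p n q ^ card Q" .
      have "real n powr (- A) * real n ^ (k + 1) = real n powr \<tau> * (1 / real n)"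
      proof -
        have "real n powr (- A) * real n ^ (k + 1) = real n powr (- A + real (k + 1))"
          unfolding powr_add powr_realpow[OF n0] ..
        also have "- A + real (k + 1) = \<tau> + - 1" by (simp add: A_def)
        also have "real n powr (\<tau> + - 1) = real n powr \<tau> * (1 / real n)"
          unfolding powr_add using n0 by (simp add: powr_minus divide_inverse)
        finally show ?thesis .
      qed
      also have "\<dots> \<le> real n powr \<tau> * ((1 + \<epsilon>) / fact (k + 1))"
      proof (rule mult_left_mono)
        have "real (fact (k + 1)) \<le> real n" using n(3) by (rule of_nat_mono)
        then have "1 / real n \<le> 1 / fact (k + 1)" using n0 by (intro divide_left_mono) simp_all
        also have "\<dots> \<le> (1 + \<epsilon>) / fact (k + 1)" using \<epsilon> by (intro divide_right_mono) auto
        finally show "1 / real n \<le> (1 + \<epsilon>) / fact (k + 1)" .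
      qed simp
      also have "\<dots> = \<theta>" by (simp add: \<theta>_def del: fact_Suc)
      finally have 2: "real n powr (- A) * real n ^ (k + 1) \<le> \<theta>" .
      have "real n ^ (k + 1) * (real n powr (- A) * real n powr (- (a q * (M * c ^ (q + 1) * rate n)))) =
        (real n powr (- A) * real n ^ (k + 1)) * real n powr (- (a q * (M * c ^ (q + 1) * rate n)))" by (simp only: mult_ac)
      also have "\<dots> \<le> \<theta> * p n q ^ card Q" using 1 2 \<theta>0 by (intro mult_mono) auto
      also note main
      finally show ?thesis using n0 by (simp only: mult_le_cancel_left_pos zero_less_power)
    qed
    moreover have "exp (- C * rate n * ln (real n)) \<le> real n powr (- A) * real n powr (- (a q * (M * c ^ (q + 1) * rate n)))"
    proof -
      have "exp (- C * rate n * ln (real n)) = real n powr (- C * rate n)" using n0 by (simp add: powr_def)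
      also have "\<dots> \<le> real n powr (- A + - (a q * (M * c ^ (q + 1) * rate n)))"
      proof (rule powr_mono)
        have "A * 1 \<le> A * rate n" using A elim(5) by (intro mult_left_mono) auto
        then show "- C * rate n \<le> - A + - (a q * (M * c ^ (q + 1) * rate n))"
          using elim(5) by (simp add: C_def algebra_simps)
      qed (use n in simp)
      finally show ?thesis by (simp only: powr_add)
    qed
    ultimately show ?case unfolding \<theta>_def by linarith
  qed
  with C show ?thesis by blast
qed

end

section \<open>Transfer from coins to Betti numbers\<close>

lemma random_skeleton_cong:
  assumes "\<And>i. 1 \<le> i \<Longrightarrow> p i = p' i"
  shows "random_skeleton n p i = random_skeleton n p' i"
  by (induction i) (simp_all add: assms)

lemma finite_complex_coin_complex:
  assumes "1 \<le> j"
  shows "finite_complex (coin_complex n i F) j"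
proof
  show "finite (coin_complex n i F)"
    by (rule finite_subset[of _ "Pow {1..n}"]) (auto simp: coin_complex_def)
  fix \<sigma> \<tau> assume s: "\<sigma> \<in> coin_complex n i F" and t: "\<tau> \<subseteq> \<sigma>" "\<tau> \<noteq> {}"
  have "\<sigma> \<subseteq> {1..n}" using s by (simp add: coin_complex_def)
  then have "finite \<sigma>" using finite_subset by blast
  then have "card \<tau> \<le> card \<sigma>" using t by (intro card_mono)
  moreover have "coin_faces \<tau> \<subseteq> coin_faces \<sigma>" using t by (auto simp: coin_faces_def)
  ultimately show "\<tau> \<in> coin_complex n i F" using s t unfolding coin_complex_def by auto
qed (rule assms)

lemma betti_coin_complex_le:
  assumes "1 \<le> k" "k \<le> i"
  shows "real (betti k (coin_complex n i F)) \<le> simplex_count n k F"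
proof -
  interpret finite_complex "coin_complex n i F" k using assms(1) by (rule finite_complex_coin_complex)
  show ?thesis using betti_le of_nat_mono unfolding card_simplices_coin_complex[OF assms(2), symmetric] by blast
qed

lemma betti_coin_complex_ge:
  assumes "1 \<le> k" "k + 1 \<le> i"
  shows "simplex_count n k F - simplex_count n (k - 1) F - simplex_count n (k + 1) F \<le> real (betti k (coin_complex n i F))"
proof -
  interpret finite_complex "coin_complex n i F" k using assms(1) by (rule finite_complex_coin_complex)
  have "real (card (simplices (coin_complex n i F) k)) \<le> real (betti k (coin_complex n i F)
      + card (simplices (coin_complex n i F) (k - 1)) + card (simplices (coin_complex n i F) (k + 1)))"
    using card_simplices_le_betti by (rule of_nat_mono)
  then show ?thesis using assms by (simp add: card_simplices_coin_complex)
qed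

section \<open>Translation of the hypotheses into real exponents\<close>

lemma sum_ereal_mult:
  assumes "\<And>i. i \<in> S \<Longrightarrow> \<bar>\<alpha> i\<bar> \<noteq> \<infinity>"
  shows "(\<Sum>i\<in>S. ereal (c i) * \<alpha> i) = ereal (\<Sum>i\<in>S. c i * real_of_ereal (\<alpha> i))"
proof -
  have "(\<Sum>i\<in>S. ereal (c i) * \<alpha> i) = (\<Sum>i\<in>S. ereal (c i * real_of_ereal (\<alpha> i)))"
    using assms by (intro sum.cong refl) (metis ereal_real times_ereal.simps(1))
  then show ?thesis by simp
qed

text \<open>The right-hand side is \<open>(k + 1) choose (q + 1)\<close> minus
  \<open>k choose q\<close>. In this form the intermediate hypothesis says that the exponents
  \<open>\<delta> j\<close> of \<open>extension_bound\<close> are negative.\<close>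

lemma binomial_identity_mid:
  assumes "q \<le> k"
  shows "(real k - real q) / (real k + 1) * real ((k + 1) choose (q + 1)) = real (k choose (q + 1))"
proof -
  have "(k + 1 - (q + 1)) * ((k + 1) choose (q + 1)) = (k + 1) * (k choose (q + 1))"
    using binomial_absorb_comp[of "k + 1" "q + 1"] by simp
  then have "real ((k - q) * ((k + 1) choose (q + 1))) = real ((k + 1) * (k choose (q + 1)))" by simp
  then show ?thesis using assms by (simp add: of_nat_diff field_simps)
qed

text \<open>The subtracted term is \<open>q * ((k + 2) choose (q + 1)) / (k + 1)\<close>, and two
  absorption rules reduce the difference to the per-vertex exponent of \<open>block_scale\<close>.
  The last hypothesis thus says that the simplices of dimension \<open>k + 1\<close> inside a block
  are at most of order \<open>n powr \<tau>\<close>.\<close>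

lemma binomial_identity_low:
  assumes "q \<le> k"
  shows "real ((k + 1) choose q) - real q * fact (k + 2) / (fact (q + 1) * fact (k + 1 - q) * (real k + 1))
    = real (k choose q) / (real q + 1)"
proof -
  define x y z where "x = real (k choose q)" and "y = real ((k + 1) choose q)" and "z = real ((k + 2) choose (q + 1))"
  have "z = fact (k + 2) / (fact (q + 1) * fact (k + 1 - q))"
    unfolding z_def using binomial_fact[of "q + 1" "k + 2", where 'a = real] assms by simp
  then have eq: "real q * fact (k + 2) / (fact (q + 1) * fact (k + 1 - q) * (real k + 1)) = real q * z / (real k + 1)"
    by simp
  have "real (Suc q * (Suc (k + 1) choose Suc q)) = real (Suc (k + 1) * ((k + 1) choose q))"
    by (simp only: Suc_times_binomial)
  then have 1: "(real q + 1) * z = (real k + 2) * y" by (simp add: z_def y_def algebra_simps)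
  have "(k + 1 - q) * ((k + 1) choose q) = (k + 1) * (k choose q)"
    using binomial_absorb_comp[of "k + 1" q] by simp
  then have "real (k + 1 - q) * real ((k + 1) choose q) = real (k + 1) * real (k choose q)"
    unfolding of_nat_mult[symmetric] by (rule arg_cong)
  moreover have "real (k + 1 - q) = real k + 1 - real q" using assms by (simp add: of_nat_diff)
  ultimately have 2: "(real k + 1 - real q) * y = (real k + 1) * x"
    by (simp only: x_def y_def of_nat_add of_nat_1)
  have "(real k + 1) * (real q + 1) * (y - real q * z / (real k + 1)) = (real k + 1) * (real q + 1) * y - real q * ((real q + 1) * z)"
    by (simp add: field_simps)
  also have "\<dots> = (real k + 1) * x" unfolding 1 2[symmetric] by (simp add: algebra_simps)
  also have "\<dots> = (real k + 1) * (real q + 1) * (x / (real q + 1))" by simp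
  finally have "y - real q * z / (real k + 1) = x / (real q + 1)"
    by (simp del: times_divide_eq_right)
  then show ?thesis unfolding eq x_def y_def .
qed

theorem theorem5p1:
  fixes \<alpha> :: "nat \<Rightarrow> ereal" and q k :: nat and \<tau> :: real
  assumes \<alpha>_nonneg: "\<And>i. i \<ge> 1 \<Longrightarrow> 0 \<le> \<alpha> i"
    and q_def: "q = (LEAST i. i \<ge> 1 \<and> \<alpha> i > 0)"
    and k_ge_1: "k \<ge> 1"
    and critical_less: "(\<Sum>i=1..k. ereal (real (k choose i)) * \<alpha> i) < 1"
    and critical_greater: "1 < (\<Sum>i=1..k+1. ereal (real ((k + 1) choose i)) * \<alpha> i)"
    and q_le_k: "q \<le> k"
    and intermediate: "q < k \<Longrightarrow> \<forall>k0\<in>{q+1..k}.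
          ereal ((real k - real q) / (real k + 1) * real ((k + 1) choose (q + 1))) * \<alpha> q
            + (\<Sum>j=q+1..k0. ereal (real ((k + 1) choose (j + 1))) * \<alpha> j)
          < ereal (real k0 - real q)"
    and lower_cond: "(\<Sum>i=q..k+1. ereal (real ((k + 1) choose i)) * \<alpha> i) - 1
          \<ge> ereal (real q * fact (k + 2) / (fact (q + 1) * fact (k + 1 - q) * (real k + 1))) * \<alpha> q"
    and \<tau>_def: "\<tau> = real k + 1 - (\<Sum>i=1..k. real ((k + 1) choose (i + 1)) * real_of_ereal (\<alpha> i))"
  shows "\<forall>\<epsilon>>0. \<exists>C1>0. \<exists>C2>0. \<forall>\<^sub>F n in sequentially.
     (let P = measure_pmf.prob (random_complex n (\<lambda>i. neg_power n (\<alpha> i)))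
                {K. real (betti k K) \<ge> (1 + \<epsilon>) * (real n powr \<tau> / fact (k + 1))};
          r = real n powr (real q + 1 - real (k choose q) * real_of_ereal (\<alpha> q))
      in exp (- C1 * r * ln (real n)) \<le> P \<and> P \<le> exp (- C2 * r))"
proof -
  define a where "a i = real_of_ereal (\<alpha> i)" for i
  define fin where "fin \<longleftrightarrow> \<alpha> (k + 1) \<noteq> \<infinity>"
  \<comment> \<open>\<open>\<alpha>_nonneg\<close> starts at index 1, so the default 1 at index 0
    keeps all values in [0, 1]. The law of the complex reads positive indices only.\<close>
  define p where "p n i = (if i = 0 then 1 else neg_power n (\<alpha> i))" for n i
  have nonneg: "0 \<le> a i" if "1 \<le> i" for i unfolding a_def using \<alpha>_nonneg[OF that] by (rule real_of_ereal_pos)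
  \<comment> \<open>Otherwise the supercritical sum would be 0. Hence the \<open>LEAST\<close> that
    defines \<open>q\<close> is attained.\<close>
  have "\<exists>i. 1 \<le> i \<and> 0 < \<alpha> i"
  proof (rule ccontr)
    assume "\<not> ?thesis"
    then have "\<alpha> i = 0" if "1 \<le> i" for i using \<alpha>_nonneg[OF that] that by (metis order_le_less)
    then have "(\<Sum>i=1..k+1. ereal (real ((k + 1) choose i)) * \<alpha> i) = 0" by (intro sum.neutral) auto
    then show False using critical_greater by simp
  qed
  then have q: "1 \<le> q" "0 < \<alpha> q" unfolding q_def by (metis (mono_tags, lifting) LeastI)+
  have below: "\<alpha> i = 0" if "1 \<le> i" "i < q" for i
  proof -
    have "\<not> (1 \<le> i \<and> 0 < \<alpha> i)" using that(2) unfolding q_def by (rule not_less_Least)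
    then show ?thesis using that(1) \<alpha>_nonneg[OF that(1)] by (metis order_le_less)
  qed
  have finite: "\<alpha> i \<noteq> \<infinity>" if i: "1 \<le> i" "i \<le> k" for i
  proof
    assume "\<alpha> i = \<infinity>"
    then have "ereal (real (k choose i)) * \<alpha> i = \<infinity>" using i by simp
    moreover have "(\<Sum>i\<in>{i}. ereal (real (k choose i)) * \<alpha> i) \<le> (\<Sum>i=1..k. ereal (real (k choose i)) * \<alpha> i)"
      using i \<alpha>_nonneg by (intro sum_mono2) auto
    ultimately show False using critical_less by auto
  qed
  have real: "\<bar>\<alpha> i\<bar> \<noteq> \<infinity>" if "1 \<le> i" "i \<le> k" for i
    using finite[OF that] \<alpha>_nonneg[OF that(1)] by auto
  have real': "\<bar>\<alpha> i\<bar> \<noteq> \<infinity>" if "1 \<le> i" "i \<le> k + 1" fin for i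
    using real[of i] that \<alpha>_nonneg[OF that(1)] by (cases "i = k + 1") (auto simp: fin_def)
  have from_q: "(\<Sum>i=1..m. c i * a i) = (\<Sum>i=q..m. c i * a i)" for c and m :: nat
    using q below by (intro sum.mono_neutral_right) (auto simp: a_def)
  have \<tau>_eq: "\<tau> = real k + 1 - (\<Sum>i=q..k. real ((k + 1) choose (i + 1)) * a i)"
    unfolding \<tau>_def a_def[symmetric] from_q ..
  interpret exponents a q k fin p
  proof
    show "1 \<le> q" "q \<le> k" by (fact q(1), fact q_le_k)
    show "0 < a q" unfolding a_def using q real[of q] q_le_k by (cases "\<alpha> q") auto
    show "a i = 0" if "1 \<le> i" "i < q" for i using below[OF that] by (simp add: a_def)
    show "p n i = real n powr - a i" if "1 \<le> n" "1 \<le> i" "i \<le> k" for n i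
      using that finite by (simp add: p_def neg_power_def a_def)
    show "0 \<le> p n i" if "1 \<le> n" for n i by (simp add: p_def neg_power_def)
    show "p n i \<le> 1" if "1 \<le> n" for n i
    proof (cases "i = 0 \<or> \<alpha> i = \<infinity>")
      case False
      then have "real n powr - a i \<le> real n powr 0" using that nonneg[of i] by (intro powr_mono) auto
      then show ?thesis using False that by (simp add: p_def neg_power_def a_def)
    qed (auto simp: p_def neg_power_def)
    show "p n (k + 1) = (if fin then real n powr - a (k + 1) else 0)" if "1 \<le> n" for n
      by (simp add: p_def neg_power_def fin_def a_def)
    show "(\<Sum>i=q..k. real (k choose i) * a i) < 1"
      using critical_less real unfolding from_q[symmetric]
      by (subst (asm) sum_ereal_mult) (auto simp: a_def)
    show "1 < (\<Sum>i=q..k+1. real ((k + 1) choose i) * a i)" if fin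
      using critical_greater real'[OF _ _ that] unfolding from_q[symmetric]
      by (subst (asm) sum_ereal_mult) (auto simp: a_def)
    have aq: "\<alpha> q = ereal (a q)" using real[OF q(1) q_le_k] by (simp add: a_def ereal_real)
    show "real (k choose (q + 1)) * a q + (\<Sum>i=q+1..j. real ((k + 1) choose (i + 1)) * a i) < real j - real q"
      if j: "q + 1 \<le> j" "j \<le> k" for j
    proof -
      have "ereal ((real k - real q) / (real k + 1) * real ((k + 1) choose (q + 1))) * \<alpha> q
            + (\<Sum>i=q+1..j. ereal (real ((k + 1) choose (i + 1))) * \<alpha> i) < ereal (real j - real q)"
        using intermediate j by auto
      moreover have "(\<Sum>i=q+1..j. ereal (real ((k + 1) choose (i + 1))) * \<alpha> i) = ereal (\<Sum>i=q+1..j. real ((k + 1) choose (i + 1)) * a i)"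
        unfolding a_def using real q(1) j by (intro sum_ereal_mult) auto
      ultimately show ?thesis
        unfolding binomial_identity_mid[OF q_le_k] aq times_ereal.simps plus_ereal.simps less_ereal.simps by simp
    qed
    show "1 \<le> real (k choose q) / (real q + 1) * a q + (\<Sum>i=q+1..k+1. real ((k + 1) choose i) * a i)" if fin
    proof -
      define L where "L = real q * fact (k + 2) / (fact (q + 1) * fact (k + 1 - q) * (real k + 1))"
      have "(\<Sum>i=q..k+1. ereal (real ((k + 1) choose i)) * \<alpha> i) = ereal (\<Sum>i=q..k+1. real ((k + 1) choose i) * a i)"
        unfolding a_def using real'[OF _ _ that] q(1) by (intro sum_ereal_mult) auto
      then have "L * a q \<le> (\<Sum>i=q..k+1. real ((k + 1) choose i) * a i) - 1"
        using lower_cond unfolding L_def[symmetric] aq by (simp add: one_ereal_def)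
      also have "(\<Sum>i=q..k+1. real ((k + 1) choose i) * a i) = real ((k + 1) choose q) * a q + (\<Sum>i=q+1..k+1. real ((k + 1) choose i) * a i)"
        using q_le_k by (subst sum.atLeast_Suc_atMost) auto
      finally have "1 \<le> (real ((k + 1) choose q) - L) * a q + (\<Sum>i=q+1..k+1. real ((k + 1) choose i) * a i)"
        by (simp add: algebra_simps)
      then show ?thesis unfolding L_def binomial_identity_low[OF q_le_k] .
    qed
    show "0 \<le> a i" if "1 \<le> i" for i using that by (rule nonneg)
  qed
  have \<tau>: "exponents.\<tau> a q k = \<tau>"
    unfolding \<tau>_eq by (rule exponents.\<tau>_def[OF exponents_axioms])
  have rate: "real n powr (real q + 1 - real (k choose q) * real_of_ereal (\<alpha> q)) = rate n" for n
    by (simp add: rate_def a_def)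
  have complex: "random_complex n (\<lambda>i. neg_power n (\<alpha> i)) = map_pmf (coin_complex n (n - 1)) (coin_pmf n (p n) (n - 1))" for n
  proof -
    have "random_complex n (\<lambda>i. neg_power n (\<alpha> i)) = random_skeleton n (p n) (n - 1)"
      unfolding random_complex_def by (rule random_skeleton_cong) (simp add: p_def)
    then show ?thesis by (simp add: random_skeleton_eq)
  qed
  have prob: "measure_pmf.prob (random_complex n (\<lambda>i. neg_power n (\<alpha> i))) {K. \<theta> \<le> real (betti k K)}
    = measure_pmf.prob (coin_pmf n (p n) (n - 1)) {F. \<theta> \<le> real (betti k (coin_complex n (n - 1) F))}" for n \<theta>
    unfolding complex measure_map_pmf by (simp add: vimage_def)
  show ?thesis
  proof (intro allI impI)
    fix \<epsilon> :: real assume \<epsilon>: "0 < \<epsilon>"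
    obtain C1 where C1: "0 < C1" and lower: "\<forall>\<^sub>F n in sequentially. exp (- C1 * rate n * ln (real n)) \<le>
      measure_pmf.prob (coin_pmf n (p n) (n - 1)) {F. (1 + \<epsilon>) * (real n powr \<tau> / fact (k + 1))
        \<le> simplex_count n k F - simplex_count n (k - 1) F - simplex_count n (k + 1) F}"
      using lower_tail[OF \<epsilon>] unfolding \<tau> by blast
    obtain C2 where C2: "0 < C2" and upper: "\<forall>\<^sub>F n in sequentially.
      measure_pmf.prob (coin_pmf n (p n) (n - 1)) {F. (1 + \<epsilon>) * (real n powr \<tau> / fact (k + 1)) \<le> simplex_count n k F}
        \<le> exp (- C2 * rate n)"
      using upper_tail[OF \<epsilon>] unfolding \<tau> by blast
    have "\<forall>\<^sub>F n in sequentially.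
     (let P = measure_pmf.prob (random_complex n (\<lambda>i. neg_power n (\<alpha> i)))
                {K. real (betti k K) \<ge> (1 + \<epsilon>) * (real n powr \<tau> / fact (k + 1))};
          r = real n powr (real q + 1 - real (k choose q) * real_of_ereal (\<alpha> q))
      in exp (- C1 * r * ln (real n)) \<le> P \<and> P \<le> exp (- C2 * r))"
      using lower upper eventually_ge_at_top[of "k + 2"]
    proof eventually_elim
      case (elim n)
      define \<theta> where "\<theta> = (1 + \<epsilon>) * (real n powr \<tau> / fact (k + 1))"
      let ?M = "coin_pmf n (p n) (n - 1)"
      have n: "k \<le> n - 1" "k + 1 \<le> n - 1" using elim(3) by auto
      have "measure_pmf.prob ?M {F. \<theta> \<le> simplex_count n k F - simplex_count n (k - 1) F - simplex_count n (k + 1) F}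
        \<le> measure_pmf.prob ?M {F. \<theta> \<le> real (betti k (coin_complex n (n - 1) F))}"
        using betti_coin_complex_ge[OF k_ge_1 n(2)]
        by (intro measure_pmf.finite_measure_mono) (auto intro: order_trans)
      moreover have "measure_pmf.prob ?M {F. \<theta> \<le> real (betti k (coin_complex n (n - 1) F))}
        \<le> measure_pmf.prob ?M {F. \<theta> \<le> simplex_count n k F}"
        using betti_coin_complex_le[OF k_ge_1 n(1)]
        by (intro measure_pmf.finite_measure_mono) (auto intro: order_trans)
      ultimately show ?case
        using elim(1,2) unfolding Let_def rate prob \<theta>_def[symmetric] by linarith
    qed
    then show "\<exists>C1>0. \<exists>C2>0. \<forall>\<^sub>F n in sequentially.
     (let P = measure_pmf.prob (random_complex n (\<lambda>i. neg_power n (\<alpha> i)))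
                {K. real (betti k K) \<ge> (1 + \<epsilon>) * (real n powr \<tau> / fact (k + 1))};
          r = real n powr (real q + 1 - real (k choose q) * real_of_ereal (\<alpha> q))
      in exp (- C1 * r * ln (real n)) \<le> P \<and> P \<le> exp (- C2 * r))"
      using C1 C2 by blast
  qed
qed

end
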